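(* Let $0<\alpha<1$, let $\Psi\in E^\infty(B_a)$, and let $u\in C^{2,\alpha}(B_a)$ with $u\ge0$ be a solution on $B_a$ of $$\Delta u=-\frac{\Psi^2(x)}{(1+r u)^7}.$$ Then $u\in E^\infty(B_a)$.
   Context: $B_a\subset\mathbb R^3$ is the open ball of radius $a$ centered at the origin, $r=|x|$, $\Delta$ the flat Laplacian. $C^{m,\alpha}(B_a)$ denotes functions with derivatives up to order $m$ that are $\alpha$-Hölder continuous on compact subsets of $B_a$. $E^\infty(B_a)=\{f=f_1+rf_2:\ f_1,f_2\in C^\infty(B_a)\}$. *)

theory Defs
  imports "HOL-Analysis.Analysis"
begin

definition pdiff :: "'n::finite \<Rightarrow> (real^'n \<Rightarrow> real) \<Rightarrow> real^'n \<Rightarrow> real" where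
  "pdiff i f x = deriv (\<lambda>t. f (x + t *\<^sub>R axis i 1)) 0"

text \<open>k times continuously differentiable on S (S open): f differentiable,
  all partial derivatives of class C^(k-1).\<close>
fun Ck_on :: "nat \<Rightarrow> (real^'n::finite) set \<Rightarrow> (real^'n \<Rightarrow> real) \<Rightarrow> bool" where
  "Ck_on 0 S f = continuous_on S f"
| "Ck_on (Suc k) S f = ((\<forall>x\<in>S. f differentiable (at x)) \<and> (\<forall>i. Ck_on k S (pdiff i f)))"

definition smooth_on :: "(real^'n::finite) set \<Rightarrow> (real^'n \<Rightarrow> real) \<Rightarrow> bool" where
  "smooth_on S f \<longleftrightarrow> (\<forall>k. Ck_on k S f)"

definition loc_holder_on :: "real \<Rightarrow> (real^'n::finite) set \<Rightarrow> (real^'n \<Rightarrow> real) \<Rightarrow> bool" where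
  "loc_holder_on \<alpha> S g \<longleftrightarrow>
     (\<forall>K. compact K \<and> K \<subseteq> S \<longrightarrow>
        (\<exists>C. \<forall>x\<in>K. \<forall>y\<in>K. \<bar>g x - g y\<bar> \<le> C * dist x y powr \<alpha>))"

definition C2alpha_on :: "real \<Rightarrow> (real^'n::finite) set \<Rightarrow> (real^'n \<Rightarrow> real) \<Rightarrow> bool" where
  "C2alpha_on \<alpha> S u \<longleftrightarrow> Ck_on 2 S u \<and> loc_holder_on \<alpha> S u
     \<and> (\<forall>i. loc_holder_on \<alpha> S (pdiff i u))
     \<and> (\<forall>i j. loc_holder_on \<alpha> S (pdiff i (pdiff j u)))"

definition Einf_on :: "(real^'n::finite) set \<Rightarrow> (real^'n \<Rightarrow> real) \<Rightarrow> bool" where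
  "Einf_on S f \<longleftrightarrow> (\<exists>f1 f2. smooth_on S f1 \<and> smooth_on S f2 \<and>
       (\<forall>x\<in>S. f x = f1 x + norm x * f2 x))"

definition laplacian :: "(real^'n::finite \<Rightarrow> real) \<Rightarrow> real^'n \<Rightarrow> real" where
  "laplacian u x = (\<Sum>i\<in>UNIV. pdiff i (pdiff i u) x)"

end

theory Submission
  imports Defs "HOL-Library.Landau_Symbols"
begin

text \<open>
  Work with expansions \<open>u = P + r Q + R\<close>, where \<open>P, Q\<close> are polynomials and the remainder
  \<open>R\<close> is \<open>C^m\<close> off the origin with \<open>\<partial>^\<beta> R = O(r^(s - |\<beta>|))\<close> for \<open>|\<beta>| \<le> m\<close>. Such expansions
  form an algebra, and \<open>1/(1 + r u)\<close> has one to order \<open>s + 1\<close> if \<open>u\<close> has one to order \<open>s\<close>, because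
  of the factor \<open>r\<close>. On the polynomial part the Poisson equation is solved explicitly: for \<open>p\<close>
  homogeneous of degree \<open>k\<close>, \<open>\<Delta>(r^(s+2) p) = (s+2)(s+n+2k) r^s p + r^(s+2) \<Delta>p\<close>, and iterating
  terminates. After subtracting this solution the right-hand side is \<open>C^m\<close> across the origin, so
  interior regularity makes the difference \<open>C^(m+1)\<close>; its Taylor polynomial improves the expansion
  of \<open>u\<close> by one order. Expansions to all orders are summed by Borel's theorem, applied separately
  to the coefficients of \<open>1\<close> and of \<open>r\<close>, and the flat remainder is smooth.
\<close>

section \<open>Partial derivatives and C^k functions\<close>

text \<open>The obstacle is that r is not smooth at the origin, so the right-hand side need not be
  smooth however regular u is, and regularity has to be measured modulo P + r Q. These sums are
  closed under products because r^2 is a polynomial, and under solving the Poisson equation because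
  the multiplier (s+2)(s+n+2k) is positive for every s >= 0: there is no resonance and no logarithm.
  One spare power of r drives the induction. A remainder O(r^s) with m controlled derivatives
  extends by 0 to a C^m function when s > m; for s = m its derivatives of order m are in general
  only bounded. The factor r in 1 + r u turns order m with m derivatives into order m + 1 with m
  derivatives, which is exactly the strict inequality. Hence a gain of a single derivative over the
  right-hand side of the Laplace equation is enough for each step, and this gain comes from a
  mollified mean value identity. The sign u >= 0 gives 1 + r u >= 1, so that the reciprocal stays in
  the class.\<close>

lemma pdiff_has_derivative:
  assumes "(f has_derivative f') (at x)"
  shows "pdiff i f x = f' (axis i 1)"
proof -
  have "((\<lambda>t::real. x + t *\<^sub>R axis i 1) has_derivative (\<lambda>t. t *\<^sub>R axis i 1)) (at 0)"
    by (auto intro!: derivative_eq_intros)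
  moreover have "(f has_derivative f') (at (x + (0::real) *\<^sub>R axis i 1))"
    using assms by simp
  ultimately have "((\<lambda>t. f (x + t *\<^sub>R axis i 1)) has_derivative (\<lambda>t. f' (t *\<^sub>R axis i 1))) (at 0)"
    by (rule has_derivative_compose)
  moreover have "(\<lambda>t. f' (t *\<^sub>R axis i 1)) = (*) (f' (axis i 1))"
    using linear_cmul[OF has_derivative_linear[OF assms]] by (auto simp: mult.commute)
  ultimately show ?thesis
    unfolding pdiff_def by (intro DERIV_imp_deriv) (simp add: has_field_derivative_def)
qed

text \<open>A linear map is determined by its values on the axes. The rules for sums, products and
  compositions below are obtained by evaluating this normal form at an axis vector.\<close>

lemma has_derivative_pdiff:
  assumes "f differentiable at x"
  shows "(f has_derivative (\<lambda>h. \<Sum>i\<in>UNIV. h $ i * pdiff i f x)) (at x)"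
proof -
  obtain f' where f': "(f has_derivative f') (at x)"
    using assms by (auto simp: differentiable_def)
  interpret linear f' by (rule has_derivative_linear[OF f'])
  have "f' h = (\<Sum>i\<in>UNIV. h $ i * pdiff i f x)" for h
  proof -
    have "f' h = f' (\<Sum>i\<in>UNIV. h $ i *\<^sub>R axis i 1)"
      using basis_expansion[of h] by (simp add: scalar_mult_eq_scaleR)
    also have "\<dots> = (\<Sum>i\<in>UNIV. h $ i * f' (axis i 1))"
      by (simp add: sum scale)
    finally show ?thesis using pdiff_has_derivative[OF f'] by simp
  qed
  then have "f' = (\<lambda>h. \<Sum>i\<in>UNIV. h $ i * pdiff i f x)" by (rule ext)
  with f' show ?thesis by simp
qed

lemma pdiff_cong:
  assumes "open S" "x \<in> S" "\<And>y. y \<in> S \<Longrightarrow> f y = g y"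
  shows "pdiff i f x = pdiff i g x"
proof -
  have "((\<lambda>t::real. x + t *\<^sub>R axis i 1) \<longlongrightarrow> x + 0 *\<^sub>R axis i 1) (nhds 0)"
    by (intro tendsto_intros filterlim_ident)
  then have "\<forall>\<^sub>F t in nhds (0::real). x + t *\<^sub>R axis i 1 \<in> S"
    using assms(1,2) by (intro topological_tendstoD) auto
  then have "\<forall>\<^sub>F t in nhds (0::real). f (x + t *\<^sub>R axis i 1) = g (x + t *\<^sub>R axis i 1)"
    by eventually_elim (use assms(3) in auto)
  then show ?thesis unfolding pdiff_def by (intro deriv_cong_ev) auto
qed

lemma differentiable_cong:
  assumes "open S" "x \<in> S" "\<And>y. y \<in> S \<Longrightarrow> f y = g y" "f differentiable at x"
  shows "g differentiable at x"
  using assms unfolding differentiable_def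
  by (meson has_derivative_transform_within_open)

lemma pdiff_add:
  assumes "f differentiable at x" "g differentiable at x"
  shows "pdiff i (\<lambda>x. f x + g x) x = pdiff i f x + pdiff i g x"
  by (subst pdiff_has_derivative[OF has_derivative_add[OF has_derivative_pdiff[OF assms(1)] has_derivative_pdiff[OF assms(2)]]])
     (simp add: axis_def if_distrib if_distribR cong: if_cong)

lemma pdiff_diff:
  assumes "f differentiable at x" "g differentiable at x"
  shows "pdiff i (\<lambda>x. f x - g x) x = pdiff i f x - pdiff i g x"
  by (subst pdiff_has_derivative[OF has_derivative_diff[OF has_derivative_pdiff[OF assms(1)] has_derivative_pdiff[OF assms(2)]]])
     (simp add: axis_def if_distrib if_distribR cong: if_cong)

lemma pdiff_mult:
  assumes "f differentiable at x" "g differentiable at x"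
  shows "pdiff i (\<lambda>x. f x * g x) x = pdiff i f x * g x + f x * pdiff i g x"
  by (subst pdiff_has_derivative[OF has_derivative_mult[OF has_derivative_pdiff[OF assms(1)] has_derivative_pdiff[OF assms(2)]]])
     (simp add: axis_def if_distrib if_distribR cong: if_cong)

lemma pdiff_const [simp]: "pdiff i (\<lambda>x. c) = (\<lambda>x. 0)"
  by (auto simp: pdiff_def)

lemma pdiff_coord:
  fixes x :: "real^'n::finite"
  shows "pdiff i (\<lambda>x. x $ j) x = (if i = j then 1 else 0)"
proof -
  have "((\<lambda>x::real^'n. x $ j) has_derivative (\<lambda>h. h $ j)) (at x)"
    by (intro bounded_linear_imp_has_derivative bounded_linear_vec_nth)
  from pdiff_has_derivative[OF this] show ?thesis by (simp add: axis_def)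
qed

lemma differentiable_coord [simp]: "(\<lambda>x::real^'n. x $ j) differentiable at x"
  using bounded_linear_imp_has_derivative[OF bounded_linear_vec_nth]
  by (auto simp: differentiable_def)

lemma pdiff_chain_real:
  assumes "(h has_real_derivative h') (at (f x))" "f differentiable at x"
  shows "(\<lambda>x. h (f x)) differentiable at x" "pdiff i (\<lambda>x. h (f x)) x = h' * pdiff i f x"
proof -
  have d: "((\<lambda>x. h (f x)) has_derivative (\<lambda>y. h' * (\<Sum>i\<in>UNIV. y $ i * pdiff i f x))) (at x)"
    using has_derivative_compose[OF has_derivative_pdiff[OF assms(2)]] assms(1)
    unfolding has_field_derivative_def by blast
  show "(\<lambda>x. h (f x)) differentiable at x" using d by (auto simp: differentiable_def)
  show "pdiff i (\<lambda>x. h (f x)) x = h' * pdiff i f x"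
    by (subst pdiff_has_derivative[OF d]) (simp add: axis_def if_distrib if_distribR cong: if_cong)
qed

lemma pdiff_affine:
  assumes "f differentiable at (y + c *\<^sub>R x)"
  shows "(\<lambda>x. f (y + c *\<^sub>R x)) differentiable at x"
    "pdiff i (\<lambda>x. f (y + c *\<^sub>R x)) x = c * pdiff i f (y + c *\<^sub>R x)"
proof -
  have "((\<lambda>x. y + c *\<^sub>R x) has_derivative (\<lambda>h. c *\<^sub>R h)) (at x)"
    by (auto intro!: derivative_eq_intros)
  from has_derivative_compose[OF this has_derivative_pdiff[OF assms]]
  have d: "((\<lambda>x. f (y + c *\<^sub>R x)) has_derivative
      (\<lambda>h. \<Sum>i\<in>UNIV. (c *\<^sub>R h) $ i * pdiff i f (y + c *\<^sub>R x))) (at x)" .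
  show "(\<lambda>x. f (y + c *\<^sub>R x)) differentiable at x" using d by (auto simp: differentiable_def)
  show "pdiff i (\<lambda>x. f (y + c *\<^sub>R x)) x = c * pdiff i f (y + c *\<^sub>R x)"
    by (subst pdiff_has_derivative[OF d]) (simp add: axis_def if_distrib if_distribR cong: if_cong)
qed

lemma Ck_on_cong:
  assumes "open S" "\<And>x. x \<in> S \<Longrightarrow> f x = g x" "Ck_on k S f"
  shows "Ck_on k S g"
  using assms(2,3)
proof (induction k arbitrary: f g)
  case 0
  then show ?case by (simp cong: continuous_on_cong)
next
  case (Suc k)
  have "g differentiable at x" if "x \<in> S" for x
    using differentiable_cong[OF assms(1) that Suc.prems(1)] Suc.prems(2) that by auto
  moreover have "Ck_on k S (pdiff i g)" for i
    using Suc.IH[of "pdiff i f"] pdiff_cong[OF assms(1) _ Suc.prems(1)] Suc.prems(2) by auto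
  ultimately show ?case by simp
qed

lemma Ck_on_SucD: "Ck_on (Suc k) S f \<Longrightarrow> Ck_on k S f"
proof (induction k arbitrary: f)
  case 0
  then show ?case
    by (auto intro!: continuous_at_imp_continuous_on differentiable_imp_continuous_within)
next
  case (Suc k)
  then show ?case by simp
qed

lemma Ck_on_mono: "l \<le> k \<Longrightarrow> Ck_on k S f \<Longrightarrow> Ck_on l S f"
  by (induction rule: dec_induct) (auto intro: Ck_on_SucD simp del: Ck_on.simps)

lemma Ck_on_imp_continuous: "Ck_on k S f \<Longrightarrow> continuous_on S f"
  using Ck_on_mono[of 0 k] by simp

lemma Ck_on_subset: "T \<subseteq> S \<Longrightarrow> Ck_on k S f \<Longrightarrow> Ck_on k T f"
  by (induction k arbitrary: f) (auto intro: continuous_on_subset)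

text \<open>Used to glue a function on an open set with zero elsewhere, and to reduce interior
  regularity to small balls, which are convex and leave room for translates.\<close>

lemma Ck_on_local:
  assumes "\<And>x. x \<in> S \<Longrightarrow> \<exists>U. open U \<and> x \<in> U \<and> Ck_on k U f"
  shows "Ck_on k S f"
  using assms
proof (induction k arbitrary: f)
  case 0
  have "continuous (at x) f" if "x \<in> S" for x
    using 0[OF that] by (auto simp: continuous_on_eq_continuous_at)
  then show ?case by (simp add: continuous_at_imp_continuous_on)
next
  case (Suc k)
  show ?case
  proof (simp, intro conjI ballI allI)
    show "f differentiable at x" if "x \<in> S" for x using Suc.prems[OF that] by auto
    show "Ck_on k S (pdiff i f)" for i
      by (rule Suc.IH) (use Suc.prems in fastforce)
  qed
qed

lemma Ck_on_const [simp]: "Ck_on k S (\<lambda>x. c)"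
  by (induction k arbitrary: c) auto

lemma Ck_on_coord [simp]: "Ck_on k S (\<lambda>x. x $ j)"
proof (cases k)
  case 0
  then show ?thesis by (auto intro!: continuous_intros)
next
  case (Suc l)
  have "pdiff i (\<lambda>x. x $ j) = (\<lambda>x. if i = j then 1 else 0)" for i :: 'a
    by (auto simp: pdiff_coord)
  with Suc show ?thesis by auto
qed

lemma Ck_on_add:
  assumes "open S" "Ck_on k S f" "Ck_on k S g"
  shows "Ck_on k S (\<lambda>x. f x + g x)"
  using assms(2,3)
proof (induction k arbitrary: f g)
  case 0
  then show ?case by (auto intro: continuous_intros)
next
  case (Suc k)
  have "Ck_on k S (pdiff i (\<lambda>x. f x + g x))" for i
    by (rule Ck_on_cong[OF assms(1) _ Suc.IH[of "pdiff i f" "pdiff i g"]])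
       (use Suc.prems in \<open>auto simp: pdiff_add\<close>)
  then show ?case using Suc.prems by auto
qed

lemma Ck_on_mult:
  assumes "open S" "Ck_on k S f" "Ck_on k S g"
  shows "Ck_on k S (\<lambda>x. f x * g x)"
  using assms(2,3)
proof (induction k arbitrary: f g)
  case 0
  then show ?case by (auto intro: continuous_intros)
next
  case (Suc k)
  have "Ck_on k S (pdiff i (\<lambda>x. f x * g x))" for i
  proof (rule Ck_on_cong[OF assms(1)])
    show "Ck_on k S (\<lambda>x. pdiff i f x * g x + f x * pdiff i g x)"
      using Suc.prems Suc.prems[THEN Ck_on_SucD] by (intro Ck_on_add assms(1) Suc.IH) auto
  qed (use Suc.prems in \<open>auto simp: pdiff_mult\<close>)
  then show ?case using Suc.prems by auto
qed

lemma Ck_on_cmult: "open S \<Longrightarrow> Ck_on k S f \<Longrightarrow> Ck_on k S (\<lambda>x. c * f x)"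
  using Ck_on_mult[of S k "\<lambda>x. c"] by auto

lemma Ck_on_diff:
  assumes "open S" "Ck_on k S f" "Ck_on k S g"
  shows "Ck_on k S (\<lambda>x. f x - g x)"
  using Ck_on_add[OF assms(1,2) Ck_on_cmult[OF assms(1,3), of "-1"]] by simp

lemma Ck_on_sum:
  assumes "open S" "\<And>a. a \<in> A \<Longrightarrow> Ck_on k S (f a)"
  shows "Ck_on k S (\<lambda>x. \<Sum>a\<in>A. f a x)"
  using assms(2) by (induction A rule: infinite_finite_induct) (auto intro: Ck_on_add[OF assms(1)])

lemma Ck_on_inverse:
  assumes "open S" "Ck_on k S f" "\<And>x. x \<in> S \<Longrightarrow> f x \<noteq> 0"
  shows "Ck_on k S (\<lambda>x. inverse (f x))"
  using assms(2)
proof (induction k)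
  case 0
  then show ?case using assms(3) by (auto intro: continuous_intros)
next
  case (Suc k)
  have d: "(inverse has_real_derivative - (inverse (f x) * inverse (f x))) (at (f x))" if "x \<in> S" for x
    using DERIV_inverse[of "f x"] assms(3)[OF that] by (simp add: power2_eq_square)
  have "Ck_on k S (pdiff i (\<lambda>x. inverse (f x)))" for i
  proof (rule Ck_on_cong[OF assms(1)])
    \<comment> \<open>The derivative is written through 1/f itself, so the induction hypothesis
      applies with the same \<open>f\<close>.\<close>
    show "Ck_on k S (\<lambda>x. (-1) * ((inverse (f x) * inverse (f x)) * pdiff i f x))"
      using Suc Ck_on_SucD by (intro Ck_on_mult Ck_on_cmult assms(1)) auto
    show "(-1) * ((inverse (f x) * inverse (f x)) * pdiff i f x) = pdiff i (\<lambda>x. inverse (f x)) x"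
      if "x \<in> S" for x
      using pdiff_chain_real(2)[where f=f, OF d[OF that]] that Suc.prems by simp
  qed
  moreover have "(\<lambda>x. inverse (f x)) differentiable at x" if "x \<in> S" for x
    using pdiff_chain_real(1)[where f=f, OF d[OF that]] that Suc.prems by simp
  ultimately show ?case by simp
qed

lemma Ck_on_affine:
  assumes "open S" "Ck_on k S f"
  shows "Ck_on k {x. y + c *\<^sub>R x \<in> S} (\<lambda>x. f (y + c *\<^sub>R x))"
proof -
  let ?T = "{x. y + c *\<^sub>R x \<in> S}"
  have T: "open ?T"
  proof -
    have "continuous_on UNIV (\<lambda>x. y + c *\<^sub>R x)" by (intro continuous_intros)
    from open_vimage[OF assms(1) this] show ?thesis by (simp add: vimage_def)
  qed
  show ?thesis using assms(2)
  proof (induction k arbitrary: f)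
    case 0
    then show ?case
      by (auto intro!: continuous_on_compose2[OF 0[simplified]] continuous_intros)
  next
    case (Suc k)
    have "Ck_on k ?T (pdiff i (\<lambda>x. f (y + c *\<^sub>R x)))" for i
      by (rule Ck_on_cong[OF T, of "\<lambda>x. c * pdiff i f (y + c *\<^sub>R x)"])
         (use Suc pdiff_affine(2)[of f y c] in \<open>auto intro: Ck_on_cmult[OF T]\<close>)
    then show ?case using Suc.prems by (auto intro: pdiff_affine(1))
  qed
qed

lemma smooth_on_add: "open S \<Longrightarrow> smooth_on S f \<Longrightarrow> smooth_on S g \<Longrightarrow> smooth_on S (\<lambda>x. f x + g x)"
  by (auto simp: smooth_on_def intro: Ck_on_add)

lemma smooth_on_mult: "open S \<Longrightarrow> smooth_on S f \<Longrightarrow> smooth_on S g \<Longrightarrow> smooth_on S (\<lambda>x. f x * g x)"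
  by (auto simp: smooth_on_def intro: Ck_on_mult)

lemma smooth_on_pdiff: "smooth_on S f \<Longrightarrow> smooth_on S (pdiff i f)"
  unfolding smooth_on_def by (metis Ck_on.simps(2))

lemma smooth_on_differentiable: "smooth_on S f \<Longrightarrow> x \<in> S \<Longrightarrow> f differentiable at x"
  unfolding smooth_on_def by (metis Ck_on.simps(2))

lemma smooth_on_continuous: "smooth_on S f \<Longrightarrow> continuous_on S f"
  unfolding smooth_on_def by (metis Ck_on.simps(1))

section \<open>Symbol classes at the origin and Taylor expansion\<close>

lemma has_real_derivative_line:
  assumes "f differentiable at (z + s *\<^sub>R v)"
  shows "((\<lambda>s. f (z + s *\<^sub>R v)) has_real_derivative (\<Sum>i\<in>UNIV. v $ i * pdiff i f (z + s *\<^sub>R v))) (at s)"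
proof -
  have "((\<lambda>s. z + s *\<^sub>R v) has_derivative (\<lambda>h. h *\<^sub>R v)) (at s)"
    by (auto intro!: derivative_eq_intros)
  from has_derivative_compose[OF this has_derivative_pdiff[OF assms]]
  have "((\<lambda>s. f (z + s *\<^sub>R v)) has_derivative
      (\<lambda>h. \<Sum>i\<in>UNIV. (h *\<^sub>R v) $ i * pdiff i f (z + s *\<^sub>R v))) (at s)" .
  moreover have "(\<lambda>h. \<Sum>i\<in>UNIV. (h *\<^sub>R v) $ i * pdiff i f (z + s *\<^sub>R v))
      = (*) (\<Sum>i\<in>UNIV. v $ i * pdiff i f (z + s *\<^sub>R v))"
    by (auto simp: fun_eq_iff sum_distrib_left mult_ac)
  ultimately show ?thesis by (simp add: has_field_derivative_def)
qed

lemma has_real_derivative_axis: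
  assumes "f differentiable at (z + s *\<^sub>R axis i 1)"
  shows "((\<lambda>s. f (z + s *\<^sub>R axis i 1)) has_real_derivative pdiff i f (z + s *\<^sub>R axis i 1)) (at s)"
  using has_real_derivative_line[OF assms] by (simp add: axis_def if_distrib if_distribR cong: if_cong)

text \<open>Two applications of the mean value theorem: in direction \<open>i\<close> to the
  difference along two parallel segments, then in direction \<open>j\<close> to the derivative so
  obtained. The radius \<open>2 * t\<close> leaves room for two shifts of length below
  \<open>t\<close>.\<close>

lemma second_difference_mvt:
  fixes x :: "real^'n::finite"
  assumes "Ck_on 2 (ball x (2 * t)) f" "t > 0" "0 < h" "h < t"
  obtains y where "y \<in> ball x (2 * t)"
    "f (x + h *\<^sub>R axis i 1 + h *\<^sub>R axis j 1) - f (x + h *\<^sub>R axis i 1) - f (x + h *\<^sub>R axis j 1) + f x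
      = h * h * pdiff j (pdiff i f) y"
proof -
  let ?e = "\<lambda>i. axis i (1::real) :: real^'n"
  have inb: "x + s *\<^sub>R ?e i + s' *\<^sub>R ?e j \<in> ball x (2 * t)" if "0 \<le> s" "s \<le> h" "0 \<le> s'" "s' \<le> h" for s s'
  proof -
    have "norm (s *\<^sub>R ?e i + s' *\<^sub>R ?e j) \<le> s + s'"
      using norm_triangle_ineq[of "s *\<^sub>R ?e i" "s' *\<^sub>R ?e j"] that by simp
    also have "\<dots> < 2 * t" using that assms by linarith
    finally show ?thesis
      using dist_add_cancel[of x 0 "s *\<^sub>R ?e i + s' *\<^sub>R ?e j"] by (simp add: add.assoc)
  qed
  have Cf: "Ck_on (Suc (Suc 0)) (ball x (2*t)) f"
    using assms(1) by (simp only: numeral_2_eq_2)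
  then have df: "y \<in> ball x (2*t) \<Longrightarrow> f differentiable at y"
    and ddf: "y \<in> ball x (2*t) \<Longrightarrow> pdiff i f differentiable at y" for y by auto
  define \<phi> where "\<phi> s = f ((x + h *\<^sub>R ?e j) + s *\<^sub>R ?e i) - f (x + s *\<^sub>R ?e i)" for s
  have "(\<phi> has_real_derivative (pdiff i f ((x + h *\<^sub>R ?e j) + s *\<^sub>R ?e i) - pdiff i f (x + s *\<^sub>R ?e i))) (at s)"
    if "0 \<le> s" "s \<le> h" for s
    unfolding \<phi>_def using inb[of s h] inb[of s 0] that assms
    by (intro DERIV_diff has_real_derivative_axis df) (auto simp: add_ac)
  from MVT2[OF \<open>0 < h\<close> this] obtain s where s: "0 < s" "s < h"
    "\<phi> h - \<phi> 0 = (h - 0) * (pdiff i f ((x + h *\<^sub>R ?e j) + s *\<^sub>R ?e i) - pdiff i f (x + s *\<^sub>R ?e i))"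
    by metis
  define \<psi> where "\<psi> s' = pdiff i f ((x + s *\<^sub>R ?e i) + s' *\<^sub>R ?e j)" for s'
  have "(\<psi> has_real_derivative pdiff j (pdiff i f) ((x + s *\<^sub>R ?e i) + s' *\<^sub>R ?e j)) (at s')"
    if "0 \<le> s'" "s' \<le> h" for s'
    unfolding \<psi>_def using inb[of s s'] that s
    by (intro has_real_derivative_axis ddf) auto
  from MVT2[OF \<open>0 < h\<close> this] obtain s' where s': "0 < s'" "s' < h"
    "\<psi> h - \<psi> 0 = (h - 0) * pdiff j (pdiff i f) ((x + s *\<^sub>R ?e i) + s' *\<^sub>R ?e j)"
    by metis
  show ?thesis
  proof (rule that[of "x + s *\<^sub>R ?e i + s' *\<^sub>R ?e j"])
    show "x + s *\<^sub>R ?e i + s' *\<^sub>R ?e j \<in> ball x (2*t)" using s s' by (intro inb) auto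
    have "\<phi> h - \<phi> 0 = h * (\<psi> h - \<psi> 0)" using s(3) by (simp add: \<psi>_def add_ac)
    also have "\<dots> = h * h * pdiff j (pdiff i f) (x + s *\<^sub>R ?e i + s' *\<^sub>R ?e j)" using s'(3) by simp
    finally show "f (x + h *\<^sub>R ?e i + h *\<^sub>R ?e j) - f (x + h *\<^sub>R ?e i) - f (x + h *\<^sub>R ?e j) + f x
      = h * h * pdiff j (pdiff i f) (x + s *\<^sub>R ?e i + s' *\<^sub>R ?e j)"
      by (simp add: \<phi>_def add_ac)
  qed
qed

text \<open>The second difference is symmetric in the two directions, so the two mixed derivatives
  agree at a pair of points near \<open>x\<close>. With \<open>e\<close> half of a supposed gap at
  \<open>x\<close>, continuity gives a contradiction.\<close>

lemma pdiff_commute: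
  fixes x :: "real^'n::finite"
  assumes "open S" "x \<in> S" "Ck_on 2 S f"
  shows "pdiff i (pdiff j f) x = pdiff j (pdiff i f) x"
proof (rule ccontr)
  let ?A = "pdiff i (pdiff j f)" and ?B = "pdiff j (pdiff i f)"
  assume ne: "?A x \<noteq> ?B x"
  define e where "e = dist (?A x) (?B x) / 2"
  have e: "e > 0" using ne by (simp add: e_def)
  have "Ck_on (Suc (Suc 0)) S f" using assms(3) by (simp only: numeral_2_eq_2)
  then have c: "isCont ?A x" "isCont ?B x"
    using assms(1,2) by (auto simp: continuous_on_eq_continuous_at)
  obtain r1 where r1: "r1 > 0" "\<And>y. dist y x < r1 \<Longrightarrow> dist (?A y) (?A x) < e"
    using c(1) e unfolding continuous_at_eps_delta by (auto simp: dist_norm)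
  obtain r2 where r2: "r2 > 0" "\<And>y. dist y x < r2 \<Longrightarrow> dist (?B y) (?B x) < e"
    using c(2) e unfolding continuous_at_eps_delta by (auto simp: dist_norm)
  obtain r3 where r3: "r3 > 0" "ball x r3 \<subseteq> S" using assms(1,2) openE by blast
  define t where "t = min r1 (min r2 r3) / 2"
  have t: "t > 0" "2 * t \<le> r1" "2 * t \<le> r2" "2 * t \<le> r3" using r1 r2 r3 by (auto simp: t_def)
  have C: "Ck_on 2 (ball x (2*t)) f"
    by (rule Ck_on_subset[OF _ assms(3)]) (use r3 t in auto)
  obtain y where y: "y \<in> ball x (2*t)"
    "f (x + (t/2) *\<^sub>R axis i 1 + (t/2) *\<^sub>R axis j 1) - f (x + (t/2) *\<^sub>R axis i 1) - f (x + (t/2) *\<^sub>R axis j 1) + f x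
      = (t/2) * (t/2) * ?B y"
    by (rule second_difference_mvt[OF C, of "t/2" i j]) (use t in auto)
  obtain z where z: "z \<in> ball x (2*t)"
    "f (x + (t/2) *\<^sub>R axis j 1 + (t/2) *\<^sub>R axis i 1) - f (x + (t/2) *\<^sub>R axis j 1) - f (x + (t/2) *\<^sub>R axis i 1) + f x
      = (t/2) * (t/2) * ?A z"
    by (rule second_difference_mvt[OF C, of "t/2" j i]) (use t in auto)
  have "(t/2) * (t/2) * ?B y = (t/2) * (t/2) * ?A z"
    using y(2) z(2) unfolding add.assoc add.commute[of "(t/2) *\<^sub>R axis j 1" "(t/2) *\<^sub>R axis i 1"] by linarith
  then have eq: "?A z = ?B y" using t by simp
  have "dist (?A z) (?A x) < e" using z(1) t by (intro r1) (auto simp: dist_commute)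
  moreover have "dist (?B y) (?B x) < e" using y(1) t by (intro r2) (auto simp: dist_commute)
  ultimately have "dist (?A x) (?B x) < e + e"
    using dist_triangle_less_add[of "?A x" "?A z" e "?B x" e] eq by (simp add: dist_commute)
  then show False by (simp add: e_def)
qed

text \<open>The value at the origin is ignored throughout; also the smallness is only asked near the
  origin, not uniformly on \<open>S\<close>.\<close>

fun conormal :: "nat \<Rightarrow> int \<Rightarrow> (real^'n::finite) set \<Rightarrow> (real^'n \<Rightarrow> real) \<Rightarrow> bool" where
  "conormal 0 s S f \<longleftrightarrow> continuous_on (S - {0}) f \<and> f \<in> O[at 0](\<lambda>x. norm x powi s)"
| "conormal (Suc m) s S f \<longleftrightarrow> (\<forall>x\<in>S - {0}. f differentiable at x)
     \<and> f \<in> O[at 0](\<lambda>x. norm x powi s) \<and> (\<forall>i. conormal m (s - 1) S (pdiff i f))"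

lemma conormal_bigo: "conormal m s S f \<Longrightarrow> f \<in> O[at 0](\<lambda>x. norm x powi s)"
  by (cases m) auto

lemma conormal_Ck_on: "conormal m s S f \<Longrightarrow> Ck_on m (S - {0}) f"
  by (induction m arbitrary: s f) auto

lemma conormal_SucD: "conormal (Suc m) s S f \<Longrightarrow> conormal m s S f"
proof (induction m arbitrary: s f)
  case 0
  then show ?case
    by (auto intro!: continuous_at_imp_continuous_on differentiable_imp_continuous_within)
qed auto

lemma conormal_mono_order: "l \<le> m \<Longrightarrow> conormal m s S f \<Longrightarrow> conormal l s S f"
  by (induction rule: dec_induct) (auto intro: conormal_SucD simp del: conormal.simps)

lemma norm_powi_bigo:
  assumes "s \<le> t"
  shows "(\<lambda>x::real^'n::finite. norm x powi t) \<in> O[at 0](\<lambda>x. norm x powi s)"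
proof (rule bigoI[of _ 1])
  have "\<forall>\<^sub>F x::real^'n in at 0. x \<in> ball 0 1 - {0}"
    by (rule eventually_at_in_open) auto
  then show "\<forall>\<^sub>F x::real^'n in at 0. norm (norm x powi t) \<le> 1 * norm (norm x powi s)"
    by eventually_elim (use assms in \<open>auto intro: power_int_decreasing\<close>)
qed

lemma conormal_mono:
  "s \<le> t \<Longrightarrow> conormal m t S f \<Longrightarrow> conormal m s S f"
proof (induction m arbitrary: s t f)
  case 0
  then show ?case using landau_o.big_trans[OF _ norm_powi_bigo] by auto
next
  case (Suc m)
  have "conormal m (s - 1) S (pdiff i f)" for i
    using Suc.prems by (intro Suc.IH[of "s - 1" "t - 1"]) auto
  with Suc.prems show ?case using landau_o.big_trans[OF _ norm_powi_bigo] by auto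
qed

text \<open>Each derivative lowers the exponent, eventually below zero, hence integer powers. The
  form x_i r^(k-2), a coordinate times another power, is what lets \<open>conormal_norm_powi\<close>
  go through by induction with \<open>k\<close> arbitrary.\<close>

lemma pdiff_norm_powi:
  fixes x :: "real^'n::finite"
  assumes "x \<noteq> 0"
  shows "(\<lambda>x. norm x powi k) differentiable at x"
    "pdiff i (\<lambda>x. norm x powi k) x = of_int k * (x $ i * norm x powi (k - 2))"
proof -
  have n: "(norm has_derivative (\<lambda>h. sgn x \<bullet> h)) (at x)"
    using has_derivative_norm[OF assms] by (simp add: inner_commute)
  then have nd: "norm differentiable at x" by (auto simp: differentiable_def)
  have pn: "pdiff i norm x = x $ i / norm x"
    by (subst pdiff_has_derivative[OF n]) (simp add: sgn_div_norm inner_axis divide_inverse mult.commute)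
  have D: "((\<lambda>y. y powi k) has_real_derivative (of_int k * norm x powi (k - 1))) (at (norm x))"
    using assms by (auto intro!: derivative_eq_intros)
  show "(\<lambda>x. norm x powi k) differentiable at x"
    by (rule pdiff_chain_real(1)[where f=norm, OF D nd])
  have "norm x powi (k - 1) = norm x powi ((k - 2) + 1)" by simp
  also have "\<dots> = norm x powi (k - 2) * norm x" using assms by (subst power_int_add) auto
  finally show "pdiff i (\<lambda>x. norm x powi k) x = of_int k * (x $ i * norm x powi (k - 2))"
    using pdiff_chain_real(2)[where f=norm, OF D nd, of i] pn assms by simp
qed

lemma bigo_norm_powi_tendsto_0:
  fixes f :: "real^'n::finite \<Rightarrow> real"
  assumes "f \<in> O[at 0](\<lambda>x::real^'n. norm x powi s)" "s \<ge> 1"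
  shows "(f \<longlongrightarrow> 0) (at 0)"
proof -
  have "f \<in> O[at 0](\<lambda>x::real^'n. norm x powi 1)"
    using landau_o.big_trans[OF assms(1) norm_powi_bigo[OF assms(2)]] .
  then obtain c where c: "\<forall>\<^sub>F x in at 0. norm (f x) \<le> c * norm (norm x powi 1)"
    by (elim landau_o.bigE)
  have "((\<lambda>x::real^'n. c * norm (norm x powi 1)) \<longlongrightarrow> 0) (at 0)"
    by (auto intro!: tendsto_eq_intros)
  with c show ?thesis by (rule Lim_null_comparison)
qed

context
  fixes S :: "(real^'n::finite) set"
  assumes S: "open S" "0 \<in> S"
begin

private lemma S': "open (S - {0})" using S by auto

private lemma ev: "\<forall>\<^sub>F x in at 0. x \<in> S - {0}"
  by (rule eventually_at_in_open) (use S in auto)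

lemma conormal_cong:
  assumes "\<And>x. x \<in> S - {0} \<Longrightarrow> f x = g x" "conormal m s S f"
  shows "conormal m s S g"
  using assms
proof (induction m arbitrary: s f g)
  case 0
  have "\<forall>\<^sub>F x in at 0. f x = g x" using ev by eventually_elim (use 0 in auto)
  then have "f \<in> O[at 0](\<lambda>x. norm x powi s) \<longleftrightarrow> g \<in> O[at 0](\<lambda>x. norm x powi s)"
    by (rule landau_o.big.in_cong)
  moreover have "continuous_on (S - {0}) f \<longleftrightarrow> continuous_on (S - {0}) g"
    using 0 by (intro continuous_on_cong) auto
  ultimately show ?case using 0 by simp
next
  case (Suc m)
  have "\<forall>\<^sub>F x in at 0. f x = g x" using ev by eventually_elim (use Suc in auto)
  then have "f \<in> O[at 0](\<lambda>x. norm x powi s) \<longleftrightarrow> g \<in> O[at 0](\<lambda>x. norm x powi s)"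
    by (rule landau_o.big.in_cong)
  moreover have "g differentiable at x" if "x \<in> S - {0}" for x
    using differentiable_cong[OF S' that Suc.prems(1)] Suc.prems(2) that by auto
  moreover have "conormal m (s - 1) S (pdiff i g)" for i
    by (rule Suc.IH[of "pdiff i f"]) (use pdiff_cong[OF S' _ Suc.prems(1)] Suc.prems in auto)
  ultimately show ?case using Suc by simp
qed

lemma conormal_add:
  assumes "conormal m s S f" "conormal m s S g"
  shows "conormal m s S (\<lambda>x. f x + g x)"
  using assms
proof (induction m arbitrary: s f g)
  case 0
  then show ?case by (auto intro: continuous_intros sum_in_bigo)
next
  case (Suc m)
  have "conormal m (s - 1) S (pdiff i (\<lambda>x. f x + g x))" for i
    by (rule conormal_cong[OF _ Suc.IH[of _ "pdiff i f" "pdiff i g"]])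
       (use Suc.prems in \<open>auto simp: pdiff_add\<close>)
  with Suc.prems show ?case by (auto intro: sum_in_bigo)
qed

lemma conormal_mult_bigo:
  assumes "f \<in> O[at 0](\<lambda>x::real^'n. norm x powi s)" "g \<in> O[at 0](\<lambda>x. norm x powi t)"
  shows "(\<lambda>x. f x * g x) \<in> O[at 0](\<lambda>x. norm x powi (s + t))"
proof -
  have "\<forall>\<^sub>F x::real^'n in at 0. norm x powi s * norm x powi t = norm x powi (s + t)"
    using ev by eventually_elim (auto simp: power_int_add)
  from landau_o.big.cong[OF this] landau_o.big_mult[OF assms] show ?thesis by simp
qed

lemma conormal_mult:
  assumes "conormal m s S f" "conormal m t S g"
  shows "conormal m (s + t) S (\<lambda>x. f x * g x)"
  using assms
proof (induction m arbitrary: s t f g)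
  case 0
  then show ?case by (auto intro: continuous_intros conormal_mult_bigo)
next
  case (Suc m)
  have "conormal m (s + t - 1) S (pdiff i (\<lambda>x. f x * g x))" for i
  proof (rule conormal_cong)
    have "conormal m ((s - 1) + t) S (\<lambda>x. pdiff i f x * g x)"
      using Suc.prems Suc.prems[THEN conormal_SucD] by (intro Suc.IH) auto
    moreover have "conormal m (s + (t - 1)) S (\<lambda>x. f x * pdiff i g x)"
      using Suc.prems Suc.prems[THEN conormal_SucD] by (intro Suc.IH) auto
    ultimately show "conormal m (s + t - 1) S (\<lambda>x. pdiff i f x * g x + f x * pdiff i g x)"
      by (intro conormal_add) (simp_all add: algebra_simps)
  qed (use Suc.prems in \<open>auto simp: pdiff_mult\<close>)
  with Suc.prems show ?case by (auto intro: conormal_mult_bigo)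
qed

lemma conormal_zero: "conormal m s S (\<lambda>x. 0)"
  by (induction m arbitrary: s) auto

lemma conormal_const: "conormal m 0 S (\<lambda>x. c)"
  using conormal_zero by (cases m) auto

lemma conormal_cmult: "conormal m s S f \<Longrightarrow> conormal m s S (\<lambda>x. c * f x)"
  using conormal_mult[OF conormal_const, of m s f c] by simp

lemma conormal_diff:
  "conormal m s S f \<Longrightarrow> conormal m s S g \<Longrightarrow> conormal m s S (\<lambda>x. f x - g x)"
  using conormal_add[of m s f "\<lambda>x. -1 * g x"] conormal_cmult[of m s g "-1"] by simp

lemma conormal_sum:
  "(\<And>a. a \<in> A \<Longrightarrow> conormal m s S (f a)) \<Longrightarrow> conormal m s S (\<lambda>x. \<Sum>a\<in>A. f a x)"
  by (induction A rule: infinite_finite_induct) (auto intro: conormal_zero conormal_add)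

lemma conormal_coord: "conormal m 1 S (\<lambda>x. x $ j)"
proof -
  have b: "(\<lambda>x. x $ j) \<in> O[at 0](\<lambda>x::real^'n. norm x powi 1)"
    by (rule bigoI[of _ 1]) (auto simp: component_le_norm_cart)
  have "pdiff i (\<lambda>x. x $ j) = (\<lambda>x. if i = j then 1 else 0)" for i :: 'n
    by (auto simp: pdiff_coord)
  with b show ?thesis
    by (cases m) (auto intro!: continuous_intros conormal_const)
qed

lemma conormal_norm_powi: "conormal m k S (\<lambda>x. norm x powi k)"
proof (induction m arbitrary: k)
  case 0
  then show ?case by (auto intro!: continuous_intros)
next
  case (Suc m)
  have "conormal m (k - 1) S (pdiff i (\<lambda>x. norm x powi k))" for i
  proof (rule conormal_cong)
    show "conormal m (k - 1) S (\<lambda>x. of_int k * (x $ i * norm x powi (k - 2)))"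
      using conormal_cmult[OF conormal_mult[OF conormal_coord Suc.IH[of "k - 2"]], of "of_int k" i] by simp
  qed (simp add: pdiff_norm_powi)
  then show ?case by (auto simp: pdiff_norm_powi(1))
qed

lemma conormal_norm: "conormal m 1 S norm"
  using conormal_norm_powi[of m 1] by simp

text \<open>The lower bound \<open>c\<close> makes 1/f bounded; derivatives then follow because that
  of 1/f is -(1/f)^2 times that of f, and order 0 is stable under products.\<close>

lemma conormal_inverse:
  assumes "c > 0" "\<And>x. x \<in> S - {0} \<Longrightarrow> f x \<ge> c" "conormal m 0 S f"
  shows "conormal m 0 S (\<lambda>x. inverse (f x))"
proof -
  have nz: "f x > 0" if "x \<in> S - {0}" for x using assms(1,2) that by force
  have b: "(\<lambda>x. inverse (f x)) \<in> O[at 0](\<lambda>x. norm x powi 0)"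
  proof (rule bigoI[of _ "inverse c"])
    show "\<forall>\<^sub>F x in at 0. norm (inverse (f x)) \<le> inverse c * norm (norm x powi 0)"
      using ev by eventually_elim (use assms(1,2) nz in \<open>force intro: le_imp_inverse_le\<close>)
  qed
  show ?thesis using assms(3)
  proof (induction m)
    case 0
    have "continuous_on (S - {0}) (\<lambda>x. inverse (f x))"
      by (rule continuous_on_inverse) (use 0 nz in force)+
    then show ?case using b by simp
  next
    case (Suc m)
    have d: "(inverse has_real_derivative - (inverse (f x) * inverse (f x))) (at (f x))" if "x \<in> S - {0}" for x
      using DERIV_inverse[of "f x"] nz[OF that] by (simp add: power2_eq_square)
    have IH: "conormal m 0 S (\<lambda>x. inverse (f x))" by (rule Suc.IH[OF conormal_SucD[OF Suc.prems]])
    have "conormal m (0 - 1) S (pdiff i (\<lambda>x. inverse (f x)))" for i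
    proof (rule conormal_cong)
      have "conormal m (0 + (0 + - 1)) S (\<lambda>x. inverse (f x) * (inverse (f x) * pdiff i f x))"
        using Suc.prems by (intro conormal_mult IH) auto
      from conormal_cmult[OF this, of "-1"]
      show "conormal m (0 - 1) S (\<lambda>x. -1 * (inverse (f x) * (inverse (f x) * pdiff i f x)))" by simp
      show "-1 * (inverse (f x) * (inverse (f x) * pdiff i f x)) = pdiff i (\<lambda>x. inverse (f x)) x"
        if "x \<in> S - {0}" for x
        using pdiff_chain_real(2)[where f=f, OF d[OF that]] that Suc.prems by simp
    qed
    moreover have "(\<lambda>x. inverse (f x)) differentiable at x" if "x \<in> S - {0}" for x
      using pdiff_chain_real(1)[where f=f, OF d[OF that]] that Suc.prems by simp
    ultimately show ?case using b by simp
  qed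
qed

text \<open>Strictness of \<open>s > int m\<close> leaves at least one power of r for the
  derivatives of order \<open>m\<close>, so they tend to 0 at the origin. The value there has to be
  prescribed since \<open>conormal\<close> does not see it.\<close>

lemma conormal_imp_Ck_on:
  assumes "conormal m s S f" "s > int m" "f 0 = 0"
  shows "Ck_on m S f"
  using assms
proof (induction m arbitrary: s f)
  case 0
  have "(f \<longlongrightarrow> 0) (at 0)"
    using bigo_norm_powi_tendsto_0[OF conormal_bigo[OF 0(1)]] 0 by simp
  then have "isCont f 0" using 0 by (simp add: isCont_def)
  moreover have "isCont f x" if "x \<in> S" "x \<noteq> 0" for x
    using 0(1) that S' by (auto simp: continuous_on_eq_continuous_at)
  ultimately have "isCont f x" if "x \<in> S" for x using that by blast
  then show ?case by (simp add: continuous_at_imp_continuous_on)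
next
  case (Suc m)
  \<comment> \<open>The order drops to \<open>s - 1\<close>, which is still at least 1. So f(x)/|x|
    tends to 0: this is differentiability at the origin with derivative zero, and the partial
    derivatives vanish there as the induction hypothesis demands.\<close>
  have "(\<lambda>x. f x * norm x powi (-1)) \<in> O[at 0](\<lambda>x::real^'n. norm x powi (s + -1))"
    by (rule conormal_mult_bigo) (use Suc.prems in auto)
  from bigo_norm_powi_tendsto_0[OF this]
  have "((\<lambda>x. f x * norm x powi (-1)) \<longlongrightarrow> 0) (at 0)" using Suc.prems by simp
  from tendsto_norm[OF this] have "(f has_derivative (\<lambda>_. 0)) (at 0)"
    using Suc.prems by (simp add: has_derivative_iff_norm divide_inverse abs_mult)
  from this pdiff_has_derivative[OF this]
  have d0: "f differentiable at 0" "\<And>i. pdiff i f 0 = 0" by (auto simp: differentiable_def)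
  have "Ck_on m S (pdiff i f)" for i
    by (rule Suc.IH[of "s - 1"]) (use Suc.prems d0 in auto)
  moreover have "f differentiable at x" if "x \<in> S" for x
    using d0 Suc.prems(1) that by (cases "x = 0") auto
  ultimately show ?case by simp
qed

end

section \<open>Taylor expansion at the origin with remainder in the symbol class\<close>

fun vanishing :: "nat \<Rightarrow> (real^'n::finite \<Rightarrow> real) \<Rightarrow> bool" where
  "vanishing 0 f \<longleftrightarrow> True"
| "vanishing (Suc m) f \<longleftrightarrow> f 0 = 0 \<and> (\<forall>i. vanishing m (pdiff i f))"

lemma vanishing_cong:
  assumes "open S" "0 \<in> S" "\<And>x. x \<in> S \<Longrightarrow> f x = g x" "vanishing m f"
  shows "vanishing m g"
  using assms(3,4)
proof (induction m arbitrary: f g)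
  case (Suc m)
  have "vanishing m (pdiff i g)" for i
    by (rule Suc.IH[of "pdiff i f"]) (use pdiff_cong[OF assms(1) _ Suc.prems(1)] Suc.prems in auto)
  with Suc.prems assms(2) show ?case by auto
qed auto

context
  fixes S :: "(real^'n::finite) set"
  assumes S: "open S" "0 \<in> S"
begin

text \<open>Taylor's estimate without a remainder formula: by the mean value theorem on the segment
  from 0 to x, a bound r^m on the first derivatives becomes r^(m+1) for the function.
  \<open>vanishing m\<close> concerns derivatives of order below \<open>m\<close>, hence the order
  \<open>m\<close> of the result.\<close>

lemma vanishing_conormal:
  assumes "Ck_on m S f" "vanishing m f"
  shows "conormal m (int m) S f"
  using assms
proof (induction m arbitrary: f)
  case 0
  then have "isCont f 0" using S by (auto simp: continuous_on_eq_continuous_at)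
  then have "(f \<longlongrightarrow> f 0) (at 0)" by (simp add: isCont_def)
  then have "f \<in> O[at 0](\<lambda>_. 1)" by (intro bigoI_tendsto[where c="f 0"]) auto
  then show ?case using 0 by (auto intro: continuous_on_subset)
next
  case (Suc m)
  have IH: "conormal m (int m) S (pdiff i f)" for i using Suc by auto
  have "\<exists>c. \<forall>\<^sub>F x in at 0. norm (pdiff i f x) \<le> c * norm (norm x powi int m)" for i
    by (rule landau_o.bigE[OF conormal_bigo[OF IH[of i]]]) blast
  then obtain c where c: "\<And>i. \<forall>\<^sub>F x in at 0. norm (pdiff i f x) \<le> c i * norm (norm x powi int m)"
    by metis
  have "\<forall>\<^sub>F x in at 0. \<forall>i. norm (pdiff i f x) \<le> c i * norm (norm x powi int m)"
    using c by (simp add: eventually_all_finite)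
  moreover have "\<forall>\<^sub>F x in at 0. x \<in> S" using S by (intro eventually_at_in_open')
  ultimately have "\<forall>\<^sub>F x in at 0. x \<in> S \<and> (\<forall>i. norm (pdiff i f x) \<le> c i * norm (norm x powi int m))"
    by eventually_elim auto
  then obtain r where r0: "r > 0" "\<And>x. x \<noteq> 0 \<Longrightarrow> norm x < r \<Longrightarrow>
      x \<in> S \<and> (\<forall>i. norm (pdiff i f x) \<le> c i * norm (norm x powi int m))"
    unfolding eventually_at dist_norm by (metis UNIV_I diff_zero)
  have r: "r > 0" "\<And>x. x \<noteq> 0 \<Longrightarrow> norm x < r \<Longrightarrow> x \<in> S"
    by (rule r0(1), rule conjunct1[OF r0(2)])
  have r3: "\<bar>pdiff i f x\<bar> \<le> c i * norm x ^ m" if "x \<noteq> 0" "norm x < r" for x i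
    using conjunct2[OF r0(2)[OF that]] by simp
  \<comment> \<open>Read off from the bound at one test point on the axis. The sign is needed below
    to enlarge |t x|^m to |x|^m.\<close>
  have c0: "c i \<ge> 0" for i
  proof -
    have "\<bar>pdiff i f ((r/2) *\<^sub>R axis i 1)\<bar> \<le> c i * norm ((r/2) *\<^sub>R axis i 1 :: real^'n) ^ m"
      using r(1) by (intro r3) (auto simp: axis_eq_0_iff)
    then have "0 \<le> c i * (r/2) ^ m" using r(1) by simp
    moreover have "(r/2) ^ m > 0" using r(1) by simp
    ultimately show ?thesis by (simp only: zero_le_mult_iff) linarith
  qed
  have "norm (f x) \<le> (\<Sum>i\<in>UNIV. c i) * norm (norm x powi int (Suc m))" if x: "norm x < r" "x \<noteq> 0" for x
  proof -
    have inS: "t *\<^sub>R x \<in> S" if "0 \<le> t" "t \<le> 1" for t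
    proof (cases "t = 0")
      case False
      have "norm (t *\<^sub>R x) \<le> norm x"
        using that mult_left_le_one_le[of "norm x" "\<bar>t\<bar>"] by simp
      from order.strict_trans1[OF this x(1)] show ?thesis using x(2) False by (intro r(2)) simp_all
    qed (use S in auto)
    have df: "f differentiable at y" if "y \<in> S" for y using Suc.prems(1) that by simp
    have D: "((\<lambda>t. f (0 + t *\<^sub>R x)) has_real_derivative (\<Sum>i\<in>UNIV. x $ i * pdiff i f (0 + t *\<^sub>R x))) (at t)"
      if "0 \<le> t" "t \<le> 1" for t
      by (rule has_real_derivative_line, rule df) (simp add: inS[OF that])
    obtain t where t: "0 < t" "t < 1"
      "f (0 + 1 *\<^sub>R x) - f (0 + 0 *\<^sub>R x) = (1 - 0) * (\<Sum>i\<in>UNIV. x $ i * pdiff i f (0 + t *\<^sub>R x))"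
      using MVT2[OF zero_less_one D] by blast
    have tx: "norm (t *\<^sub>R x) \<le> norm x" using t mult_left_le_one_le[of "norm x" "\<bar>t\<bar>"] by simp
    have "\<bar>pdiff i f (t *\<^sub>R x)\<bar> \<le> c i * norm x ^ m" for i
    proof -
      have "\<bar>pdiff i f (t *\<^sub>R x)\<bar> \<le> c i * norm (t *\<^sub>R x) ^ m"
        by (rule r3) (use t(1) x(2) order.strict_trans1[OF tx x(1)] in simp_all)
      also have "\<dots> \<le> c i * norm x ^ m" using tx c0 by (intro mult_left_mono power_mono) auto
      finally show ?thesis .
    qed
    then have "\<bar>x $ i\<bar> * \<bar>pdiff i f (t *\<^sub>R x)\<bar> \<le> norm x * (c i * norm x ^ m)" for i
      by (rule mult_mono[OF component_le_norm_cart]) simp_all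
    then have "(\<Sum>i\<in>UNIV. \<bar>x $ i * pdiff i f (t *\<^sub>R x)\<bar>) \<le> (\<Sum>i\<in>UNIV. norm x * (c i * norm x ^ m))"
      unfolding abs_mult by (rule sum_mono)
    moreover have "\<bar>f x\<bar> \<le> (\<Sum>i\<in>UNIV. \<bar>x $ i * pdiff i f (t *\<^sub>R x)\<bar>)"
      using t(3) Suc.prems(2) sum_abs[of "\<lambda>i. x $ i * pdiff i f (t *\<^sub>R x)" UNIV] by simp
    ultimately have "\<bar>f x\<bar> \<le> (\<Sum>i\<in>UNIV. norm x * (c i * norm x ^ m))" by linarith
    also have "\<dots> = (\<Sum>i\<in>UNIV. c i) * (norm x * norm x ^ m)"
      unfolding sum_distrib_right by (intro sum.cong) auto
    also have "norm x * norm x ^ m = norm (norm x powi int (Suc m))"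
      by (simp only: power_int_of_nat) simp
    finally show ?thesis by simp
  qed
  then have "\<forall>\<^sub>F x in at 0. norm (f x) \<le> (\<Sum>i\<in>UNIV. c i) * norm (norm x powi int (Suc m))"
    unfolding eventually_at dist_norm using r(1) by (intro exI[of _ r]) auto
  then have big: "f \<in> O[at 0](\<lambda>x. norm x powi int (Suc m))" by (rule bigoI)
  show ?case unfolding conormal.simps
  proof (intro conjI ballI allI)
    show "f differentiable at x" if "x \<in> S - {0}" for x using Suc.prems(1) that by simp
    show "conormal m (int (Suc m) - 1) S (pdiff i f)" for i using IH[of i] by simp
  qed (rule big)
qed

end

text \<open>The homogeneous part of degree \<open>k\<close> of the Taylor series at the origin. The
  recursion is Euler's identity for homogeneous functions solved for the function, which avoids
  multi-indices and factorials.\<close>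

fun taylor_term :: "nat \<Rightarrow> (real^'n::finite \<Rightarrow> real) \<Rightarrow> real^'n \<Rightarrow> real" where
  "taylor_term 0 f x = f 0"
| "taylor_term (Suc k) f x = (\<Sum>i\<in>UNIV. x $ i * taylor_term k (pdiff i f) x) / real (Suc k)"

lemma taylor_term_cong:
  assumes "open S" "0 \<in> S" "\<And>x. x \<in> S \<Longrightarrow> f x = g x"
  shows "taylor_term k f = taylor_term k g"
  using assms(3)
proof (induction k arbitrary: f g)
  case 0
  then show ?case using assms(2) by auto
next
  case (Suc k)
  have "taylor_term k (pdiff i f) = taylor_term k (pdiff i g)" for i
    using pdiff_cong[OF assms(1) _ Suc.prems] by (intro Suc.IH) auto
  then show ?case by auto
qed

lemma smooth_on_const: "smooth_on S (\<lambda>x. c)"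
  by (simp add: smooth_on_def)

lemma smooth_on_coord: "smooth_on S (\<lambda>x. x $ i)"
  by (simp add: smooth_on_def)

lemma smooth_on_sum: "open S \<Longrightarrow> (\<And>a. a \<in> A \<Longrightarrow> smooth_on S (f a)) \<Longrightarrow> smooth_on S (\<lambda>x. \<Sum>a\<in>A. f a x)"
  by (auto simp: smooth_on_def intro: Ck_on_sum)

lemma smooth_taylor_term: "smooth_on UNIV (taylor_term k f)"
proof (induction k arbitrary: f)
  case (Suc k)
  have "smooth_on UNIV (\<lambda>x. (1 / real (Suc k)) * (\<Sum>i\<in>UNIV. x $ i * taylor_term k (pdiff i f) x))"
    by (intro smooth_on_mult smooth_on_sum smooth_on_coord Suc smooth_on_const) auto
  then show ?case by (simp add: divide_inverse mult.commute)
qed (simp add: smooth_on_const taylor_term.simps(1)[abs_def])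

lemma taylor_term_scale: "taylor_term k f (t *\<^sub>R x) = t ^ k * taylor_term k f x"
  by (induction k arbitrary: f) (simp_all add: sum_distrib_left mult_ac sum_divide_distrib)

lemma pdiff_sum:
  assumes "\<And>a. a \<in> A \<Longrightarrow> f a differentiable at x"
  shows "pdiff i (\<lambda>x. \<Sum>a\<in>A. f a x) x = (\<Sum>a\<in>A. pdiff i (f a) x)"
  using assms
proof (induction A rule: infinite_finite_induct)
  case (insert a A)
  then show ?case
    by (simp add: pdiff_add differentiable_sum[where f=f])
qed auto

text \<open>The product rule gives the wanted term once plus a sum over second derivatives. After
  exchanging the order of differentiation that sum is \<open>k\<close> times the wanted term (for
  the term of degree \<open>k + 1\<close>), and the total cancels the division in the
  recursion.\<close>

lemma pdiff_taylor_term: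
  assumes "open S" "0 \<in> S" "Ck_on (Suc k) S f"
  shows "pdiff j (taylor_term (Suc k) f) = taylor_term k (pdiff j f)"
  using assms(3)
proof (induction k arbitrary: f)
  case 0
  have "pdiff j (\<lambda>x. \<Sum>i\<in>UNIV. x $ i * pdiff i f 0) x = pdiff j f 0" for x
    by (subst pdiff_sum) (auto simp: pdiff_mult pdiff_coord if_distrib if_distribR cong: if_cong)
  then show ?case by auto
next
  case (Suc k)
  let ?c = "1 / real (Suc (Suc k))"
  have d: "taylor_term l g differentiable at x" for l g and x :: "real^'a"
    using smooth_on_differentiable[OF smooth_taylor_term] by auto
  show ?case
  proof
    fix x
    have C2: "Ck_on 2 S f"
      using Suc.prems by (intro Ck_on_mono[of 2 "Suc (Suc k)"]) auto
    have comm: "taylor_term k (pdiff j (pdiff i f)) = taylor_term k (pdiff i (pdiff j f))" for i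
      by (intro taylor_term_cong[OF assms(1,2)] pdiff_commute[OF assms(1) _ C2])
    have "pdiff j (taylor_term (Suc (Suc k)) f) x
        = pdiff j (\<lambda>x. ?c * (\<Sum>i\<in>UNIV. x $ i * taylor_term (Suc k) (pdiff i f) x)) x"
      by (intro arg_cong[where f="\<lambda>h. pdiff j h x"]) auto
    also have "\<dots> = ?c * (\<Sum>i\<in>UNIV. (if j = i then taylor_term (Suc k) (pdiff i f) x else 0)
          + x $ i * pdiff j (taylor_term (Suc k) (pdiff i f)) x)"
    proof -
      have ds: "(\<lambda>x. x $ i * taylor_term (Suc k) (pdiff i f) x) differentiable at x" for i
        by (intro differentiable_mult d differentiable_coord)
      have "pdiff j (\<lambda>x. \<Sum>i\<in>UNIV. x $ i * taylor_term (Suc k) (pdiff i f) x) x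
          = (\<Sum>i\<in>UNIV. pdiff j (\<lambda>x. x $ i * taylor_term (Suc k) (pdiff i f) x) x)"
        by (rule pdiff_sum[OF ds])
      also have "\<dots> = (\<Sum>i\<in>UNIV. (if j = i then taylor_term (Suc k) (pdiff i f) x else 0)
          + x $ i * pdiff j (taylor_term (Suc k) (pdiff i f)) x)"
        by (intro sum.cong refl)
           (simp only: pdiff_mult[OF differentiable_coord d] pdiff_coord, simp del: taylor_term.simps)
      finally show ?thesis
        using pdiff_mult[of "\<lambda>x. ?c" x "\<lambda>x. \<Sum>i\<in>UNIV. x $ i * taylor_term (Suc k) (pdiff i f) x" j]
          differentiable_sum[OF finite, of UNIV "\<lambda>i x. x $ i * taylor_term (Suc k) (pdiff i f) x" "at x"] ds
        by (simp del: taylor_term.simps)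
    qed
    also have "\<dots> = ?c * (taylor_term (Suc k) (pdiff j f) x
          + (\<Sum>i\<in>UNIV. x $ i * taylor_term k (pdiff j (pdiff i f)) x))"
    proof -
      have "pdiff j (taylor_term (Suc k) (pdiff i f)) = taylor_term k (pdiff j (pdiff i f))" for i
        using Suc.prems by (intro Suc.IH) simp
      then show ?thesis by (simp add: sum.distrib del: taylor_term.simps)
    qed
    also have "(\<Sum>i\<in>UNIV. x $ i * taylor_term k (pdiff j (pdiff i f)) x)
        = real (Suc k) * taylor_term (Suc k) (pdiff j f) x"
      by (simp add: comm)
    also have "?c * (taylor_term (Suc k) (pdiff j f) x + real (Suc k) * taylor_term (Suc k) (pdiff j f) x)
        = taylor_term (Suc k) (pdiff j f) x"
      by (simp add: field_simps del: taylor_term.simps)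
    finally show "pdiff j (taylor_term (Suc (Suc k)) f) x = taylor_term (Suc k) (pdiff j f) x" .
  qed
qed

text \<open>Differentiation kills the constant term and lowers each other term by one degree, so
  partial derivatives of the remainder of \<open>f\<close> are the remainders of the partial
  derivatives of \<open>f\<close>.\<close>

lemma vanishing_taylor_remainder:
  assumes "open S" "0 \<in> S" "Ck_on m S f"
  shows "vanishing m (\<lambda>x. f x - (\<Sum>k<m. taylor_term k f x))"
  using assms(3)
proof (induction m arbitrary: f)
  case (Suc m)
  have z: "taylor_term (Suc k) f 0 = 0" for k by simp
  have d: "taylor_term l g differentiable at x" for l g and x :: "real^'a"
    using smooth_on_differentiable[OF smooth_taylor_term] by auto
  have "f 0 - (\<Sum>k<Suc m. taylor_term k f 0) = 0"
    by (subst sum.lessThan_Suc_shift) (simp add: z)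
  moreover have "vanishing m (pdiff i (\<lambda>x. f x - (\<Sum>k<Suc m. taylor_term k f x)))" for i
  proof (rule vanishing_cong[OF assms(1,2)])
    show "vanishing m (\<lambda>x. pdiff i f x - (\<Sum>k<m. taylor_term k (pdiff i f) x))"
      using Suc by auto
    fix x assume x: "x \<in> S"
    have "pdiff i (\<lambda>x. f x - (\<Sum>k<Suc m. taylor_term k f x)) x
        = pdiff i f x - (\<Sum>k<Suc m. pdiff i (taylor_term k f) x)"
      using Suc.prems x by (subst pdiff_diff) (auto simp: pdiff_sum d simp del: sum.lessThan_Suc intro!: differentiable_sum)
    also have "(\<Sum>k<Suc m. pdiff i (taylor_term k f) x)
        = pdiff i (taylor_term 0 f) x + (\<Sum>k<m. pdiff i (taylor_term (Suc k) f) x)"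
      by (rule sum.lessThan_Suc_shift)
    also have "pdiff i (taylor_term 0 f) x = 0"
      using fun_cong[OF pdiff_const, of i "f 0" x] by (simp add: taylor_term.simps(1)[abs_def])
    also have "(\<Sum>k<m. pdiff i (taylor_term (Suc k) f) x) = (\<Sum>k<m. taylor_term k (pdiff i f) x)"
    proof (intro sum.cong refl)
      fix k assume "k \<in> {..<m}"
      then have "Ck_on (Suc k) S f" using Suc.prems by (intro Ck_on_mono[of "Suc k" "Suc m"]) auto
      from pdiff_taylor_term[OF assms(1,2) this]
      show "pdiff i (taylor_term (Suc k) f) x = taylor_term k (pdiff i f) x" by simp
    qed
    finally show "pdiff i f x - (\<Sum>k<m. taylor_term k (pdiff i f) x)
        = pdiff i (\<lambda>x. f x - (\<Sum>k<Suc m. taylor_term k f x)) x" by simp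
  qed
  ultimately show ?case by simp
qed auto

lemma smooth_on_subset: "T \<subseteq> S \<Longrightarrow> smooth_on S f \<Longrightarrow> smooth_on T f"
  by (auto simp: smooth_on_def intro: Ck_on_subset)

lemma smooth_on_diff: "open S \<Longrightarrow> smooth_on S f \<Longrightarrow> smooth_on S g \<Longrightarrow> smooth_on S (\<lambda>x. f x - g x)"
  by (auto simp: smooth_on_def intro: Ck_on_diff)

lemma taylor_remainder_conormal:
  assumes "open S" "0 \<in> S" "Ck_on m S f"
  shows "conormal m (int m) S (\<lambda>x. f x - (\<Sum>k<m. taylor_term k f x))"
proof (rule vanishing_conormal[OF assms(1,2) _ vanishing_taylor_remainder[OF assms]])
  have "smooth_on S (\<lambda>x. \<Sum>k<m. taylor_term k f x)"
    using smooth_on_subset[OF _ smooth_taylor_term] by (intro smooth_on_sum assms) auto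
  then show "Ck_on m S (\<lambda>x. f x - (\<Sum>k<m. taylor_term k f x))"
    using assms by (intro Ck_on_diff) (auto simp: smooth_on_def)
qed

section \<open>Expansions in polynomials and |x| times polynomials\<close>

text \<open>A smooth function with this scaling property is automatically a homogeneous polynomial, so
  multivariate polynomials need no syntax of their own.\<close>

definition homogeneous :: "nat \<Rightarrow> (real^'n::finite \<Rightarrow> real) \<Rightarrow> bool" where
  "homogeneous k f \<longleftrightarrow> smooth_on UNIV f \<and> (\<forall>t x. f (t *\<^sub>R x) = t ^ k * f x)"

lemma homogeneous_zero: "homogeneous k (\<lambda>x. 0)"
  by (simp add: homogeneous_def smooth_on_const)

lemma homogeneous_const: "homogeneous 0 (\<lambda>x. c)"
  by (simp add: homogeneous_def smooth_on_const)

lemma homogeneous_add: "homogeneous k f \<Longrightarrow> homogeneous k g \<Longrightarrow> homogeneous k (\<lambda>x. f x + g x)"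
  by (simp add: homogeneous_def smooth_on_add algebra_simps)

lemma homogeneous_sum: "(\<And>a. a \<in> A \<Longrightarrow> homogeneous k (f a)) \<Longrightarrow> homogeneous k (\<lambda>x. \<Sum>a\<in>A. f a x)"
  by (induction A rule: infinite_finite_induct) (auto intro: homogeneous_zero homogeneous_add)

lemma homogeneous_mult: "homogeneous k f \<Longrightarrow> homogeneous l g \<Longrightarrow> homogeneous (k + l) (\<lambda>x. f x * g x)"
  by (simp add: homogeneous_def smooth_on_mult power_add mult_ac)

lemma homogeneous_cmult: "homogeneous k f \<Longrightarrow> homogeneous k (\<lambda>x. c * f x)"
  using homogeneous_mult[OF homogeneous_const] by force

lemma homogeneous_coord: "homogeneous 1 (\<lambda>x. x $ i)"
  by (simp add: homogeneous_def smooth_on_coord)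

lemma norm_power2_vec: "norm (x :: real^'n::finite) ^ 2 = (\<Sum>i\<in>UNIV. x $ i * x $ i)"
  by (simp add: power2_norm_eq_inner inner_vec_def)

lemma homogeneous_norm_power2: "homogeneous 2 (\<lambda>x :: real^'n::finite. norm x ^ 2)"
  unfolding norm_power2_vec
  using homogeneous_mult[OF homogeneous_coord homogeneous_coord]
  by (intro homogeneous_sum) (simp add: numeral_2_eq_2)

lemma homogeneous_taylor_term: "homogeneous k (taylor_term k f)"
  by (simp add: homogeneous_def smooth_taylor_term taylor_term_scale)

text \<open>The scaling law at t = 0, where 0^0 = 1.\<close>

lemma homogeneous_0D: "homogeneous 0 f \<Longrightarrow> f = (\<lambda>x. f 0)"
  unfolding homogeneous_def by (metis mult_1 power_0 scaleR_zero_left)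

lemma homogeneous_differentiable: "homogeneous k f \<Longrightarrow> f differentiable at x"
  by (auto simp: homogeneous_def intro: smooth_on_differentiable)

lemma homogeneous_pdiff:
  assumes "homogeneous (Suc k) f"
  shows "homogeneous k (pdiff i f)"
proof -
  have sm: "smooth_on UNIV (pdiff i f)" using assms by (auto simp: homogeneous_def intro: smooth_on_pdiff)
  have nz: "pdiff i f (t *\<^sub>R x) = t ^ k * pdiff i f x" if "t \<noteq> 0" for t x
  proof -
    have "t * pdiff i f (t *\<^sub>R x) = pdiff i (\<lambda>x. f (t *\<^sub>R x)) x"
      using pdiff_affine(2)[of f 0 t x i] homogeneous_differentiable[OF assms] by simp
    also have "(\<lambda>x. f (t *\<^sub>R x)) = (\<lambda>x. t ^ Suc k * f x)"
      using assms by (simp add: homogeneous_def)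
    also have "pdiff i (\<lambda>x. t ^ Suc k * f x) x = t ^ Suc k * pdiff i f x"
      using pdiff_mult[of "\<lambda>x. t ^ Suc k" x f i] homogeneous_differentiable[OF assms] by simp
    finally show ?thesis using that by simp
  qed
  have "pdiff i f (t *\<^sub>R x) = t ^ k * pdiff i f x" for t x
  proof (cases "t = 0")
    case True
    \<comment> \<open>At t = 0 the chain rule only yields 0 = 0. The law is recovered by continuity
      in the scaling parameter.\<close>
    define g where "g s = pdiff i f (s *\<^sub>R x) - s ^ k * pdiff i f x" for s :: real
    have "continuous_on UNIV g"
      unfolding g_def
      by (intro continuous_intros continuous_on_compose2[OF smooth_on_continuous[OF sm]]) auto
    then have "(g \<longlongrightarrow> g 0) (at 0)"
      by (simp add: continuous_on_eq_continuous_at isCont_def)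
    moreover have "(g \<longlongrightarrow> 0) (at 0)"
      by (rule tendsto_eventually) (auto simp: g_def nz eventually_at_filter)
    ultimately have "g 0 = 0" by (rule tendsto_unique[rotated]) simp
    then show ?thesis using True by (simp add: g_def)
  qed (rule nz)
  with sm show ?thesis by (simp add: homogeneous_def)
qed

lemma homogeneous_euler:
  assumes "homogeneous k f"
  shows "(\<Sum>i\<in>UNIV. x $ i * pdiff i f x) = real k * f x"
proof -
  have "((\<lambda>t. f (0 + t *\<^sub>R x)) has_real_derivative (\<Sum>i\<in>UNIV. x $ i * pdiff i f (0 + 1 *\<^sub>R x))) (at 1)"
    by (intro has_real_derivative_line homogeneous_differentiable[OF assms])
  moreover have "(\<lambda>t. f (0 + t *\<^sub>R x)) = (\<lambda>t. t ^ k * f x)"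
    using assms by (simp add: homogeneous_def)
  moreover have "((\<lambda>t. t ^ k * f x) has_real_derivative real k * f x) (at 1)"
    by (auto intro!: derivative_eq_intros)
  ultimately show ?thesis using DERIV_unique by fastforce
qed

lemma homogeneous_conormal:
  assumes "open S" "0 \<in> S" "homogeneous k f"
  shows "conormal m (int k) S f"
  using assms(3)
proof (induction m arbitrary: k f)
  case 0
  have c: "continuous_on A f" for A
    using 0 by (auto simp: homogeneous_def intro: continuous_on_subset smooth_on_continuous)
  \<comment> \<open>Compactness of the unit sphere bounds \<open>f\<close> there, and the scaling
    law carries the bound to every other point.\<close>
  have "bounded (f ` sphere 0 1)"
    by (intro compact_imp_bounded compact_continuous_image c) simp
  then obtain C where C: "\<And>x. norm x = 1 \<Longrightarrow> \<bar>f x\<bar> \<le> C"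
    unfolding bounded_iff by (auto simp: sphere_def)
  have "\<bar>f x\<bar> \<le> C * norm x ^ k" if "x \<noteq> 0" for x
  proof -
    have "f x = f (norm x *\<^sub>R (x /\<^sub>R norm x))" using that by simp
    also have "\<dots> = norm x ^ k * f (x /\<^sub>R norm x)"
      using 0 by (simp only: homogeneous_def)
    finally have "\<bar>f x\<bar> = norm x ^ k * \<bar>f (x /\<^sub>R norm x)\<bar>" by (simp add: abs_mult)
    also have "\<dots> \<le> norm x ^ k * C" using that by (intro mult_left_mono C) auto
    finally show ?thesis by (simp add: mult.commute)
  qed
  then have "f \<in> O[at 0](\<lambda>x. norm x powi int k)"
    by (intro bigoI[of _ C]) (auto simp: eventually_at_filter)
  with c show ?case by simp
next
  case (Suc m)
  have big: "f \<in> O[at 0](\<lambda>x. norm x powi int k)"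
    by (rule conormal_bigo[OF Suc.IH[OF Suc.prems]])
  have "conormal m (int k - 1) S (pdiff i f)" for i
  \<comment> \<open>Degree 0 is separate because the order \<open>int k - 1\<close> is then
    negative; the function is constant and its derivatives are zero.\<close>
  proof (cases k)
    case 0
    then have "pdiff i f = (\<lambda>x. 0)" using homogeneous_0D[of f] Suc.prems pdiff_const by metis
    then show ?thesis using conormal_zero[OF assms(1,2)] by simp
  next
    case (Suc l)
    then show ?thesis using Suc.IH[OF homogeneous_pdiff, of l f i] Suc.prems by simp
  qed
  with big show ?case using homogeneous_differentiable[OF Suc.prems] by simp
qed

text \<open>Finite sums of homogeneous functions without a degree bound, which makes closure
  properties plain inductions. A grading is recovered in \<open>polynomial_fn_graded\<close> when
  degrees matter.\<close>

inductive polynomial_fn :: "(real^'n::finite \<Rightarrow> real) \<Rightarrow> bool" where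
  hom: "homogeneous k p \<Longrightarrow> polynomial_fn p"
| add: "polynomial_fn p \<Longrightarrow> polynomial_fn q \<Longrightarrow> polynomial_fn (\<lambda>x. p x + q x)"

lemma polynomial_fn_const: "polynomial_fn (\<lambda>x. c)"
  by (rule polynomial_fn.hom[OF homogeneous_const])

lemma polynomial_fn_mult_hom:
  "polynomial_fn q \<Longrightarrow> homogeneous k p \<Longrightarrow> polynomial_fn (\<lambda>x. p x * q x)"
  by (induction rule: polynomial_fn.induct)
     (auto simp: algebra_simps intro: polynomial_fn.intros homogeneous_mult)

lemma polynomial_fn_mult:
  "polynomial_fn p \<Longrightarrow> polynomial_fn q \<Longrightarrow> polynomial_fn (\<lambda>x. p x * q x)"
  by (induction rule: polynomial_fn.induct)
     (auto simp: algebra_simps intro: polynomial_fn.add polynomial_fn_mult_hom)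

lemma polynomial_fn_sum:
  "(\<And>a. a \<in> A \<Longrightarrow> polynomial_fn (f a)) \<Longrightarrow> polynomial_fn (\<lambda>x. \<Sum>a\<in>A. f a x)"
  by (induction A rule: infinite_finite_induct)
     (auto intro: polynomial_fn_const polynomial_fn.add)

lemma polynomial_fn_norm_power2: "polynomial_fn (\<lambda>x. norm x ^ 2)"
  by (rule polynomial_fn.hom[OF homogeneous_norm_power2])

lemma polynomial_fn_smooth: "polynomial_fn p \<Longrightarrow> smooth_on UNIV p"
  by (induction rule: polynomial_fn.induct) (auto simp: homogeneous_def intro: smooth_on_add)

lemma polynomial_fn_conormal:
  assumes "open S" "0 \<in> S" "polynomial_fn p"
  shows "conormal m 0 S p"
  using assms(3)
proof (induction rule: polynomial_fn.induct)
  case (hom k p)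
  then show ?case using conormal_mono[OF _ homogeneous_conormal[OF assms(1,2) hom]] by simp
qed (auto intro: conormal_add[OF assms(1,2)])

section \<open>Sums P + r Q and expansions modulo them\<close>

definition radial_poly :: "(real^'n::finite \<Rightarrow> real) \<Rightarrow> bool" where
  "radial_poly f \<longleftrightarrow> (\<exists>P Q. polynomial_fn P \<and> polynomial_fn Q \<and> f = (\<lambda>x. P x + norm x * Q x))"

lemma radial_poly_polynomial: "polynomial_fn p \<Longrightarrow> radial_poly p"
  unfolding radial_poly_def using polynomial_fn_const[of 0] by force

lemma radial_poly_norm_mult: "polynomial_fn p \<Longrightarrow> radial_poly (\<lambda>x. norm x * p x)"
  unfolding radial_poly_def using polynomial_fn_const[of 0] by force

lemma radial_poly_add:
  assumes "radial_poly f" "radial_poly g"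
  shows "radial_poly (\<lambda>x. f x + g x)"
proof -
  obtain P Q where f: "polynomial_fn P" "polynomial_fn Q" "f = (\<lambda>x. P x + norm x * Q x)"
    using assms(1) by (auto simp: radial_poly_def)
  obtain P' Q' where g: "polynomial_fn P'" "polynomial_fn Q'" "g = (\<lambda>x. P' x + norm x * Q' x)"
    using assms(2) by (auto simp: radial_poly_def)
  have "polynomial_fn (\<lambda>x. P x + P' x)" "polynomial_fn (\<lambda>x. Q x + Q' x)"
    using f g by (auto intro: polynomial_fn.add)
  moreover have "(\<lambda>x. f x + g x) = (\<lambda>x. (P x + P' x) + norm x * (Q x + Q' x))"
    by (simp add: f g algebra_simps)
  ultimately show ?thesis unfolding radial_poly_def by blast
qed

text \<open>The product of the two terms with a factor r contains r^2, a polynomial. This is why no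
  powers of r beyond the first need be carried.\<close>

lemma radial_poly_mult:
  assumes "radial_poly f" "radial_poly g"
  shows "radial_poly (\<lambda>x. f x * g x)"
proof -
  obtain P Q where f: "polynomial_fn P" "polynomial_fn Q" "f = (\<lambda>x. P x + norm x * Q x)"
    using assms(1) by (auto simp: radial_poly_def)
  obtain P' Q' where g: "polynomial_fn P'" "polynomial_fn Q'" "g = (\<lambda>x. P' x + norm x * Q' x)"
    using assms(2) by (auto simp: radial_poly_def)
  have "polynomial_fn (\<lambda>x. P x * P' x + norm x ^ 2 * (Q x * Q' x))"
    "polynomial_fn (\<lambda>x. P x * Q' x + Q x * P' x)"
    using f g by (auto intro!: polynomial_fn.add polynomial_fn_mult polynomial_fn_norm_power2)
  moreover have "(\<lambda>x. f x * g x) =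
      (\<lambda>x. (P x * P' x + norm x ^ 2 * (Q x * Q' x)) + norm x * (P x * Q' x + Q x * P' x))"
    by (simp add: f g algebra_simps power2_eq_square)
  ultimately show ?thesis unfolding radial_poly_def by blast
qed

lemma radial_poly_const: "radial_poly (\<lambda>x. c)"
  by (rule radial_poly_polynomial[OF polynomial_fn_const])

lemma radial_poly_power: "radial_poly f \<Longrightarrow> radial_poly (\<lambda>x. f x ^ n)"
  by (induction n) (auto intro: radial_poly_const radial_poly_mult)

lemma radial_poly_sum:
  "(\<And>a. a \<in> A \<Longrightarrow> radial_poly (f a)) \<Longrightarrow> radial_poly (\<lambda>x. \<Sum>a\<in>A. f a x)"
  by (induction A rule: infinite_finite_induct) (auto intro: radial_poly_const radial_poly_add)

lemma radial_poly_norm: "radial_poly norm"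
  using radial_poly_norm_mult[OF polynomial_fn_const[of 1]] by simp

text \<open>The number \<open>m\<close> of controlled derivatives and the order \<open>s\<close> of
  the remainder are independent, since the bootstrap needs an order exceeding the number of
  derivatives. The degree of \<open>g\<close> is not limited, so products need no
  truncation.\<close>

definition expandable :: "nat \<Rightarrow> int \<Rightarrow> (real^'n::finite) set \<Rightarrow> (real^'n \<Rightarrow> real) \<Rightarrow> bool" where
  "expandable m s S f \<longleftrightarrow> (\<exists>g. radial_poly g \<and> conormal m s S (\<lambda>x. f x - g x))"

lemma expandableI: "radial_poly g \<Longrightarrow> conormal m s S (\<lambda>x. f x - g x) \<Longrightarrow> expandable m s S f"
  by (auto simp: expandable_def)

context
  fixes S :: "(real^'n::finite) set"
  assumes S: "open S" "0 \<in> S"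
begin

lemma radial_poly_conormal: "radial_poly f \<Longrightarrow> conormal m 0 S f"
proof -
  assume "radial_poly f"
  then obtain P Q where f: "polynomial_fn P" "polynomial_fn Q" "f = (\<lambda>x. P x + norm x * Q x)"
    by (auto simp: radial_poly_def)
  have "conormal m (1 + 0) S (\<lambda>x. norm x * Q x)"
    by (intro conormal_mult[OF S] conormal_norm[OF S] polynomial_fn_conormal[OF S] f)
  then have "conormal m 0 S (\<lambda>x. norm x * Q x)" by (rule conormal_mono[rotated]) simp
  with polynomial_fn_conormal[OF S f(1)] show ?thesis unfolding f(3) by (rule conormal_add[OF S])
qed

lemma expandable_add:
  assumes "expandable m s S f" "expandable m s S g"
  shows "expandable m s S (\<lambda>x. f x + g x)"
proof -
  obtain f' where f': "radial_poly f'" "conormal m s S (\<lambda>x. f x - f' x)"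
    using assms(1) by (auto simp: expandable_def)
  obtain g' where g': "radial_poly g'" "conormal m s S (\<lambda>x. g x - g' x)"
    using assms(2) by (auto simp: expandable_def)
  have "conormal m s S (\<lambda>x. (f x + g x) - (f' x + g' x))"
    using conormal_add[OF S f'(2) g'(2)] by (simp add: algebra_simps)
  then show ?thesis by (intro expandableI[OF radial_poly_add[OF f'(1) g'(1)]])
qed

lemma expandable_mult:
  assumes "s \<ge> 0" "expandable m s S f" "expandable m s S g"
  shows "expandable m s S (\<lambda>x. f x * g x)"
proof -
  obtain f' where f': "radial_poly f'" "conormal m s S (\<lambda>x. f x - f' x)"
    using assms(2) by (auto simp: expandable_def)
  obtain g' where g': "radial_poly g'" "conormal m s S (\<lambda>x. g x - g' x)"
    using assms(3) by (auto simp: expandable_def)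
  \<comment> \<open>The product of the two remainders has order 2 s, at least s because s is
    nonnegative. In the mixed terms the other factor has order 0.\<close>
  have 1: "conormal m s S (\<lambda>x. (f x - f' x) * (g x - g' x))"
    using conormal_mono[OF _ conormal_mult[OF S f'(2) g'(2)], of s] assms(1) by simp
  have 2: "conormal m s S (\<lambda>x. (f x - f' x) * g' x)"
    using conormal_mult[OF S f'(2) radial_poly_conormal[OF g'(1)]] by simp
  have 3: "conormal m s S (\<lambda>x. f' x * (g x - g' x))"
    using conormal_mult[OF S radial_poly_conormal[OF f'(1)] g'(2)] by simp
  have "conormal m s S (\<lambda>x. f x * g x - f' x * g' x)"
    using conormal_add[OF S conormal_add[OF S 1 2] 3] by (simp add: algebra_simps)
  then show ?thesis by (intro expandableI[OF radial_poly_mult[OF f'(1) g'(1)]])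
qed

lemma expandable_power:
  assumes "s \<ge> 0" "expandable m s S f"
  shows "expandable m s S (\<lambda>x. f x ^ n)"
proof (induction n)
  case 0
  show ?case using expandableI[OF radial_poly_const[of 1], of m s S "\<lambda>x. 1"] conormal_zero[OF S] by simp
qed (use expandable_mult[OF assms(1,2)] in simp)

lemma expandable_cmult:
  assumes "expandable m s S f"
  shows "expandable m s S (\<lambda>x. c * f x)"
proof -
  obtain f' where f': "radial_poly f'" "conormal m s S (\<lambda>x. f x - f' x)"
    using assms(1) by (auto simp: expandable_def)
  have "conormal m s S (\<lambda>x. c * f x - c * f' x)"
    using conormal_cmult[OF S f'(2), of c] by (simp add: algebra_simps)
  then show ?thesis by (intro expandableI[OF radial_poly_mult[OF radial_poly_const f'(1)]])
qed

lemma expandable_radial_poly: "radial_poly f \<Longrightarrow> expandable m s S f"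
  by (rule expandableI[of f]) (simp_all add: conormal_zero[OF S])

lemma Ck_on_expandable: "Ck_on m S f \<Longrightarrow> expandable m (int m) S f"
  by (rule expandableI[OF radial_poly_polynomial[OF polynomial_fn_sum] taylor_remainder_conormal[OF S]])
     (auto intro: polynomial_fn.hom homogeneous_taylor_term)

lemma smooth_on_expandable:
  assumes "smooth_on S f"
  shows "expandable m s S f"
proof -
  \<comment> \<open>Taylor's formula ties the order to the number of derivatives; going up to the
    larger of the two serves any pair.\<close>
  define M where "M = max m (nat s)"
  have "expandable M (int M) S f" using assms by (intro Ck_on_expandable) (simp add: smooth_on_def)
  then obtain g where g: "radial_poly g" "conormal M (int M) S (\<lambda>x. f x - g x)"
    by (auto simp: expandable_def)
  have "conormal m s S (\<lambda>x. f x - g x)"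
    by (rule conormal_mono[OF _ conormal_mono_order[OF _ g(2)]]) (auto simp: M_def)
  with g(1) show ?thesis by (rule expandableI)
qed

lemma conormal_power: "conormal m s S f \<Longrightarrow> conormal m (int n * s) S (\<lambda>x. f x ^ n)"
proof (induction n)
  case 0
  then show ?case using conormal_const[OF S] by simp
next
  case (Suc n)
  then show ?case using conormal_mult[OF S Suc.prems Suc.IH] by (simp add: algebra_simps)
qed

text \<open>A truncated geometric series \<open>y\<close> inverts \<open>w = 1 + r f\<close> up to \<open>1/w - y = (1 - w y)/w\<close>, where
  dividing by \<open>w\<close> preserves the remainder class.\<close>

lemma expandable_inverse_one_plus:
  assumes "s \<ge> 0" "expandable m s S f" "\<And>x. x \<in> S \<Longrightarrow> f x \<ge> 0"
  shows "expandable m (s + 1) S (\<lambda>x. inverse (1 + norm x * f x))"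
proof -
  obtain g where g: "radial_poly g" "conormal m s S (\<lambda>x. f x - g x)"
    using assms(2) by (auto simp: expandable_def)
  define t where "t x = norm x * g x" for x
  define R where "R x = norm x * (f x - g x)" for x
  \<comment> \<open>Since \<open>t\<close> has order 1, its \<open>N\<close>-th power has order
    \<open>s + 1\<close>.\<close>
  define N where "N = nat (s + 1)"
  define y where "y x = (\<Sum>j<N. (- t x) ^ j)" for x
  define w where "w x = 1 + norm x * f x" for x
  have w: "w x = 1 + t x + R x" for x by (simp add: w_def t_def R_def algebra_simps)
  have w1: "w x \<ge> 1" if "x \<in> S" for x using assms(3)[OF that] by (simp add: w_def)
  have t: "radial_poly t" "conormal m 1 S t"
    unfolding t_def using radial_poly_mult[OF radial_poly_norm g(1)]
      conormal_mult[OF S conormal_norm[OF S] radial_poly_conormal[OF g(1)]] by simp_all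
  have nt: "radial_poly (\<lambda>x. - t x)" using radial_poly_mult[OF radial_poly_const[of "-1"] t(1)] by simp
  have y: "radial_poly y" unfolding y_def by (intro radial_poly_sum radial_poly_power nt)
  \<comment> \<open>The only place where an order is gained: the factor r in front of the remainder
    of \<open>f\<close>.\<close>
  have R: "conormal m (s + 1) S R"
    unfolding R_def using conormal_mult[OF S conormal_norm[OF S] g(2)] by (simp add: algebra_simps)
  have cw: "conormal m 0 S w"
    unfolding w[abs_def]
    by (intro conormal_add[OF S] conormal_const[OF S] conormal_mono[OF _ t(2)] conormal_mono[OF _ R])
       (use assms(1) in auto)
  have iw: "conormal m 0 S (\<lambda>x. inverse (w x))"
    by (rule conormal_inverse[OF S, of 1]) (use w1 cw in auto)
  have tN: "conormal m (s + 1) S (\<lambda>x. (- t x) ^ N)"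
    using conormal_power[OF conormal_cmult[OF S t(2), of "-1"], of N] assms(1) by (simp add: N_def)
  have "conormal m (s + 1) S (\<lambda>x. (- t x) ^ N - R x * y x)"
    using conormal_diff[OF S tN] conormal_mult[OF S R radial_poly_conormal[OF y]] by simp
  from conormal_mult[OF S this iw]
  have "conormal m (s + 1) S (\<lambda>x. ((- t x) ^ N - R x * y x) * inverse (w x))" by simp
  then have "conormal m (s + 1) S (\<lambda>x. inverse (w x) - y x)"
  proof (rule conormal_cong[OF S, rotated])
    fix x assume x: "x \<in> S - {0}"
    \<comment> \<open>The telescoped geometric sum. As w = (1 + t) + R, it leaves 1 - w y = (-t)^N -
      R y, and both terms have order \<open>s + 1\<close>.\<close>
    have "(1 + t x) * y x = 1 - (- t x) ^ N"
      using one_diff_power_eq[of "- t x" N] by (simp add: y_def)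
    then have "(- t x) ^ N - R x * y x = 1 - w x * y x" by (simp add: w algebra_simps)
    then show "((- t x) ^ N - R x * y x) * inverse (w x) = inverse (w x) - y x"
      using w1[of x] x by (simp add: field_simps)
  qed
  with y show ?thesis unfolding w_def by (rule expandableI)
qed

end

section \<open>Poisson's equation with right-hand side P + r Q\<close>

lemma laplacian_add:
  assumes "open S" "x \<in> S" "Ck_on 2 S f" "Ck_on 2 S g"
  shows "laplacian (\<lambda>x. f x + g x) x = laplacian f x + laplacian g x"
proof -
  have C: "Ck_on (Suc (Suc 0)) S f" "Ck_on (Suc (Suc 0)) S g" using assms(3,4) by (simp_all only: numeral_2_eq_2)
  have "pdiff i (pdiff i (\<lambda>x. f x + g x)) x = pdiff i (\<lambda>x. pdiff i f x + pdiff i g x) x" for i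
    by (rule pdiff_cong[OF assms(1,2)]) (use C in \<open>simp add: pdiff_add\<close>)
  also have "pdiff i (\<lambda>x. pdiff i f x + pdiff i g x) x = pdiff i (pdiff i f) x + pdiff i (pdiff i g) x" for i
    using C assms(2) by (simp add: pdiff_add)
  finally show ?thesis by (simp add: laplacian_def sum.distrib)
qed

lemma laplacian_cmult:
  assumes "open S" "x \<in> S" "Ck_on 2 S f"
  shows "laplacian (\<lambda>x. c * f x) x = c * laplacian f x"
proof -
  have C: "Ck_on (Suc (Suc 0)) S f" using assms(3) by (simp_all only: numeral_2_eq_2)
  have "pdiff i (pdiff i (\<lambda>x. c * f x)) x = pdiff i (\<lambda>x. c * pdiff i f x) x" for i
    by (rule pdiff_cong[OF assms(1,2)]) (use C in \<open>simp add: pdiff_mult\<close>)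
  also have "pdiff i (\<lambda>x. c * pdiff i f x) x = c * pdiff i (pdiff i f) x" for i
    using C assms(2) by (simp add: pdiff_mult)
  finally show ?thesis by (simp add: laplacian_def sum_distrib_left)
qed

lemma Ck_on_norm_powi: "Ck_on m (- {0}) (\<lambda>x. norm x powi k)"
  using conormal_Ck_on[OF conormal_norm_powi[of UNIV m k]] by (simp add: Compl_eq_Diff_UNIV)

text \<open>In the bracket, the dimension comes from differentiating the coordinates in x_i r^(s-2),
  the term s - 2 from differentiating that power again, where the x_i^2 add up to r^2, and 2 k from
  the cross terms by Euler's identity.\<close>

lemma laplacian_norm_powi_mult:
  fixes p :: "real^'n::finite \<Rightarrow> real"
  assumes "homogeneous k p" "x \<noteq> 0"
  shows "laplacian (\<lambda>x. norm x powi s * p x) x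
    = of_int s * (of_int s + real CARD('n) - 2 + 2 * real k) * norm x powi (s - 2) * p x
      + norm x powi s * laplacian p x"
proof -
  let ?N = "\<lambda>s x. norm (x::real^'n) powi s"
  note d = homogeneous_differentiable[OF assms(1)]
  have dp: "pdiff i p differentiable at x" for i x
    using assms(1) by (auto simp: homogeneous_def intro!: smooth_on_differentiable[of UNIV] smooth_on_pdiff)
  have 1: "pdiff i (\<lambda>x. ?N s x * p x) x
      = of_int s * (x $ i * (?N (s - 2) x * p x)) + ?N s x * pdiff i p x" if "x \<noteq> 0" for i x
    using pdiff_mult[OF pdiff_norm_powi(1)[OF that] d] pdiff_norm_powi(2)[OF that] by simp
  have 2: "pdiff i (pdiff i (\<lambda>x. ?N s x * p x)) x
      = of_int s * ?N (s - 2) x * p x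
        + of_int s * of_int (s - 2) * p x * ?N (s - 4) x * (x $ i * x $ i)
        + 2 * of_int s * ?N (s - 2) x * (x $ i * pdiff i p x)
        + ?N s x * pdiff i (pdiff i p) x" for i
  proof -
    have "pdiff i (pdiff i (\<lambda>x. ?N s x * p x)) x
        = pdiff i (\<lambda>x. of_int s * (x $ i * (?N (s - 2) x * p x)) + ?N s x * pdiff i p x) x"
      by (rule pdiff_cong[of "- {0}"]) (use 1 assms(2) in auto)
    moreover note dN = pdiff_norm_powi(1)[OF assms(2)]
    ultimately show ?thesis
      using assms(2)
      by (simp add: pdiff_add pdiff_mult pdiff_coord pdiff_norm_powi(2) d dp dN algebra_simps)
  qed
  have "laplacian (\<lambda>x. ?N s x * p x) x
      = real CARD('n) * (of_int s * ?N (s - 2) x * p x)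
        + of_int s * of_int (s - 2) * p x * ?N (s - 4) x * (\<Sum>i\<in>UNIV. x $ i * x $ i)
        + 2 * of_int s * ?N (s - 2) x * (\<Sum>i\<in>UNIV. x $ i * pdiff i p x)
        + ?N s x * laplacian p x"
    by (simp add: laplacian_def 2 sum.distrib sum_distrib_left)
  also have "(\<Sum>i\<in>UNIV. x $ i * x $ i) = ?N 2 x"
    using norm_power2_vec[of x] by simp
  also have "of_int s * of_int (s - 2) * p x * ?N (s - 4) x * ?N 2 x
      = of_int s * of_int (s - 2) * p x * ?N (s - 2) x"
    using assms(2) power_int_add[of "norm x" "s - 4" 2] by simp
  also note homogeneous_euler[OF assms(1)]
  finally show ?thesis by (simp add: algebra_simps)
qed

lemma laplacian_homogeneous_low:
  assumes "homogeneous k p" "k < 2"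
  shows "laplacian p x = 0"
proof -
  have "pdiff i (pdiff i p) = (\<lambda>x. 0)" for i
  proof (cases k)
    case 0
    with assms(1) have "p = (\<lambda>x. p 0)" by (auto intro: homogeneous_0D)
    then have "pdiff i p = (\<lambda>x. 0)" using pdiff_const[of i "p 0"] by metis
    then show ?thesis by simp
  next
    case (Suc l)
    then have "homogeneous 0 (pdiff i p)" using assms by (intro homogeneous_pdiff) simp
    then have "pdiff i p = (\<lambda>x. pdiff i p 0)" by (rule homogeneous_0D)
    then show ?thesis using pdiff_const[of i "pdiff i p 0"] by metis
  qed
  then show ?thesis by (simp add: laplacian_def)
qed

lemma homogeneous_laplacian:
  assumes "homogeneous (Suc (Suc k)) p"
  shows "homogeneous k (laplacian p)"
  unfolding laplacian_def[abs_def]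
  using assms by (intro homogeneous_sum homogeneous_pdiff)

lemma Ck_on_norm_power_mult:
  assumes "smooth_on UNIV q"
  shows "Ck_on m (- {0}) (\<lambda>x. norm x ^ s * q x)"
proof -
  have "Ck_on m (- {0}) q" using Ck_on_subset[of "- {0}" UNIV m q] assms by (simp add: smooth_on_def)
  from Ck_on_mult[OF open_Compl[OF closed_singleton] Ck_on_norm_powi[of m "int s"] this]
  show ?thesis by (simp only: power_int_of_nat)
qed

text \<open>A multiple of \<open>p\<close> solves the equation up to r^(s+2) times the Laplacian of
  \<open>p\<close>. That error has polynomial degree k - 2 but a higher power of r, so the induction
  on \<open>k\<close> must leave \<open>s\<close> arbitrary; it ends at degrees below 2, where the
  Laplacian vanishes.\<close>

lemma homogeneous_laplace_solvable:
  fixes p :: "real^'n::finite \<Rightarrow> real"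
  assumes "homogeneous k p"
  shows "\<exists>q. homogeneous k q \<and> (\<forall>x. x \<noteq> 0 \<longrightarrow> laplacian (\<lambda>x. norm x ^ (s + 2) * q x) x = norm x ^ s * p x)"
  using assms
proof (induction k arbitrary: p s rule: less_induct)
  case (less k)
  \<comment> \<open>The multiplier of the previous formula at exponent s + 2. Both factors are
    positive, so the division is legitimate.\<close>
  define c where "c = real (s + 2) * (real s + real CARD('n) + 2 * real k)"
  have c: "c > 0" unfolding c_def by (intro mult_pos_pos add_pos_nonneg add_nonneg_pos) auto
  define q0 where "q0 x = inverse c * p x" for x
  have q0: "homogeneous k q0" unfolding q0_def by (rule homogeneous_cmult[OF less.prems])
  have lq0: "laplacian q0 x = inverse c * laplacian p x" for x
    unfolding q0_def[abs_def] using less.prems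
    by (intro laplacian_cmult[of UNIV]) (auto simp: homogeneous_def smooth_on_def)
  have L0: "laplacian (\<lambda>x. norm x ^ (s + 2) * q0 x) x
      = norm x ^ s * p x + inverse c * (norm x ^ (s + 2) * laplacian p x)" if "x \<noteq> 0" for x
  proof -
    have "(\<lambda>x. norm x ^ (s + 2) * q0 x) = (\<lambda>x. norm x powi int (s + 2) * q0 x)"
      by (simp only: power_int_of_nat)
    then have "laplacian (\<lambda>x. norm x ^ (s + 2) * q0 x) x
        = c * norm x powi int s * q0 x + norm x powi int (s + 2) * laplacian q0 x"
      using laplacian_norm_powi_mult[OF q0 that, of "int (s + 2)"]
      by (simp add: c_def algebra_simps)
    also have "\<dots> = norm x ^ s * p x + inverse c * (norm x ^ (s + 2) * laplacian p x)"
      unfolding lq0 using c unfolding power_int_of_nat by (simp add: q0_def)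
    finally show ?thesis .
  qed
  show ?case
  proof (cases "k < 2")
    case True
    then show ?thesis
      using q0 L0 laplacian_homogeneous_low[OF less.prems True] by (intro exI[of _ q0]) simp
  next
    case False
    then obtain l where l: "k = Suc (Suc l)" by (metis Suc_1 Suc_diff_Suc less_2_cases_iff not0_implies_Suc One_nat_def)
    have "homogeneous l (laplacian p)" using less.prems l by (intro homogeneous_laplacian) simp
    from less.IH[OF _ this, of "s + 2"] l obtain q1 where q1: "homogeneous l q1"
      "\<And>x. x \<noteq> 0 \<Longrightarrow> laplacian (\<lambda>x. norm x ^ (s + 2 + 2) * q1 x) x = norm x ^ (s + 2) * laplacian p x"
      by auto
    \<comment> \<open>The factor r^2 restores degree \<open>k\<close> and turns the prefactor
      r^(s+2) into r^(s+4), the exponent for which \<open>q1\<close> was chosen.\<close>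
    define q where "q x = q0 x + (- inverse c) * (norm x ^ 2 * q1 x)" for x
    have "homogeneous k (\<lambda>x. norm x ^ 2 * q1 x)"
      using homogeneous_mult[OF homogeneous_norm_power2 q1(1)] l by simp
    then have "homogeneous k q"
      unfolding q_def by (intro homogeneous_add q0 homogeneous_cmult)
    moreover have "laplacian (\<lambda>x. norm x ^ (s + 2) * q x) x = norm x ^ s * p x" if "x \<noteq> 0" for x
    proof -
      have sm: "smooth_on UNIV q0" "smooth_on UNIV q1" using q0 q1 by (auto simp: homogeneous_def)
      have "(\<lambda>x. norm x ^ (s + 2) * q x)
          = (\<lambda>x. norm x ^ (s + 2) * q0 x + (- inverse c) * (norm x ^ (s + 2 + 2) * q1 x))"
        by (simp add: q_def fun_eq_iff algebra_simps power_add power2_eq_square)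
      moreover have C0: "Ck_on 2 (- {0}) (\<lambda>x. norm x ^ (s + 2) * q0 x)"
        and C1: "Ck_on 2 (- {0}) (\<lambda>x. norm x ^ (s + 2 + 2) * q1 x)"
        by (rule Ck_on_norm_power_mult[OF sm(1)], rule Ck_on_norm_power_mult[OF sm(2)])
      note o = open_Compl[OF closed_singleton[of "0::real^'n"]]
      ultimately have "laplacian (\<lambda>x. norm x ^ (s + 2) * q x) x
          = laplacian (\<lambda>x. norm x ^ (s + 2) * q0 x) x
            + laplacian (\<lambda>x. (- inverse c) * (norm x ^ (s + 2 + 2) * q1 x)) x"
        using laplacian_add[OF o _ C0 Ck_on_cmult[OF o C1, of "- inverse c"], of x] that
        by (simp only: Compl_iff singleton_iff not_False_eq_True simp_thms)
      also have "laplacian (\<lambda>x. (- inverse c) * (norm x ^ (s + 2 + 2) * q1 x)) x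
          = (- inverse c) * laplacian (\<lambda>x. norm x ^ (s + 2 + 2) * q1 x) x"
        by (rule laplacian_cmult[OF o _ C1]) (use that in simp)
      finally show ?thesis using L0[OF that] q1(2)[OF that] by simp
    qed
    ultimately show ?thesis by blast
  qed
qed

lemma polynomial_fn_laplace_solvable:
  assumes "polynomial_fn p"
  shows "\<exists>q. polynomial_fn q \<and> (\<forall>x. x \<noteq> 0 \<longrightarrow> laplacian (\<lambda>x. norm x ^ (s + 2) * q x) x = norm x ^ s * p x)"
  using assms
proof (induction rule: polynomial_fn.induct)
  case (hom k p)
  then show ?case using homogeneous_laplace_solvable[OF hom, of s] polynomial_fn.hom by blast
next
  case (add p p')
  then obtain q q' where q: "polynomial_fn q" "\<And>x. x \<noteq> 0 \<Longrightarrow> laplacian (\<lambda>x. norm x ^ (s + 2) * q x) x = norm x ^ s * p x"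
    and q': "polynomial_fn q'" "\<And>x. x \<noteq> 0 \<Longrightarrow> laplacian (\<lambda>x. norm x ^ (s + 2) * q' x) x = norm x ^ s * p' x"
    by auto
  have "laplacian (\<lambda>x. norm x ^ (s + 2) * (q x + q' x)) x = norm x ^ s * (p x + p' x)" if "x \<noteq> 0" for x
  proof -
    have "laplacian (\<lambda>x. norm x ^ (s + 2) * q x + norm x ^ (s + 2) * q' x) x
        = laplacian (\<lambda>x. norm x ^ (s + 2) * q x) x + laplacian (\<lambda>x. norm x ^ (s + 2) * q' x) x"
      using that by (intro laplacian_add[of "- {0}"] Ck_on_norm_power_mult polynomial_fn_smooth q q') auto
    then show ?thesis using q(2)[OF that] q'(2)[OF that] by (simp add: distrib_left)
  qed
  then show ?case using polynomial_fn.add[OF q(1) q'(1)] by blast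
qed

text \<open>P is treated with s = 0 and Q with s = 1, which gives r^2 p + r^3 q. The second term is
  not smooth, but its order 3 exceeds 2, so the solution is C^2 across the origin and may be
  subtracted from u.\<close>

lemma radial_poly_laplace_solvable:
  assumes "radial_poly g"
  obtains h where "radial_poly h" "Ck_on 2 UNIV h" "\<And>x. x \<noteq> 0 \<Longrightarrow> laplacian h x = g x"
proof -
  obtain P Q where g: "polynomial_fn P" "polynomial_fn Q" "g = (\<lambda>x. P x + norm x * Q x)"
    using assms by (auto simp: radial_poly_def)
  obtain p where p: "polynomial_fn p" "\<And>x. x \<noteq> 0 \<Longrightarrow> laplacian (\<lambda>x. norm x ^ (0 + 2) * p x) x = norm x ^ 0 * P x"
    using polynomial_fn_laplace_solvable[OF g(1)] by blast
  obtain q where q: "polynomial_fn q" "\<And>x. x \<noteq> 0 \<Longrightarrow> laplacian (\<lambda>x. norm x ^ (1 + 2) * q x) x = norm x ^ 1 * Q x"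
    using polynomial_fn_laplace_solvable[OF g(2)] by blast
  let ?p = "\<lambda>x. norm x ^ 2 * p x" and ?q = "\<lambda>x. norm x ^ 3 * q x"
  have pp: "polynomial_fn ?p" by (intro polynomial_fn_mult polynomial_fn_norm_power2 p)
  have C1: "Ck_on 2 UNIV ?p" using polynomial_fn_smooth[OF pp] by (simp add: smooth_on_def)
  have "conormal 2 (int 3 + 0) UNIV (\<lambda>x. norm x powi int 3 * q x)"
    by (intro conormal_mult conormal_norm_powi polynomial_fn_conormal q) auto
  then have "conormal 2 3 UNIV ?q" by (simp add: power_int_def)
  from conormal_imp_Ck_on[OF _ _ this] have C2: "Ck_on 2 UNIV ?q" by simp
  show ?thesis
  proof (rule that[of "\<lambda>x. ?p x + ?q x"])
    have "?q = (\<lambda>x. norm x * (norm x ^ 2 * q x))" by (simp add: power3_eq_cube power2_eq_square mult_ac)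
    then have "radial_poly ?q"
      using radial_poly_norm_mult[OF polynomial_fn_mult[OF polynomial_fn_norm_power2 q(1)]] by simp
    then show "radial_poly (\<lambda>x. ?p x + ?q x)"
      by (intro radial_poly_add radial_poly_polynomial[OF pp])
    show "Ck_on 2 UNIV (\<lambda>x. ?p x + ?q x)" by (intro Ck_on_add C1 C2) simp
    show "laplacian (\<lambda>x. ?p x + ?q x) x = g x" if "x \<noteq> 0" for x
    proof -
      have "laplacian ?p x = P x" using p(2)[OF that] by (simp only: add_0 power_0 mult_1)
      moreover have "laplacian ?q x = norm x * Q x"
      proof -
        have "(1::nat) + 2 = 3" by simp
        with q(2)[OF that] show ?thesis by (simp only: power_one_right)
      qed
      ultimately show ?thesis using laplacian_add[OF _ _ C1 C2, of x] g(3) by simp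
    qed
  qed
qed

section \<open>Borel's theorem\<close>

text \<open>The powers of 1/t make the family closed under differentiation up to linear
  combinations, so smoothness of compositions is an induction with \<open>n\<close>
  arbitrary.\<close>

definition flat_exp :: "nat \<Rightarrow> real \<Rightarrow> real" where
  "flat_exp n t = (if t > 0 then exp (- inverse t) / t ^ n else 0)"

lemma flat_exp_tendsto_0: "(flat_exp n \<longlongrightarrow> 0) (at_right 0)"
proof -
  have "((\<lambda>t::real. inverse t ^ n / exp (inverse t)) \<longlongrightarrow> 0) (at_right 0)"
    by (rule filterlim_compose[OF tendsto_power_div_exp_0 filterlim_inverse_at_top_right])
  then show ?thesis
  proof (rule Lim_transform_eventually)
    show "\<forall>\<^sub>F t in at_right 0. inverse t ^ n / exp (inverse t) = flat_exp n t"
      by (auto simp: eventually_at_filter flat_exp_def exp_minus field_simps)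
  qed
qed

lemma DERIV_flat_exp:
  "(flat_exp n has_real_derivative flat_exp (n + 2) t - real n * flat_exp (n + 1) t) (at t)"
proof -
  consider "t > 0" | "t < 0" | "t = 0" by linarith
  then show ?thesis
  proof cases
    case 1
    have "((\<lambda>t. exp (- inverse t)) has_real_derivative exp (- inverse t) * (inverse t * inverse t)) (at t)"
      using 1 by (auto intro!: derivative_eq_intros)
    moreover have "((\<lambda>t. inverse t ^ n) has_real_derivative - (real n * inverse t ^ (n + 1))) (at t)"
      using DERIV_power[OF DERIV_inverse[of t], of n] 1 by (cases n) (auto simp: mult_ac)
    ultimately have "((\<lambda>t. exp (- inverse t) * inverse t ^ n) has_real_derivative
        exp (- inverse t) * (inverse t * inverse t) * inverse t ^ n
        + - (real n * inverse t ^ (n + 1)) * exp (- inverse t)) (at t)"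
      by (rule DERIV_mult)
    moreover have "exp (- inverse t) * (inverse t * inverse t) * inverse t ^ n
        + - (real n * inverse t ^ (n + 1)) * exp (- inverse t)
        = flat_exp (n + 2) t - real n * flat_exp (n + 1) t"
      using 1 by (simp add: flat_exp_def divide_inverse power_inverse mult_ac)
    ultimately have "((\<lambda>t. exp (- inverse t) * inverse t ^ n) has_real_derivative
        flat_exp (n + 2) t - real n * flat_exp (n + 1) t) (at t)" by simp
    then show ?thesis
      by (rule has_field_derivative_transform_within_open[of _ _ _ "{0<..}"])
         (use 1 in \<open>auto simp: flat_exp_def field_simps\<close>)
  next
    case 2
    have "((\<lambda>t. 0) has_real_derivative flat_exp (n + 2) t - real n * flat_exp (n + 1) t) (at t)"
      using 2 by (simp add: flat_exp_def)
    then show ?thesis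
      by (rule has_field_derivative_transform_within_open[of _ _ _ "{..<0}"])
         (use 2 in \<open>auto simp: flat_exp_def\<close>)
  next
    case 3
    \<comment> \<open>To the right of 0 the difference quotient is the member \<open>Suc n\<close>
      of the same family; to the left it is 0.\<close>
    have "((\<lambda>y. (flat_exp n y - flat_exp n 0) / (y - 0)) \<longlongrightarrow> 0) (at_right 0)"
      by (rule Lim_transform_eventually[OF flat_exp_tendsto_0[of "Suc n"]])
         (auto simp: eventually_at_filter flat_exp_def field_simps)
    moreover have "((\<lambda>y. (flat_exp n y - flat_exp n 0) / (y - 0)) \<longlongrightarrow> 0) (at_left 0)"
      by (rule tendsto_eventually) (auto simp: eventually_at_filter flat_exp_def)
    ultimately have "((\<lambda>y. (flat_exp n y - flat_exp n 0) / (y - 0)) \<longlongrightarrow> 0) (at 0)"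
      by (simp add: filterlim_at_split)
    then show ?thesis using 3 by (simp add: has_field_derivative_iff flat_exp_def)
  qed
qed

lemma flat_exp_pos: "t > 0 \<Longrightarrow> flat_exp n t > 0"
  and flat_exp_nonneg: "flat_exp n t \<ge> 0"
  and flat_exp_zero: "t \<le> 0 \<Longrightarrow> flat_exp n t = 0"
  by (auto simp: flat_exp_def)

lemma Ck_on_flat_exp:
  assumes "open S" "Ck_on k S f"
  shows "Ck_on k S (\<lambda>x. flat_exp n (f x))"
  using assms(2)
proof (induction k arbitrary: n)
  case 0
  have "continuous_on UNIV (flat_exp n)"
    by (auto intro!: continuous_at_imp_continuous_on DERIV_isCont DERIV_flat_exp)
  then show ?case using 0 by (auto intro: continuous_on_compose2)
next
  case (Suc k)
  have f: "f differentiable at x" if "x \<in> S" for x using Suc.prems that by simp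
  have "Ck_on k S (pdiff i (\<lambda>x. flat_exp n (f x)))" for i
  proof (rule Ck_on_cong[OF assms(1)])
    show "(flat_exp (n + 2) (f x) - real n * flat_exp (n + 1) (f x)) * pdiff i f x
        = pdiff i (\<lambda>x. flat_exp n (f x)) x" if "x \<in> S" for x
      by (rule pdiff_chain_real(2)[OF DERIV_flat_exp f[OF that], symmetric])
    show "Ck_on k S (\<lambda>x. (flat_exp (n + 2) (f x) - real n * flat_exp (n + 1) (f x)) * pdiff i f x)"
      using Suc.prems Suc.IH[OF Ck_on_SucD[OF Suc.prems]]
      by (intro Ck_on_mult Ck_on_diff Ck_on_cmult assms(1)) auto
  qed
  then show ?case using pdiff_chain_real(1)[OF DERIV_flat_exp f] by auto
qed

lemma smooth_on_norm_power2: "smooth_on UNIV (\<lambda>x :: real^'n::finite. norm x ^ 2)"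
  using homogeneous_norm_power2 unfolding homogeneous_def by blast

text \<open>The usual quotient of flat functions. The two summands of the denominator never vanish
  together, since |x|^2 is below 2 or above 1.\<close>

definition cutoff :: "real^'n::finite \<Rightarrow> real" where
  "cutoff x = flat_exp 0 (2 - norm x ^ 2) * inverse (flat_exp 0 (2 - norm x ^ 2) + flat_exp 0 (norm x ^ 2 - 1))"

lemma smooth_cutoff: "smooth_on UNIV cutoff"
proof -
  have "Ck_on k UNIV (\<lambda>x::real^'n. flat_exp 0 (2 - norm x ^ 2))"
    "Ck_on k UNIV (\<lambda>x::real^'n. flat_exp 0 (norm x ^ 2 - 1))" for k
    using smooth_on_norm_power2[where 'n='n]
    by (auto simp: smooth_on_def intro!: Ck_on_flat_exp Ck_on_diff)
  moreover have "flat_exp 0 (2 - norm x ^ 2) + flat_exp 0 (norm x ^ 2 - 1) \<noteq> 0" for x :: "real^'n"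
  proof (cases "norm x ^ 2 < 2")
    case True
    then show ?thesis using flat_exp_pos[of "2 - norm x ^ 2" 0] flat_exp_nonneg[of 0 "norm x ^ 2 - 1"] by linarith
  next
    case False
    then show ?thesis using flat_exp_pos[of "norm x ^ 2 - 1" 0] flat_exp_nonneg[of 0 "2 - norm x ^ 2"] by linarith
  qed
  ultimately show ?thesis
    unfolding smooth_on_def cutoff_def[abs_def]
    by (intro allI Ck_on_mult Ck_on_inverse Ck_on_add) auto
qed

lemma cutoff_eq_1: "norm x \<le> 1 \<Longrightarrow> cutoff x = 1"
proof -
  assume "norm x \<le> 1"
  then have "norm x ^ 2 \<le> 1" by (simp add: power_le_one)
  then show ?thesis using flat_exp_pos[of "2 - norm x ^ 2" 0] by (simp add: cutoff_def flat_exp_zero)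
qed

lemma cutoff_eq_0: "2 \<le> norm x \<Longrightarrow> cutoff x = 0"
proof -
  assume "2 \<le> norm x"
  then have "2 ^ 2 \<le> norm x ^ 2" by (intro power_mono) auto
  then show ?thesis by (simp add: cutoff_def flat_exp_zero)
qed

section \<open>Series of smooth functions and summation of homogeneous terms\<close>

fun pdiffs :: "'n list \<Rightarrow> (real^'n::finite \<Rightarrow> real) \<Rightarrow> real^'n \<Rightarrow> real" where
  "pdiffs [] f = f"
| "pdiffs (i # is) f = pdiffs is (pdiff i f)"

lemma smooth_pdiffs: "smooth_on S f \<Longrightarrow> smooth_on S (pdiffs is f)"
  by (induction "is" arbitrary: f) (auto intro: smooth_on_pdiff)

lemma pdiffs_scale:
  assumes "smooth_on UNIV f"
  shows "pdiffs is (\<lambda>x. c * f (l *\<^sub>R x)) = (\<lambda>x. c * l ^ length is * pdiffs is f (l *\<^sub>R x))"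
  using assms
proof (induction "is" arbitrary: f c)
  case (Cons i "is")
  have "pdiff i (\<lambda>x. c * f (l *\<^sub>R x)) = (\<lambda>x. (c * l) * pdiff i f (l *\<^sub>R x))"
  proof
    fix x
    have d: "f differentiable at (0 + l *\<^sub>R x)" using Cons.prems by (rule smooth_on_differentiable) simp
    show "pdiff i (\<lambda>x. c * f (l *\<^sub>R x)) x = (c * l) * pdiff i f (l *\<^sub>R x)"
      using pdiff_mult[of "\<lambda>x. c" x "\<lambda>x. f (l *\<^sub>R x)" i] pdiff_affine[OF d] by simp
  qed
  then show ?case using Cons.IH[OF smooth_on_pdiff[OF Cons.prems], of "c * l" i] by (simp add: mult_ac)
qed simp

lemma pdiffs_zero_on:
  assumes "open U" "\<And>x. x \<in> U \<Longrightarrow> f x = 0" "x \<in> U"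
  shows "pdiffs is f x = 0"
  using assms(2)
proof (induction "is" arbitrary: f)
  case (Cons i "is")
  have "pdiff i f y = 0" if "y \<in> U" for y
    using pdiff_cong[OF assms(1) that, of f "\<lambda>x. 0" i] Cons.prems by simp
  then show ?case using Cons.IH by simp
qed (use assms in simp)

lemma pdiffs_bounded:
  fixes f :: "real^'n::finite \<Rightarrow> real"
  assumes "smooth_on UNIV f" "\<And>x. norm x > r \<Longrightarrow> f x = 0"
  shows "\<exists>B\<ge>0. \<forall>x. \<bar>pdiffs is f x\<bar> \<le> B"
proof -
  have "continuous_on (cball 0 r) (pdiffs is f)"
    using smooth_on_continuous[OF smooth_pdiffs[OF assms(1)]] by (rule continuous_on_subset) simp
  then have "bounded (pdiffs is f ` cball 0 r)"
    by (intro compact_imp_bounded compact_continuous_image compact_cball)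
  then obtain C where C: "\<And>x. norm x \<le> r \<Longrightarrow> \<bar>pdiffs is f x\<bar> \<le> C"
    unfolding bounded_iff by (auto simp: cball_def)
  have "pdiffs is f x = 0" if "norm x > r" for x
    using that assms(2) by (intro pdiffs_zero_on[of "- cball 0 r"]) auto
  then have "\<bar>pdiffs is f x\<bar> \<le> max C 0" for x
    using C[of x] by (cases "norm x \<le> r") auto
  then show ?thesis by (intro exI[of _ "max C 0"]) auto
qed

text \<open>The Weierstrass test for each derivative separately. As the majorant may depend on
  \<open>is\<close>, the terms may be large for finitely many \<open>k\<close> depending on the
  order of differentiation, which Borel's construction requires.\<close>

definition smooth_summable :: "(nat \<Rightarrow> real^'n::finite \<Rightarrow> real) \<Rightarrow> bool" where
  "smooth_summable \<phi> \<longleftrightarrow> (\<forall>k. smooth_on UNIV (\<phi> k))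
     \<and> (\<forall>is. \<exists>M. summable M \<and> (\<forall>k x. \<bar>pdiffs is (\<phi> k) x\<bar> \<le> M k))"

lemma smooth_summable_pdiff: "smooth_summable \<phi> \<Longrightarrow> smooth_summable (\<lambda>k. pdiff i (\<phi> k))"
  unfolding smooth_summable_def by (metis pdiffs.simps(2) smooth_on_pdiff)

lemma smooth_summable_ignore: "smooth_summable \<phi> \<Longrightarrow> smooth_summable (\<lambda>k. \<phi> (k + m))"
  unfolding smooth_summable_def by (metis summable_iff_shift)

lemma smooth_summable_summable: "smooth_summable \<phi> \<Longrightarrow> summable (\<lambda>k. \<phi> k x)"
  unfolding smooth_summable_def
  by (metis pdiffs.simps(1) real_norm_def summable_comparison_test')

text \<open>There are only finitely many first partial derivatives, each converging uniformly, so
  the derivatives converge uniformly as linear maps; this permits differentiation term by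
  term.\<close>

lemma smooth_summable_has_derivative:
  fixes \<phi> :: "nat \<Rightarrow> real^'n::finite \<Rightarrow> real"
  assumes "smooth_summable \<phi>"
  shows "((\<lambda>x. \<Sum>k. \<phi> k x) has_derivative (\<lambda>h. \<Sum>i\<in>UNIV. h $ i * (\<Sum>k. pdiff i (\<phi> k) x))) (at x)"
proof -
  define D where "D x h = (\<Sum>i\<in>UNIV. h $ i * (\<Sum>k. pdiff i (\<phi> k) x))" for x and h :: "real^'n"
  have "\<forall>\<^sub>F n in sequentially. \<forall>x. \<bar>(\<Sum>k<n. pdiff i (\<phi> k) x) - (\<Sum>k. pdiff i (\<phi> k) x)\<bar> < e" if "e > 0" for e i
  proof -
    from assms obtain M where M: "summable M" "\<And>k x. \<bar>pdiffs [i] (\<phi> k) x\<bar> \<le> M k"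
      unfolding smooth_summable_def by metis
    then have "uniform_limit UNIV (\<lambda>n x. \<Sum>k<n. pdiff i (\<phi> k) x) (\<lambda>x. \<Sum>k. pdiff i (\<phi> k) x) sequentially"
      by (intro Weierstrass_m_test[of _ _ M]) auto
    from uniform_limitD[OF this that] show ?thesis by (simp add: dist_real_def)
  qed
  then have lim: "\<forall>\<^sub>F n in sequentially. \<forall>i x. \<bar>(\<Sum>k<n. pdiff i (\<phi> k) x) - (\<Sum>k. pdiff i (\<phi> k) x)\<bar> < e" if "e > 0" for e
    using that by (simp add: eventually_all_finite)
  have "\<exists>g. \<forall>x\<in>UNIV. (\<lambda>k. \<phi> k x) sums (g x) \<and> (g has_derivative D x) (at x within UNIV)"
  proof (rule has_derivative_series[where f'="\<lambda>k x h. \<Sum>i\<in>UNIV. h $ i * pdiff i (\<phi> k) x" and x=0 and l="\<Sum>k. \<phi> k 0"])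
    show "(\<phi> k has_derivative (\<lambda>h. \<Sum>i\<in>UNIV. h $ i * pdiff i (\<phi> k) x)) (at x within UNIV)" for k x
      using assms by (intro has_derivative_pdiff smooth_on_differentiable[of UNIV]) (auto simp: smooth_summable_def)
    show "(\<lambda>k. \<phi> k 0) sums (\<Sum>k. \<phi> k 0)"
      using smooth_summable_summable[OF assms] by (rule summable_sums)
    fix e :: real assume "e > 0"
    \<comment> \<open>The tolerance is shared among the coordinates.\<close>
    define e' where "e' = e / real CARD('n)"
    have "e' > 0" using \<open>e > 0\<close> by (simp add: e'_def)
    from lim[OF this] show "\<forall>\<^sub>F n in sequentially. \<forall>x\<in>UNIV. \<forall>h.
        norm ((\<Sum>k<n. \<Sum>i\<in>UNIV. h $ i * pdiff i (\<phi> k) x) - D x h) \<le> e * norm h"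
    proof eventually_elim
      case (elim n)
      show ?case
      proof (intro ballI allI)
        fix x and h :: "real^'n"
        have "(\<Sum>k<n. \<Sum>i\<in>UNIV. h $ i * pdiff i (\<phi> k) x) - D x h
            = (\<Sum>i\<in>UNIV. h $ i * ((\<Sum>k<n. pdiff i (\<phi> k) x) - (\<Sum>k. pdiff i (\<phi> k) x)))"
          unfolding D_def by (subst sum.swap) (simp add: sum_distrib_left sum_subtractf right_diff_distrib)
        also have "\<bar>\<dots>\<bar> \<le> (\<Sum>i\<in>(UNIV::'n set). norm h * e')"
          by (rule order.trans[OF sum_abs sum_mono])
             (unfold abs_mult, rule mult_mono[OF component_le_norm_cart less_imp_le[OF elim[rule_format]]], simp_all)
        also have "\<dots> = e * norm h" by (simp add: e'_def)
        finally show "norm ((\<Sum>k<n. \<Sum>i\<in>UNIV. h $ i * pdiff i (\<phi> k) x) - D x h) \<le> e * norm h" by simp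
      qed
    qed
  qed auto
  then obtain g where g: "\<And>x. (\<lambda>k. \<phi> k x) sums (g x)" "\<And>x. (g has_derivative D x) (at x)" by auto
  have "g = (\<lambda>x. \<Sum>k. \<phi> k x)" using g(1) sums_unique by blast
  with g(2) show ?thesis by (simp add: D_def[abs_def])
qed

lemma pdiff_suminf:
  assumes "smooth_summable \<phi>"
  shows "pdiff i (\<lambda>x. \<Sum>k. \<phi> k x) = (\<lambda>x. \<Sum>k. pdiff i (\<phi> k) x)"
  by (rule ext, subst pdiff_has_derivative[OF smooth_summable_has_derivative[OF assms]])
     (simp add: axis_def if_distrib if_distribR cong: if_cong)

lemma smooth_on_suminf:
  assumes "smooth_summable \<phi>"
  shows "smooth_on UNIV (\<lambda>x. \<Sum>k. \<phi> k x)"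
proof -
  have "Ck_on m UNIV (\<lambda>x. \<Sum>k. \<phi> k x)" for m
    using assms
  proof (induction m arbitrary: \<phi>)
    case 0
    then show ?case
      using has_derivative_continuous[OF smooth_summable_has_derivative[OF 0]]
      by (auto intro!: continuous_at_imp_continuous_on)
  next
    case (Suc m)
    then show ?case
      using smooth_summable_has_derivative[OF Suc.prems] smooth_summable_pdiff[OF Suc.prems]
      by (auto simp: pdiff_suminf[OF Suc.prems] differentiable_def)
  qed
  then show ?thesis by (simp add: smooth_on_def)
qed

lemma vanishing_suminf:
  assumes "smooth_summable \<phi>" "\<And>k. vanishing m (\<phi> k)"
  shows "vanishing m (\<lambda>x. \<Sum>k. \<phi> k x)"
  using assms
proof (induction m arbitrary: \<phi>)
  case (Suc m)
  then show ?case
    using Suc.IH[OF smooth_summable_pdiff[OF Suc.prems(1)]] by (simp add: pdiff_suminf[OF Suc.prems(1)])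
qed simp

lemma homogeneous_vanishing: "homogeneous k f \<Longrightarrow> m \<le> k \<Longrightarrow> vanishing m f"
proof (induction m arbitrary: k f)
  case (Suc m)
  then obtain l where l: "k = Suc l" by (cases k) auto
  have "f (0 *\<^sub>R 0) = 0 ^ k * f 0" using Suc.prems(1) unfolding homogeneous_def by blast
  then have "f 0 = 0" using l by simp
  moreover have "vanishing m (pdiff i f)" for i
    using Suc.prems l by (intro Suc.IH[of l] homogeneous_pdiff) auto
  ultimately show ?case by simp
qed simp

text \<open>Each \<open>p k\<close> is cut off at a radius proportional to 1/l_k, which changes
  nothing near the origin. In a derivative of order j the rescaling costs l_k^j while homogeneity
  gains l_k^(-k), so for j < k a factor 1/l_k is left over to absorb any bound fixed
  beforehand.\<close>

theorem borel_expansion: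
  fixes p :: "nat \<Rightarrow> real^'n::finite \<Rightarrow> real"
  assumes "\<And>k. homogeneous k (p k)"
  obtains f where "smooth_on UNIV f" "\<And>m. conormal m (int m) UNIV (\<lambda>x. f x - (\<Sum>k<m. p k x))"
proof -
  define \<psi> where "\<psi> k x = p k x * cutoff x" for k x
  have sp: "smooth_on UNIV (p k)" for k using assms by (simp add: homogeneous_def)
  have s\<psi>: "smooth_on UNIV (\<psi> k)" for k
    unfolding \<psi>_def by (intro smooth_on_mult smooth_cutoff sp) simp
  have "\<exists>B\<ge>0. \<forall>x. \<bar>pdiffs is (\<psi> k) x\<bar> \<le> B" for k "is"
    by (rule pdiffs_bounded[OF s\<psi>, of 2]) (simp add: \<psi>_def cutoff_eq_0)
  then have "\<forall>k. \<forall>is. \<exists>B. B \<ge> 0 \<and> (\<forall>x. \<bar>pdiffs is (\<psi> k) x\<bar> \<le> B)" by blast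
  then obtain B where "\<forall>k is. B k is \<ge> 0 \<and> (\<forall>x. \<bar>pdiffs is (\<psi> k) x\<bar> \<le> B k is)"
    unfolding choice_iff by blast
  then have B: "\<And>k is. B k is \<ge> 0" "\<And>k is x. \<bar>pdiffs is (\<psi> k) x\<bar> \<le> B k is" by auto
  \<comment> \<open>Large enough to beat 2^k times the bounds for all derivatives of order at most
    \<open>k\<close>, of which there are finitely many. The summand 1 ensures that
    \<open>l k\<close> is at least 1.\<close>
  define l where "l k = 1 + 2 ^ k * (\<Sum>is | length is \<le> k. B k is)" for k
  have l1: "l k \<ge> 1" for k unfolding l_def using B(1) by (simp add: sum_nonneg)
  define \<phi> where "\<phi> k x = inverse (l k) ^ k * \<psi> k (l k *\<^sub>R x)" for k x
  have \<phi>: "\<phi> k x = p k x * cutoff (l k *\<^sub>R x)" for k x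
  proof -
    have "p k (l k *\<^sub>R x) = l k ^ k * p k x" using assms by (simp add: homogeneous_def)
    moreover have "inverse (l k) ^ k * l k ^ k = 1" using l1[of k] by (simp flip: power_mult_distrib)
    ultimately show ?thesis by (simp add: \<phi>_def \<psi>_def flip: mult.assoc)
  qed
  have pd: "pdiffs is (\<phi> k) x = inverse (l k) ^ k * l k ^ length is * pdiffs is (\<psi> k) (l k *\<^sub>R x)" for k "is" x
    unfolding \<phi>_def[abs_def] using pdiffs_scale[OF s\<psi>] by simp
  have small: "\<bar>pdiffs is (\<phi> k) x\<bar> \<le> (1/2) ^ k" if len: "length is < k" for k "is" x
  proof -
    have "B k is \<le> (\<Sum>is | length is \<le> k. B k is)"
      using that B(1) finite_lists_length_le[OF finite, of UNIV k] by (intro member_le_sum) auto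
    then have "B k is * 2 ^ k \<le> (\<Sum>is | length is \<le> k. B k is) * 2 ^ k"
      by (rule mult_right_mono) simp
    then have Bl: "B k is * 2 ^ k \<le> l k"
      unfolding l_def mult.commute[of "2 ^ k"] by linarith
    obtain j where j: "k = Suc (length is + j)" using less_imp_Suc_add[OF len] by blast
    define a where "a = inverse (l k)"
    have a: "a * l k = 1" "0 \<le> a" "a \<le> 1"
      using l1[of k] by (auto simp: a_def inverse_le_1_iff)
    have "a ^ k = a * a ^ j * a ^ length is" by (subst j) (simp add: power_add mult_ac)
    then have "a ^ k * l k ^ length is = a * a ^ j * (a * l k) ^ length is"
      by (simp only: power_mult_distrib mult.assoc)
    also have "\<dots> \<le> a * 1"
      unfolding a(1) using a by (simp add: mult_left_le power_le_one)
    finally have "inverse (l k) ^ k * l k ^ length is \<le> inverse (l k)" by (simp add: a_def)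
    note le = this
    have "\<bar>pdiffs is (\<phi> k) x\<bar> = inverse (l k) ^ k * l k ^ length is * \<bar>pdiffs is (\<psi> k) (l k *\<^sub>R x)\<bar>"
      using l1[of k] by (simp add: pd abs_mult)
    also have "\<dots> \<le> inverse (l k) * B k is"
      using l1[of k] B le by (intro mult_mono) auto
    also have "\<dots> \<le> (1/2) ^ k" using Bl l1[of k] by (simp add: field_simps power_divide)
    finally show ?thesis .
  qed
  have sum: "smooth_summable \<phi>"
    unfolding smooth_summable_def
  proof (intro conjI allI)
    show "smooth_on UNIV (\<phi> k)" for k
      unfolding \<phi>_def[abs_def] smooth_on_def
      using Ck_on_affine[of UNIV _ "\<psi> k" 0 "l k"] s\<psi>[of k] by (auto simp: smooth_on_def intro: Ck_on_cmult)
    fix "is" :: "'n list"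
    \<comment> \<open>A geometric majorant for k above the order of differentiation, plus the
      finitely many terms to which \<open>small\<close> does not apply.\<close>
    define M where "M k = (1/2) ^ k + (if k \<in> {..length is} then inverse (l k) ^ k * l k ^ length is * B k is else 0)" for k
    have "summable M"
      unfolding M_def by (intro summable_add summable_If_finite_set summable_geometric) auto
    moreover have "\<bar>pdiffs is (\<phi> k) x\<bar> \<le> M k" for k x
    proof (cases "length is < k")
      case True
      then show ?thesis using small by (simp add: M_def)
    next
      case False
      have "\<bar>pdiffs is (\<phi> k) x\<bar> = inverse (l k) ^ k * l k ^ length is * \<bar>pdiffs is (\<psi> k) (l k *\<^sub>R x)\<bar>"
        using l1[of k] by (simp add: pd abs_mult)
      also have "\<dots> \<le> inverse (l k) ^ k * l k ^ length is * B k is"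
        using l1[of k] B by (intro mult_left_mono) auto
      also have "\<dots> \<le> M k" using False by (simp add: M_def)
      finally show ?thesis .
    qed
    ultimately show "\<exists>M. summable M \<and> (\<forall>k x. \<bar>pdiffs is (\<phi> k) x\<bar> \<le> M k)" by blast
  qed
  have near: "\<phi> k x = p k x" if "norm x \<le> inverse (l k)" for k x
  proof -
    have "norm (l k *\<^sub>R x) \<le> 1" using that l1[of k] by (simp add: field_simps)
    then show ?thesis by (simp add: \<phi> cutoff_eq_1)
  qed
  show ?thesis
  proof (rule that[of "\<lambda>x. \<Sum>k. \<phi> k x"])
    show sm: "smooth_on UNIV (\<lambda>x. \<Sum>k. \<phi> k x)" by (rule smooth_on_suminf[OF sum])
    fix m
    have vk: "vanishing m (\<phi> (k + m))" for k
    proof (rule vanishing_cong[of "ball 0 (inverse (l (k + m)))"])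
      show "vanishing m (p (k + m))" by (rule homogeneous_vanishing[OF assms]) simp
      show "0 \<in> ball 0 (inverse (l (k + m)))" using l1[of "k + m"] by simp
    qed (auto simp: near)
    \<comment> \<open>A radius below 1/l_k for each k < m: in this ball the first \<open>m\<close>
      terms of the series are exactly \<open>p k\<close>, and the remainder is the tail, whose terms
      all vanish to order \<open>m\<close>.\<close>
    define r where "r = inverse (1 + (\<Sum>k<m. l k))"
    have S0: "(\<Sum>k<m. l k) \<ge> 0" using l1 by (intro sum_nonneg) (meson order_trans zero_le_one)
    have r: "r > 0" "k < m \<Longrightarrow> r \<le> inverse (l k)" for k
    proof -
      show "r > 0" unfolding r_def using S0 by simp
      assume "k < m"
      then have "l k \<le> (\<Sum>k<m. l k)"
        using l1 by (intro member_le_sum) (auto intro: order_trans[OF zero_le_one])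
      then show "r \<le> inverse (l k)"
        unfolding r_def using l1[of k] by (intro le_imp_inverse_le) auto
    qed
    have "vanishing m (\<lambda>x. (\<Sum>k. \<phi> k x) - (\<Sum>k<m. p k x))"
    proof (rule vanishing_cong[of "ball 0 r"])
      show "vanishing m (\<lambda>x. \<Sum>k. \<phi> (k + m) x)"
        by (rule vanishing_suminf[OF smooth_summable_ignore[OF sum] vk])
      fix x :: "real^'n" assume "x \<in> ball 0 r"
      then have "(\<Sum>k<m. \<phi> k x) = (\<Sum>k<m. p k x)"
        using r(2) by (intro sum.cong near refl) force
      then show "(\<Sum>k. \<phi> (k + m) x) = (\<Sum>k. \<phi> k x) - (\<Sum>k<m. p k x)"
        using suminf_split_initial_segment[OF smooth_summable_summable[OF sum], of x m] by simp
    qed (use r in auto)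
    moreover have "smooth_on UNIV (\<lambda>x. (\<Sum>k. \<phi> k x) - (\<Sum>k<m. p k x))"
      by (intro smooth_on_diff smooth_on_sum sm sp) auto
    ultimately show "conormal m (int m) UNIV (\<lambda>x. (\<Sum>k. \<phi> k x) - (\<Sum>k<m. p k x))"
      by (intro vanishing_conormal) (auto simp: smooth_on_def)
  qed
qed

section \<open>Interior regularity for the Laplacian\<close>

text \<open>The parameter space is left general for two uses: y in the cube with shift d y, and
  pairs (s, y) with shift s y.\<close>

definition weighted_avg ::
  "'t::euclidean_space set \<Rightarrow> ('t \<Rightarrow> real) \<Rightarrow> ('t \<Rightarrow> real^'n) \<Rightarrow> (real^'n::finite \<Rightarrow> real) \<Rightarrow> real^'n \<Rightarrow> real"
  where "weighted_avg T \<kappa> \<sigma> g x = integral T (\<lambda>p. \<kappa> p * g (x - \<sigma> p))"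

context
  fixes a b :: "'t::euclidean_space" and \<kappa> :: "'t \<Rightarrow> real" and \<sigma> :: "'t \<Rightarrow> real^'n::finite"
    and U W :: "(real^'n) set"
  assumes \<kappa>: "continuous_on (cbox a b) \<kappa>" and \<sigma>: "continuous_on (cbox a b) \<sigma>"
    and U: "open U" "convex U" and W: "open W"
    and UW: "\<And>x p. x \<in> U \<Longrightarrow> p \<in> cbox a b \<Longrightarrow> x - \<sigma> p \<in> W"
begin

private lemma continuous_integrand:
  assumes "continuous_on W g"
  shows "continuous_on (U \<times> cbox a b) (\<lambda>(x, p). \<kappa> p * g (x - \<sigma> p))"
proof -
  have 1: "continuous_on (U \<times> cbox a b) (\<lambda>z. \<kappa> (snd z))"
    by (rule continuous_on_compose2[OF \<kappa> continuous_on_snd[OF continuous_on_id]]) auto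
  have 2: "continuous_on (U \<times> cbox a b) (\<lambda>z. \<sigma> (snd z))"
    by (rule continuous_on_compose2[OF \<sigma> continuous_on_snd[OF continuous_on_id]]) auto
  have 3: "continuous_on (U \<times> cbox a b) (\<lambda>z. g (fst z - \<sigma> (snd z)))"
    by (rule continuous_on_compose2[OF assms continuous_on_diff[OF continuous_on_fst[OF continuous_on_id] 2]])
       (use UW in auto)
  show ?thesis using continuous_on_mult[OF 1 3] by (simp add: case_prod_beta)
qed

private lemma continuous_integrand_fixed:
  assumes "continuous_on W g" "x \<in> U"
  shows "continuous_on (cbox a b) (\<lambda>p. \<kappa> p * g (x - \<sigma> p))"
proof -
  have "continuous_on (cbox a b) (\<lambda>p. (\<lambda>(x, p). \<kappa> p * g (x - \<sigma> p)) (x, p))"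
    by (rule continuous_on_compose2[OF continuous_integrand[OF assms(1)]
          continuous_on_Pair[OF continuous_on_const continuous_on_id]]) (use assms(2) in auto)
  then show ?thesis by simp
qed

lemma weighted_avg_continuous:
  "continuous_on W g \<Longrightarrow> continuous_on U (weighted_avg (cbox a b) \<kappa> \<sigma> g)"
  unfolding weighted_avg_def[abs_def]
  by (rule integral_continuous_on_param[OF continuous_integrand])

lemma weighted_avg_pdiff:
  assumes g: "Ck_on (Suc 0) W g" and x: "x \<in> U"
  shows "weighted_avg (cbox a b) \<kappa> \<sigma> g differentiable at x"
    "pdiff i (weighted_avg (cbox a b) \<kappa> \<sigma> g) x = weighted_avg (cbox a b) \<kappa> \<sigma> (pdiff i g) x"
proof -
  \<comment> \<open>\<open>leibniz_rule\<close> takes the derivative as a bounded linear map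
    depending continuously on the parameters; it is assembled here from the coordinate
    functionals.\<close>
  define L where "L i = Blinfun (\<lambda>h::real^'n. h $ i)" for i
  have L: "blinfun_apply (L i) h = h $ i" for i h
    unfolding L_def by (simp add: bounded_linear_Blinfun_apply bounded_linear_vec_nth)
  define fx where "fx x p = (\<Sum>i\<in>UNIV. (\<kappa> p * pdiff i g (x - \<sigma> p)) *\<^sub>R L i)" for x p
  have fx: "blinfun_apply (fx x p) h = (\<Sum>i\<in>UNIV. \<kappa> p * pdiff i g (x - \<sigma> p) * h $ i)" for x p h
    by (simp add: fx_def blinfun.sum_left blinfun.scaleR_left L)
  have cg: "continuous_on W g" by (rule Ck_on_imp_continuous[OF g])
  have cp: "continuous_on W (pdiff i g)" for i using g by simp
  have D: "((\<lambda>x. integral (cbox a b) (\<lambda>p. \<kappa> p * g (x - \<sigma> p))) has_derivative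
      blinfun_apply (integral (cbox a b) (fx x))) (at x within U)"
  proof (rule leibniz_rule)
    fix x p assume xp: "x \<in> U" "p \<in> cbox a b"
    have "g differentiable at (x - \<sigma> p)" using g UW[OF xp] by simp
    moreover have "((\<lambda>x. x - \<sigma> p) has_derivative (\<lambda>h. h)) (at x)"
      by (auto intro!: derivative_eq_intros)
    ultimately have "((\<lambda>x. g (x - \<sigma> p)) has_derivative (\<lambda>h. \<Sum>i\<in>UNIV. h $ i * pdiff i g (x - \<sigma> p))) (at x)"
      using has_derivative_compose[where g=g] has_derivative_pdiff by blast
    from has_derivative_mult_right[OF this, of "\<kappa> p"]
    have "((\<lambda>x. \<kappa> p * g (x - \<sigma> p)) has_derivative blinfun_apply (fx x p)) (at x)"
      by (simp add: fx[abs_def] sum_distrib_left mult_ac)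
    then show "((\<lambda>x. \<kappa> p * g (x - \<sigma> p)) has_derivative blinfun_apply (fx x p)) (at x within U)"
      by (rule has_derivative_at_withinI)
  next
    fix x assume "x \<in> U"
    then show "(\<lambda>p. \<kappa> p * g (x - \<sigma> p)) integrable_on cbox a b"
      by (intro integrable_continuous continuous_integrand_fixed cg)
  next
    show "continuous_on (U \<times> cbox a b) (\<lambda>(x, p). fx x p)"
      unfolding fx_def case_prod_beta
      using continuous_integrand[OF cp]
      by (intro continuous_on_sum continuous_on_scaleR continuous_on_const) (simp add: case_prod_beta)
  qed (use x U in auto)
  then have D': "(weighted_avg (cbox a b) \<kappa> \<sigma> g has_derivative
      blinfun_apply (integral (cbox a b) (fx x))) (at x)"
    using at_within_open[OF x U(1)] by (simp add: weighted_avg_def[abs_def])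
  then show "weighted_avg (cbox a b) \<kappa> \<sigma> g differentiable at x" by (auto simp: differentiable_def)
  have ci: "continuous_on (cbox a b) (fx x)"
    unfolding fx_def
    by (intro continuous_on_sum continuous_on_scaleR continuous_on_const continuous_integrand_fixed cp x)
  have "blinfun_apply (integral (cbox a b) (fx x)) (axis i 1)
      = integral (cbox a b) (\<lambda>p. blinfun_apply (fx x p) (axis i 1))"
    by (rule blinfun_apply_integral[OF integrable_continuous[OF ci]])
  also have "\<dots> = weighted_avg (cbox a b) \<kappa> \<sigma> (pdiff i g) x"
    by (simp add: weighted_avg_def fx axis_def if_distrib if_distribR cong: if_cong)
  finally show "pdiff i (weighted_avg (cbox a b) \<kappa> \<sigma> g) x = weighted_avg (cbox a b) \<kappa> \<sigma> (pdiff i g) x"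
    using pdiff_has_derivative[OF D'] by simp
qed

lemma weighted_avg_Ck_on:
  "Ck_on m W g \<Longrightarrow> Ck_on m U (weighted_avg (cbox a b) \<kappa> \<sigma> g)"
proof (induction m arbitrary: g)
  case 0
  then show ?case using weighted_avg_continuous by simp
next
  case (Suc m)
  have g1: "Ck_on (Suc 0) W g" by (rule Ck_on_mono[OF _ Suc.prems]) simp
  have "Ck_on m U (pdiff i (weighted_avg (cbox a b) \<kappa> \<sigma> g))" for i
    by (rule Ck_on_cong[OF U(1), of "weighted_avg (cbox a b) \<kappa> \<sigma> (pdiff i g)"])
       (use weighted_avg_pdiff(2)[OF g1] Suc in auto)
  then show ?case using weighted_avg_pdiff(1)[OF g1] by simp
qed

end

text \<open>A box, because differentiation under the integral and Fubini are applied over boxes. The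
  kernels vanish outside the unit ball, so nothing is lost and no boundary terms arise.\<close>

abbreviation unit_cube :: "(real^'n::finite) set" where
  "unit_cube \<equiv> cbox (- vec 1) (vec 1)"

lemma mem_unit_cube: "norm y \<le> 1 \<Longrightarrow> y \<in> unit_cube"
  using component_le_norm_cart[of y] by (auto simp: mem_box_cart abs_le_iff) (smt (verit))+

lemma norm_unit_cube: "y \<in> unit_cube \<Longrightarrow> norm (y::real^'n::finite) \<le> real CARD('n)"
  using norm_le_l1_cart[of y] sum_bounded_above[of UNIV "\<lambda>i. \<bar>y $ i\<bar>" 1]
  by (force simp: mem_box_cart abs_le_iff)

lemma integral_superset:
  fixes f :: "'a::euclidean_space \<Rightarrow> real"
  assumes "\<And>x. x \<notin> S \<Longrightarrow> f x = 0"
  shows "integral S f = integral UNIV f"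
proof -
  have "(\<lambda>x. if x \<in> S then f x else 0) = f" using assms by auto
  then show ?thesis using integral_restrict_UNIV[of S f] by simp
qed

text \<open>Translation invariance: the integral of a translate of F over a large cube does not
  depend on the translation while the support stays inside, and its derivative is the integral of
  the derivative.\<close>

lemma integral_pdiff_eq_0:
  fixes F :: "real^'n::finite \<Rightarrow> real"
  assumes "Ck_on (Suc 0) UNIV F" "\<And>x. norm x > 1 \<Longrightarrow> F x = 0"
  shows "integral unit_cube (pdiff i F) = 0"
proof -
  \<comment> \<open>Half side 2: a support in the unit ball, moved by less than 1.\<close>
  let ?T = "cbox (- vec 2) (vec 2 :: real^'n)"
  let ?J = "weighted_avg ?T (\<lambda>_. 1) (\<lambda>p. - p) F"
  have J: "?J x = integral UNIV F" if x: "x \<in> ball 0 1" for x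
  proof -
    have "?J x = integral (cbox ((- vec 2 + x) - x) ((vec 2 + x) - x)) (\<lambda>p. F (p + x))"
      by (simp add: weighted_avg_def add.commute)
    also have "\<dots> = integral (cbox (- vec 2 + x) (vec 2 + x)) F"
      by (rule integral_shift_cbox)
    also have "\<dots> = integral UNIV F"
    proof (rule integral_superset)
      fix y assume y: "y \<notin> cbox (- vec 2 + x) (vec 2 + x)"
      have "norm y > 1"
      proof (rule ccontr)
        assume "\<not> norm y > 1"
        then have "\<bar>y $ j\<bar> \<le> 1" "\<bar>x $ j\<bar> \<le> 1" for j
          using component_le_norm_cart[of y j] component_le_norm_cart[of x j] x by auto
        then have "y \<in> cbox (- vec 2 + x) (vec 2 + x)"
          unfolding mem_box_cart by (simp add: abs_le_iff) (smt (verit))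
        with y show False by simp
      qed
      then show "F y = 0" by (rule assms(2))
    qed
    finally show ?thesis .
  qed
  have "pdiff i ?J 0 = pdiff i (\<lambda>x. integral UNIV F) (0 :: real^'n)"
    by (rule pdiff_cong[of "ball 0 1"]) (use J in auto)
  then have "0 = pdiff i ?J 0" by simp
  also have "\<dots> = weighted_avg ?T (\<lambda>_. 1) (\<lambda>p. - p) (pdiff i F) 0"
    by (rule weighted_avg_pdiff(2)[where U=UNIV and W=UNIV]) (use assms in \<open>auto intro!: continuous_intros\<close>)
  also have "\<dots> = integral ?T (pdiff i F)" by (simp add: weighted_avg_def)
  finally have 0: "integral ?T (pdiff i F) = 0" by simp
  have z: "pdiff i F y = 0" if "norm y > 1" for y
    using pdiff_cong[of "- cball 0 1" y F "\<lambda>_. 0" i] assms(2) that by auto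
  have "integral unit_cube (pdiff i F) = integral UNIV (pdiff i F)"
    by (rule integral_superset) (use z mem_unit_cube in force)
  also have "\<dots> = integral ?T (pdiff i F)"
  proof (rule integral_superset[symmetric])
    fix y :: "real^'n" assume "y \<notin> ?T"
    moreover have "y \<in> ?T" if "norm y \<le> 1"
      using mem_unit_cube[OF that] by (auto simp: mem_box_cart) (smt (verit))+
    ultimately show "pdiff i F y = 0" using z by force
  qed
  finally show ?thesis using 0 by simp
qed

lemma integral_by_parts:
  fixes \<kappa> h :: "real^'n::finite \<Rightarrow> real"
  assumes \<kappa>: "Ck_on (Suc 0) UNIV \<kappa>" "\<And>x. norm x > 1 \<Longrightarrow> \<kappa> x = 0"
    and W: "open W" "unit_cube \<subseteq> W" and h: "Ck_on (Suc 0) W h"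
  shows "integral unit_cube (\<lambda>y. pdiff i \<kappa> y * h y) = - integral unit_cube (\<lambda>y. \<kappa> y * pdiff i h y)"
proof -
  \<comment> \<open>Extension by zero keeps the product C^1: points outside W lie outside the closed
    unit ball, where the kernel vanishes on a neighbourhood.\<close>
  define F where "F y = (if y \<in> W then \<kappa> y * h y else 0)" for y
  have \<kappa>W: "Ck_on (Suc 0) W \<kappa>" by (rule Ck_on_subset[OF _ \<kappa>(1)]) simp
  have "Ck_on (Suc 0) UNIV F"
  proof (rule Ck_on_local)
    fix x :: "real^'n"
    show "\<exists>U. open U \<and> x \<in> U \<and> Ck_on (Suc 0) U F"
    proof (cases "x \<in> W")
      case True
      have "Ck_on (Suc 0) W F"
        by (rule Ck_on_cong[OF W(1) _ Ck_on_mult[OF W(1) \<kappa>W h]]) (simp add: F_def)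
      with True W show ?thesis by blast
    next
      case False
      then have "norm x > 1" using mem_unit_cube W(2) by force
      moreover have "Ck_on (Suc 0) (- cball 0 1) F"
        by (rule Ck_on_cong[OF _ _ Ck_on_const[of _ _ 0]]) (use \<kappa>(2) in \<open>auto simp: F_def\<close>)
      ultimately show ?thesis by (intro exI[of _ "- cball 0 1"]) auto
    qed
  qed
  then have "integral unit_cube (pdiff i F) = 0"
    by (rule integral_pdiff_eq_0) (simp add: F_def \<kappa>(2))
  also have "integral unit_cube (pdiff i F) = integral unit_cube (\<lambda>y. pdiff i \<kappa> y * h y + \<kappa> y * pdiff i h y)"
  proof (rule integral_cong)
    fix y assume "y \<in> (unit_cube :: (real^'n) set)"
    then have y: "y \<in> W" using W by auto
    have "pdiff i F y = pdiff i (\<lambda>y. \<kappa> y * h y) y"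
      by (rule pdiff_cong[OF W(1) y]) (simp add: F_def)
    then show "pdiff i F y = pdiff i \<kappa> y * h y + \<kappa> y * pdiff i h y"
      using \<kappa>(1) h y by (simp add: pdiff_mult)
  qed
  also have "\<dots> = integral unit_cube (\<lambda>y. pdiff i \<kappa> y * h y) + integral unit_cube (\<lambda>y. \<kappa> y * pdiff i h y)"
  proof (rule integral_add)
    have c: "continuous_on unit_cube \<kappa>" "continuous_on unit_cube (pdiff i \<kappa>)"
      "continuous_on unit_cube h" "continuous_on unit_cube (pdiff i h)"
      using Ck_on_subset[OF subset_UNIV \<kappa>(1)] Ck_on_subset[OF W(2) h] Ck_on_imp_continuous
      by (auto simp del: Ck_on.simps(2), auto)
    show "(\<lambda>y. pdiff i \<kappa> y * h y) integrable_on unit_cube"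
      by (intro integrable_continuous continuous_on_mult c)
    show "(\<lambda>y. \<kappa> y * pdiff i h y) integrable_on unit_cube"
      by (intro integrable_continuous continuous_on_mult c)
  qed
  finally show ?thesis by simp
qed

section \<open>Mollifiers and the gain of one derivative\<close>

definition bump :: "real^'n::finite \<Rightarrow> real" where
  "bump y = flat_exp 0 (1 - norm y ^ 2)"

text \<open>Not a derivative in the literal sense but the factor with
  \<open>pdiff i bump y = - (y $ i) * bump' y\<close>: the derivative of \<open>flat_exp 0\<close>
  is \<open>flat_exp 2\<close>, and the 2 comes from |y|^2.\<close>

definition bump' :: "real^'n::finite \<Rightarrow> real" where
  "bump' y = 2 * flat_exp 2 (1 - norm y ^ 2)"

lemma smooth_bump: "smooth_on UNIV bump" and smooth_bump': "smooth_on UNIV bump'"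
  using smooth_on_norm_power2
  by (auto simp: smooth_on_def bump_def[abs_def] bump'_def[abs_def] intro!: Ck_on_flat_exp Ck_on_diff Ck_on_cmult)

lemma bump_zero: "norm y > 1 \<Longrightarrow> bump y = 0" and bump'_zero: "norm y > 1 \<Longrightarrow> bump' y = 0"
  by (simp_all add: bump_def bump'_def flat_exp_zero less_imp_le one_less_power)

lemma pdiff_norm_power2: "pdiff i (\<lambda>x. norm x ^ 2) x = 2 * x $ i"
  unfolding norm_power2_vec by (simp add: pdiff_sum pdiff_mult pdiff_coord if_distrib if_distribR sum.distrib cong: if_cong)

lemma pdiff_bump: "pdiff i bump y = - (y $ i) * bump' y"
proof -
  have d2: "(\<lambda>x. norm x ^ 2) differentiable at y"
    by (rule smooth_on_differentiable[OF smooth_on_norm_power2]) simp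
  then have d: "(\<lambda>x. 1 - norm x ^ 2) differentiable at y" by simp
  have "pdiff i (\<lambda>x. 1 - norm x ^ 2) y = - (2 * y $ i)"
    using pdiff_diff[OF _ d2, of "\<lambda>x. 1" i] by (simp add: pdiff_norm_power2)
  then show ?thesis
    using pdiff_chain_real(2)[OF DERIV_flat_exp[of 0] d, of i]
    by (simp add: bump_def[abs_def] bump'_def numeral_2_eq_2)
qed

lemma integral_bump'_pos: "integral unit_cube (bump' :: real^'n::finite \<Rightarrow> real) > 0"
proof -
  have c: "continuous_on unit_cube (bump' :: real^'n \<Rightarrow> real)"
    using smooth_on_continuous[OF smooth_bump'] by (rule continuous_on_subset) simp
  have nn: "bump' y \<ge> 0" for y :: "real^'n" by (simp add: bump'_def flat_exp_nonneg)
  have "integral unit_cube (bump' :: real^'n \<Rightarrow> real) \<noteq> 0"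
  proof
    assume "integral unit_cube (bump' :: real^'n \<Rightarrow> real) = 0"
    then have "((bump' :: real^'n \<Rightarrow> real) has_integral 0) unit_cube"
      using integrable_continuous[OF c] by (simp add: has_integral_integral)
    moreover have "box (- vec 1) (vec 1 :: real^'n) \<noteq> {}"
      by (auto simp: box_ne_empty inner_axis Basis_vec_def)
    moreover have "(0 :: real^'n) \<in> unit_cube" by (rule mem_unit_cube) simp
    ultimately have "bump' (0 :: real^'n) = 0"
      by (intro has_integral_0_cbox_imp_0[OF c nn])
    then show False using flat_exp_pos[of 1 2] by (simp add: bump'_def)
  qed
  moreover have "integral unit_cube (bump' :: real^'n \<Rightarrow> real) \<ge> 0" by (intro integral_nonneg integrable_continuous c nn)
  ultimately show ?thesis by simp
qed

context
  fixes x :: "real^'n::finite" and s :: real and W :: "(real^'n) set"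
  assumes W: "open W" "\<And>y. y \<in> unit_cube \<Longrightarrow> x - s *\<^sub>R y \<in> W"
begin

text \<open>The chain rule factor -s cancels the sign of the integration by parts. Without division
  by \<open>s\<close> the formula covers the end point s = 0.\<close>

lemma integral_by_parts_scaled:
  assumes "Ck_on (Suc 0) UNIV \<kappa>" "\<And>x. norm x > 1 \<Longrightarrow> \<kappa> x = 0" "Ck_on (Suc 0) W g"
  shows "integral unit_cube (\<lambda>y. pdiff i \<kappa> y * g (x - s *\<^sub>R y))
    = s * integral unit_cube (\<lambda>y. \<kappa> y * pdiff i g (x - s *\<^sub>R y))"
proof -
  let ?V = "{y. x + (- s) *\<^sub>R y \<in> W}"
  have "continuous_on UNIV (\<lambda>y. x + (- s) *\<^sub>R y)" by (intro continuous_intros)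
  from open_vimage[OF W(1) this] have V: "open ?V" by (simp add: vimage_def)
  have sub: "unit_cube \<subseteq> ?V" using W(2) by auto
  have "integral unit_cube (\<lambda>y. pdiff i \<kappa> y * g (x + (- s) *\<^sub>R y))
      = - integral unit_cube (\<lambda>y. \<kappa> y * pdiff i (\<lambda>y. g (x + (- s) *\<^sub>R y)) y)"
    by (rule integral_by_parts[OF assms(1,2) V sub Ck_on_affine[OF W(1) assms(3)]])
  also have "integral unit_cube (\<lambda>y. \<kappa> y * pdiff i (\<lambda>y. g (x + (- s) *\<^sub>R y)) y)
      = integral unit_cube (\<lambda>y. (- s) * (\<kappa> y * pdiff i g (x + (- s) *\<^sub>R y)))"
  proof (rule integral_cong)
    fix y :: "real^'n" assume "y \<in> unit_cube"
    then have "g differentiable at (x + (- s) *\<^sub>R y)" using W(2) assms(3) by simp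
    from pdiff_affine(2)[OF this, of i]
    show "\<kappa> y * pdiff i (\<lambda>y. g (x + (- s) *\<^sub>R y)) y = (- s) * (\<kappa> y * pdiff i g (x + (- s) *\<^sub>R y))" by simp
  qed
  finally show ?thesis by simp
qed

end

text \<open>As the gradient of \<open>bump\<close> at \<open>y\<close> is \<open>- bump' y\<close> times \<open>y\<close>, the derivative in \<open>s\<close> of the average of
  \<open>v (x - s y)\<close> against \<open>bump'\<close> is, after an integration by parts, \<open>s\<close> times the average of the
  Laplacian against \<open>bump\<close>. This replaces the Newtonian potential: no singular kernel occurs.\<close>

lemma bump_average_identity:
  fixes v :: "real^'n::finite \<Rightarrow> real"
  assumes "open W" "Ck_on 2 W v" "0 \<le> d" "\<And>s y. s \<in> {0..d} \<Longrightarrow> y \<in> unit_cube \<Longrightarrow> x - s *\<^sub>R y \<in> W"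
  shows "integral {0..d} (\<lambda>s. s * integral unit_cube (\<lambda>y. bump y * laplacian v (x - s *\<^sub>R y)))
    = integral unit_cube (\<lambda>y. bump' y * v (x - d *\<^sub>R y)) - v x * integral unit_cube (bump' :: real^'n \<Rightarrow> real)"
proof -
  have C: "Ck_on (Suc (Suc 0)) W v" using assms(2) by (simp only: numeral_2_eq_2)
  then have Cp: "Ck_on (Suc 0) W (pdiff i v)" for i by simp
  have dv: "v differentiable at y" if "y \<in> W" for y using C that by simp
  have cv: "continuous_on W v" by (rule Ck_on_imp_continuous[OF C])
  have cpv: "continuous_on W (pdiff i v)" for i by (rule Ck_on_imp_continuous[OF Cp])
  have cppv: "continuous_on W (pdiff i (pdiff i v))" for i using Cp by simp
  have cb: "continuous_on A bump" "continuous_on A bump'" for A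
    using smooth_on_continuous[OF smooth_bump] smooth_on_continuous[OF smooth_bump']
    by (auto intro: continuous_on_subset)
  have cW: "continuous_on ({0..d} \<times> unit_cube) (\<lambda>z. g (x - fst z *\<^sub>R snd z))" if "continuous_on W g" for g :: "real^'n \<Rightarrow> real"
    by (rule continuous_on_compose2[OF that]) (use assms(4) in \<open>auto intro!: continuous_intros\<close>)
  have cW1: "continuous_on unit_cube (\<lambda>y. g (x - s *\<^sub>R y))" if "continuous_on W g" "s \<in> {0..d}" for g :: "real^'n \<Rightarrow> real" and s
    by (rule continuous_on_compose2[OF that(1)]) (use assms(4)[OF that(2)] in \<open>auto intro!: continuous_intros\<close>)
  define M where "M s = integral unit_cube (\<lambda>y. bump' y * v (x - s *\<^sub>R y))" for s
  have M': "(M has_vector_derivative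
      integral unit_cube (\<lambda>y. bump' y * (\<Sum>i\<in>UNIV. (- y) $ i * pdiff i v (x - s *\<^sub>R y)))) (at s within {0..d})"
    if s: "s \<in> {0..d}" for s
    unfolding M_def
  proof (rule leibniz_rule_vector_derivative)
    fix s y assume sy: "s \<in> {0..d}" "y \<in> (unit_cube :: (real^'n) set)"
    have "v differentiable at (x + s *\<^sub>R (- y))" using dv assms(4)[OF sy] by simp
    from DERIV_cmult[OF has_real_derivative_line[OF this], of "bump' y"]
    have "((\<lambda>s. bump' y * v (x - s *\<^sub>R y)) has_real_derivative
        bump' y * (\<Sum>i\<in>UNIV. (- y) $ i * pdiff i v (x - s *\<^sub>R y))) (at s)" by simp
    then show "((\<lambda>s. bump' y * v (x - s *\<^sub>R y)) has_vector_derivative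
        bump' y * (\<Sum>i\<in>UNIV. (- y) $ i * pdiff i v (x - s *\<^sub>R y))) (at s within {0..d})"
      by (simp add: has_real_derivative_iff_has_vector_derivative has_vector_derivative_at_within)
  next
    fix s assume "s \<in> {0..d}"
    then show "(\<lambda>y. bump' y * v (x - s *\<^sub>R y)) integrable_on unit_cube"
      by (intro integrable_continuous continuous_on_mult cb cW1 cv)
  next
    have "continuous_on ({0..d} \<times> unit_cube) (\<lambda>z. bump' (snd z))"
      by (rule continuous_on_compose2[OF cb(2) continuous_on_snd[OF continuous_on_id]]) auto
    then show "continuous_on ({0..d} \<times> unit_cube)
        (\<lambda>(s, y). bump' y * (\<Sum>i\<in>UNIV. (- y) $ i * pdiff i v (x - s *\<^sub>R y)))"
      unfolding case_prod_beta
      by (intro continuous_on_mult continuous_on_sum cW cpv continuous_on_component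
          continuous_on_minus continuous_on_snd continuous_on_id)
  qed (use s in auto)
  have M'_eq: "integral unit_cube (\<lambda>y. bump' y * (\<Sum>i\<in>UNIV. (- y) $ i * pdiff i v (x - s *\<^sub>R y)))
      = s * integral unit_cube (\<lambda>y. bump y * laplacian v (x - s *\<^sub>R y))" if s: "s \<in> {0..d}" for s
  proof -
    have i1: "(\<lambda>y. pdiff i bump y * pdiff i v (x - s *\<^sub>R y)) integrable_on unit_cube" for i
      using smooth_on_continuous[OF smooth_on_pdiff[OF smooth_bump]]
      by (intro integrable_continuous continuous_on_mult cW1 cpv s) (auto intro: continuous_on_subset)
    have i2: "(\<lambda>y. bump y * pdiff i (pdiff i v) (x - s *\<^sub>R y)) integrable_on unit_cube" for i
      by (intro integrable_continuous continuous_on_mult cW1 cb cppv s)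
    have "integral unit_cube (\<lambda>y. bump' y * (\<Sum>i\<in>UNIV. (- y) $ i * pdiff i v (x - s *\<^sub>R y)))
        = integral unit_cube (\<lambda>y. \<Sum>i\<in>UNIV. pdiff i bump y * pdiff i v (x - s *\<^sub>R y))"
      by (simp add: pdiff_bump sum_distrib_left mult_ac)
    also have "\<dots> = (\<Sum>i\<in>UNIV. integral unit_cube (\<lambda>y. pdiff i bump y * pdiff i v (x - s *\<^sub>R y)))"
      by (rule integral_sum[OF finite i1])
    also have "\<dots> = (\<Sum>i\<in>UNIV. s * integral unit_cube (\<lambda>y. bump y * pdiff i (pdiff i v) (x - s *\<^sub>R y)))"
      using smooth_bump assms(4)[OF s]
      by (intro sum.cong refl integral_by_parts_scaled[OF assms(1) _ _ bump_zero Cp]) (auto simp: smooth_on_def simp del: Ck_on.simps)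
    also have "\<dots> = s * integral unit_cube (\<lambda>y. \<Sum>i\<in>UNIV. bump y * pdiff i (pdiff i v) (x - s *\<^sub>R y))"
      by (subst integral_sum[OF finite i2]) (rule sum_distrib_left[symmetric])
    finally show ?thesis by (simp add: laplacian_def sum_distrib_left)
  qed
  \<comment> \<open>The fundamental theorem in the scale \<open>s\<close>. At scale 0 the average is
    \<open>v x\<close> times the mass of \<open>bump'\<close>.\<close>
  have "((\<lambda>s. s * integral unit_cube (\<lambda>y. bump y * laplacian v (x - s *\<^sub>R y))) has_integral M d - M 0) {0..d}"
    by (rule fundamental_theorem_of_calculus[OF assms(3)]) (use M' M'_eq in auto)
  then show ?thesis by (simp add: integral_unique M_def mult.commute)
qed

text \<open>At a fixed scale d > 0 each derivative moves to the kernel at the price of a factor 1/d,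
  so a C^1 function has averages of every class. The kernel changes at each step, hence the
  induction over all kernels.\<close>

lemma weighted_avg_smoothing:
  fixes v :: "real^'n::finite \<Rightarrow> real"
  assumes U: "open U" "convex U" and W: "open W" and d: "d > 0"
    and UW: "\<And>x y. x \<in> U \<Longrightarrow> y \<in> unit_cube \<Longrightarrow> x - d *\<^sub>R y \<in> W"
    and v: "Ck_on (Suc 0) W v"
  shows "smooth_on UNIV \<kappa> \<Longrightarrow> (\<And>x. norm x > 1 \<Longrightarrow> \<kappa> x = 0)
    \<Longrightarrow> Ck_on m U (weighted_avg unit_cube \<kappa> (\<lambda>y. d *\<^sub>R y) v)"
proof (induction m arbitrary: \<kappa>)
  case 0
  have "continuous_on unit_cube \<kappa>"
    using smooth_on_continuous[OF 0(1)] by (rule continuous_on_subset) simp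
  moreover have "continuous_on unit_cube (\<lambda>y. d *\<^sub>R y :: real^'n)" by (intro continuous_intros)
  ultimately show ?case using weighted_avg_continuous[OF _ _ U W UW Ck_on_imp_continuous[OF v]] by simp
next
  case (Suc m)
  have c: "continuous_on unit_cube \<kappa>"
    using smooth_on_continuous[OF Suc.prems(1)] by (rule continuous_on_subset) simp
  have cs: "continuous_on unit_cube (\<lambda>y. d *\<^sub>R y :: real^'n)" by (intro continuous_intros)
  note wd = weighted_avg_pdiff[OF c cs U W UW v]
  have "Ck_on m U (pdiff i (weighted_avg unit_cube \<kappa> (\<lambda>y. d *\<^sub>R y) v))" for i
  proof (rule Ck_on_cong[OF U(1)])
    have "pdiff i \<kappa> y = 0" if "norm y > 1" for y
      using pdiff_cong[of "- cball 0 1" y \<kappa> "\<lambda>_. 0" i] Suc.prems(2) that by auto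
    then show "Ck_on m U (\<lambda>x. inverse d * weighted_avg unit_cube (pdiff i \<kappa>) (\<lambda>y. d *\<^sub>R y) v x)"
      by (intro Ck_on_cmult U Suc.IH smooth_on_pdiff Suc.prems)
    fix x assume x: "x \<in> U"
    have "weighted_avg unit_cube (pdiff i \<kappa>) (\<lambda>y. d *\<^sub>R y) v x
        = d * weighted_avg unit_cube \<kappa> (\<lambda>y. d *\<^sub>R y) (pdiff i v) x"
      unfolding weighted_avg_def using Suc.prems
      by (intro integral_by_parts_scaled[OF W UW[OF x] _ _ v]) (auto simp: smooth_on_def simp del: Ck_on.simps)
    then show "inverse d * weighted_avg unit_cube (pdiff i \<kappa>) (\<lambda>y. d *\<^sub>R y) v x
        = pdiff i (weighted_avg unit_cube \<kappa> (\<lambda>y. d *\<^sub>R y) v) x"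
      using d wd(2)[OF _ _ x] by simp
  qed
  then show ?case using wd(1) by simp
qed

text \<open>A derivative on \<open>g\<close> is moved back to \<open>bump\<close> by parts; this
  would cost a factor 1/s, which the weight s cancels exactly. The first derivatives are thus
  averages of \<open>g\<close> itself with a continuous weight and keep all its \<open>Suc m\<close>
  derivatives.\<close>

lemma potential_Ck_on:
  fixes g :: "real^'n::finite \<Rightarrow> real"
  assumes U: "open U" "convex U" and W: "open W" and d: "d > 0"
    and UW: "\<And>x s y. x \<in> U \<Longrightarrow> s \<in> {0..d} \<Longrightarrow> y \<in> unit_cube \<Longrightarrow> x - s *\<^sub>R y \<in> W"
    and g: "Ck_on (Suc m) W g"
  shows "Ck_on (Suc (Suc m)) U (weighted_avg (cbox (0, - vec 1) (d, vec 1))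
    (\<lambda>p. fst p * bump (snd p)) (\<lambda>p. fst p *\<^sub>R snd p) g)"
    (is "Ck_on _ _ (weighted_avg ?T ?\<kappa> ?\<sigma> g)")
proof -
  have T: "?T = {0..d} \<times> unit_cube" by (simp add: cbox_Pair_eq)
  have csnd: "continuous_on ?T (\<lambda>p. k (snd p))" if "smooth_on UNIV k" for k :: "real^'n \<Rightarrow> real"
    by (rule continuous_on_compose2[OF smooth_on_continuous[OF that] continuous_on_snd[OF continuous_on_id]]) auto
  have c\<kappa>: "continuous_on ?T ?\<kappa>"
    by (intro continuous_on_mult continuous_on_fst continuous_on_id csnd smooth_bump)
  have c\<sigma>: "continuous_on ?T ?\<sigma>" by (intro continuous_intros)
  have UW': "x - ?\<sigma> p \<in> W" if "x \<in> U" "p \<in> ?T" for x p using UW that unfolding T by auto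
  have g1: "Ck_on (Suc 0) W g" by (rule Ck_on_mono[OF _ g]) simp
  note wd = weighted_avg_pdiff[OF c\<kappa> c\<sigma> U W UW' g1]
  have "Ck_on (Suc m) U (pdiff i (weighted_avg ?T ?\<kappa> ?\<sigma> g))" for i
  proof (rule Ck_on_cong[OF U(1)])
    have sp: "smooth_on UNIV (pdiff i bump)" by (rule smooth_on_pdiff[OF smooth_bump])
    show "Ck_on (Suc m) U (weighted_avg ?T (\<lambda>p. pdiff i bump (snd p)) ?\<sigma> g)"
      by (rule weighted_avg_Ck_on[OF csnd[OF sp] c\<sigma> U W UW' g])
    fix x assume x: "x \<in> U"
    have c: "continuous_on ?T (\<lambda>p. k p * f (x - ?\<sigma> p))"
      if "continuous_on ?T k" "continuous_on W f" for k :: "real \<times> (real^'n) \<Rightarrow> real" and f :: "real^'n \<Rightarrow> real"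
    proof -
      have "continuous_on ?T (\<lambda>p. f (x - ?\<sigma> p))"
        by (rule continuous_on_compose2[OF that(2) continuous_on_diff[OF continuous_on_const c\<sigma>]])
           (use UW'[OF x] in blast)
      with that(1) show ?thesis by (rule continuous_on_mult)
    qed
    have cg: "continuous_on W g" "continuous_on W (pdiff i g)"
      using Ck_on_imp_continuous[OF g1] g1 by auto
    have "weighted_avg ?T (\<lambda>p. pdiff i bump (snd p)) ?\<sigma> g x
        = integral (cbox 0 d) (\<lambda>s. integral unit_cube (\<lambda>y. pdiff i bump y * g (x - s *\<^sub>R y)))"
      unfolding weighted_avg_def by (subst integral_prod_continuous[OF c[OF csnd[OF sp] cg(1)]]) simp
    also have "\<dots> = integral (cbox 0 d) (\<lambda>s. integral unit_cube (\<lambda>y. s * bump y * pdiff i g (x - s *\<^sub>R y)))"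
    proof (rule integral_cong)
      fix s assume "s \<in> cbox 0 d"
      then have s: "s \<in> {0..d}" by simp
      have "integral unit_cube (\<lambda>y. pdiff i bump y * g (x - s *\<^sub>R y))
          = s * integral unit_cube (\<lambda>y. bump y * pdiff i g (x - s *\<^sub>R y))"
        using smooth_bump
        by (intro integral_by_parts_scaled[OF W UW[OF x s] _ bump_zero g1]) (auto simp: smooth_on_def simp del: Ck_on.simps)
      then show "integral unit_cube (\<lambda>y. pdiff i bump y * g (x - s *\<^sub>R y))
          = integral unit_cube (\<lambda>y. s * bump y * pdiff i g (x - s *\<^sub>R y))"
        by (simp add: mult.assoc)
    qed
    also have "\<dots> = weighted_avg ?T ?\<kappa> ?\<sigma> (pdiff i g) x"
      unfolding weighted_avg_def by (subst integral_prod_continuous[OF c[OF c\<kappa> cg(2)]]) simp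
    also have "\<dots> = pdiff i (weighted_avg ?T ?\<kappa> ?\<sigma> g) x"
      by (rule wd(2)[OF _ _ x, symmetric])
    finally show "weighted_avg ?T (\<lambda>p. pdiff i bump (snd p)) ?\<sigma> g x = pdiff i (weighted_avg ?T ?\<kappa> ?\<sigma> g) x" .
  qed
  then show ?thesis using wd(1) by simp
qed

theorem laplacian_regularity:
  fixes v :: "real^'n::finite \<Rightarrow> real"
  assumes S: "open S" and v: "Ck_on 2 S v" and g: "Ck_on (Suc m) S (laplacian v)"
  shows "Ck_on (Suc (Suc m)) S v"
proof (rule Ck_on_local)
  fix x0 assume "x0 \<in> S"
  then obtain e' where e': "e' > 0" "ball x0 e' \<subseteq> S" using S openE by blast
  define e where "e = e' / 2"
  \<comment> \<open>Points of the cube have norm at most the dimension, so shifts at scale up to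
    \<open>d\<close> have length at most \<open>e\<close> and stay in the ball of radius 2
    e.\<close>
  define d where "d = e / real CARD('n)"
  let ?U = "ball x0 e" and ?W = "ball x0 (2 * e)"
  have e: "e > 0" "?W \<subseteq> S" and d: "d > 0" using e' by (auto simp: e_def d_def)
  have UW: "x - s *\<^sub>R y \<in> ?W" if "x \<in> ?U" "s \<in> {0..d}" "y \<in> unit_cube" for x s y
  proof -
    have "norm (s *\<^sub>R y) \<le> d * real CARD('n)"
      using that norm_unit_cube[OF that(3)] by (auto intro!: mult_mono)
    then have "norm (s *\<^sub>R y) \<le> e" by (simp add: d_def)
    moreover have "dist x0 (x - s *\<^sub>R y) \<le> dist x0 x + norm (s *\<^sub>R y)"
      using dist_triangle[of x0 "x - s *\<^sub>R y" x] by (simp add: dist_norm)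
    ultimately show ?thesis using that(1) by simp
  qed
  have vW: "Ck_on 2 ?W v" and gW: "Ck_on (Suc m) ?W (laplacian v)"
    by (rule Ck_on_subset[OF e(2) v], rule Ck_on_subset[OF e(2) g])
  have v1: "Ck_on (Suc 0) ?W v" by (rule Ck_on_mono[OF _ vW]) simp
  let ?A = "weighted_avg unit_cube bump' (\<lambda>y. d *\<^sub>R y) v"
  let ?T = "cbox (0, - vec 1) (d, vec 1) :: (real \<times> (real^'n)) set"
  let ?B = "weighted_avg ?T (\<lambda>p. fst p * bump (snd p)) (\<lambda>p. fst p *\<^sub>R snd p) (laplacian v)"
  let ?I = "integral unit_cube (bump' :: real^'n \<Rightarrow> real)"
  have A: "Ck_on (Suc (Suc m)) ?U ?A"
    by (rule weighted_avg_smoothing[where W="?W"]) (use d UW v1 smooth_bump' bump'_zero in auto)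
  have B: "Ck_on (Suc (Suc m)) ?U ?B"
    by (rule potential_Ck_on[where W="?W"]) (use d UW gW in \<open>auto simp del: Ck_on.simps\<close>)
  have "Ck_on (Suc (Suc m)) ?U v"
  proof (rule Ck_on_cong)
    \<comment> \<open>The averaging identity solved for v: the mollified part is of every class, the
      potential part has one derivative more than the Laplacian.\<close>
    show "Ck_on (Suc (Suc m)) ?U (\<lambda>x. inverse ?I * (?A x - ?B x))"
      by (intro Ck_on_cmult Ck_on_diff A B) auto
    fix x assume x: "x \<in> ?U"
    have "continuous_on ?T (\<lambda>p. bump (snd p) :: real)"
      by (rule continuous_on_compose2[OF smooth_on_continuous[OF smooth_bump] continuous_on_snd[OF continuous_on_id]]) auto
    moreover have "continuous_on ?T (\<lambda>p. laplacian v (x - fst p *\<^sub>R snd p))"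
      by (rule continuous_on_compose2[OF Ck_on_imp_continuous[OF gW]])
         (use UW[OF x] in \<open>auto intro!: continuous_intros simp: cbox_Pair_eq\<close>)
    ultimately have "continuous_on ?T (\<lambda>p. fst p * bump (snd p) * laplacian v (x - fst p *\<^sub>R snd p))"
      by (intro continuous_on_mult continuous_on_fst continuous_on_id)
    then have "?B x = integral (cbox 0 d) (\<lambda>s. integral unit_cube (\<lambda>y. s * bump y * laplacian v (x - s *\<^sub>R y)))"
      unfolding weighted_avg_def by (subst integral_prod_continuous) auto
    also have "\<dots> = integral {0..d} (\<lambda>s. s * integral unit_cube (\<lambda>y. bump y * laplacian v (x - s *\<^sub>R y)))"
      by (simp add: mult.assoc)
    also have "\<dots> = ?A x - v x * ?I"
      unfolding weighted_avg_def
      by (rule bump_average_identity[OF _ vW]) (use d UW[OF x] in auto)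
    finally show "inverse ?I * (?A x - ?B x) = v x"
      using integral_bump'_pos[where 'n='n] by simp
  qed simp
  then show "\<exists>U. open U \<and> x0 \<in> U \<and> Ck_on (Suc (Suc m)) U v"
    using e(1) by (intro exI[of _ ?U]) auto
qed

section \<open>Graded expansions and the bootstrap\<close>

text \<open>Once the lower coefficients are known to vanish, dividing by l^j leaves a quantity
  tending to \<open>c j\<close>, bounded by a multiple of l^(s-j), which tends to 0.\<close>

lemma polynomial_bigo_coeffs_zero:
  fixes c :: "nat \<Rightarrow> real"
  assumes "\<forall>\<^sub>F l in at_right 0. \<bar>\<Sum>j<n. c j * l ^ j\<bar> \<le> C * l ^ s" "j < n" "j < s"
  shows "c j = 0"
  using assms(2,3)
proof (induction j rule: less_induct)
  case (less j)
  define G where "G l = (\<Sum>i\<in>{j..<n}. c i * l ^ (i - j))" for l :: real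
  have lt: "(\<Sum>i<n. c i * l ^ i) = l ^ j * G l" for l
  proof -
    have "(\<Sum>i<n. c i * l ^ i) = (\<Sum>i\<in>{j..<n}. c i * l ^ i)"
      using less by (intro sum.mono_neutral_right) auto
    also have "\<dots> = (\<Sum>i\<in>{j..<n}. l ^ j * (c i * l ^ (i - j)))"
      by (intro sum.cong) (auto simp flip: power_add)
    finally show ?thesis by (simp add: G_def sum_distrib_left)
  qed
  have "isCont G 0" unfolding G_def by (intro continuous_intros)
  then have "(G \<longlongrightarrow> G 0) (at_right 0)"
    by (auto simp: isCont_def intro: filterlim_mono[OF _ order.refl at_le])
  moreover have "G 0 = c j"
  proof -
    have "G 0 = (\<Sum>i\<in>{j..<n}. if i = j then c i else 0)"
      unfolding G_def by (intro sum.cong) auto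
    then show ?thesis using less.prems by simp
  qed
  ultimately have G: "(G \<longlongrightarrow> c j) (at_right 0)" by simp
  have "(G \<longlongrightarrow> 0) (at_right 0)"
  proof (rule Lim_null_comparison)
    have "\<forall>\<^sub>F l in at_right 0. (0::real) < l" by (rule eventually_at_right_less)
    with assms(1) show "\<forall>\<^sub>F l in at_right 0. norm (G l) \<le> C * l ^ (s - j)"
    proof eventually_elim
      case (elim l)
      have "l ^ j * \<bar>G l\<bar> \<le> l ^ j * (C * l ^ (s - j))"
        using elim less.prems unfolding lt by (simp add: abs_mult mult_ac flip: power_add)
      then show ?case using elim(2) by simp
    qed
    have "((\<lambda>l. C * l ^ (s - j)) \<longlongrightarrow> C * 0 ^ (s - j)) (at_right (0::real))"
      by (intro tendsto_intros)
    moreover have "C * 0 ^ (s - j) = 0" using less.prems by (simp add: power_0_left)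
    ultimately show "((\<lambda>l. C * l ^ (s - j)) \<longlongrightarrow> 0) (at_right (0::real))" by (simp only:)
  qed
  with G show ?case using tendsto_unique trivial_limit_at_right_real by blast
qed

text \<open>On the ray through \<open>x\<close> the sum is a polynomial in the scaling factor, so
  the one-dimensional statement applies.\<close>

lemma graded_bigo_terms_zero:
  fixes t :: "nat \<Rightarrow> real^'n::finite \<Rightarrow> real"
  assumes "\<And>k l x. l > 0 \<Longrightarrow> t k (l *\<^sub>R x) = l ^ k * t k x"
    and "(\<lambda>x. \<Sum>k<n. t k x) \<in> O[at 0](\<lambda>x. norm x powi int s)"
    and "k < n" "k < s" "x \<noteq> 0"
  shows "t k x = 0"
proof -
  from assms(2) obtain C where C: "\<forall>\<^sub>F y in at 0. norm (\<Sum>k<n. t k y) \<le> C * norm (norm y powi int s)"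
    by (rule landau_o.bigE)
  have "filterlim (\<lambda>l. l *\<^sub>R x) (at 0) (at_right 0)"
    using assms(5) by (auto simp: filterlim_at eventually_at_filter intro!: tendsto_eq_intros)
  from eventually_compose_filterlim[OF C this]
  have "\<forall>\<^sub>F l in at_right 0. norm (\<Sum>k<n. t k (l *\<^sub>R x)) \<le> C * norm (norm (l *\<^sub>R x) powi int s)" .
  moreover have "\<forall>\<^sub>F l in at_right 0. (0::real) < l" by (rule eventually_at_right_less)
  ultimately have "\<forall>\<^sub>F l in at_right 0. \<bar>\<Sum>k<n. t k x * l ^ k\<bar> \<le> (C * norm x ^ s) * l ^ s"
  proof eventually_elim
    case (elim l)
    then show ?case by (simp add: assms(1) mult_ac power_mult_distrib)
  qed
  from polynomial_bigo_coeffs_zero[OF this assms(3,4)] show ?thesis .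
qed

text \<open>Asking for the identity at every large \<open>N\<close> forces the later terms to vanish
  and lets gradings of different length be added or compared at a common length.\<close>

lemma polynomial_fn_graded:
  assumes "polynomial_fn p"
  shows "\<exists>n h. (\<forall>k. homogeneous k (h k)) \<and> (\<forall>N\<ge>n. \<forall>x. p x = (\<Sum>k<N. h k x))"
  using assms
proof (induction rule: polynomial_fn.induct)
  case (hom k p)
  let ?h = "\<lambda>j. if j = k then p else (\<lambda>_. 0)"
  have "p x = (\<Sum>j<N. ?h j x)" if "N \<ge> Suc k" for N x
  proof -
    have "(\<Sum>j<N. ?h j x) = (\<Sum>j<N. if j = k then p x else 0)" by (intro sum.cong) auto
    then show ?thesis using that by simp
  qed
  moreover have "homogeneous j (?h j)" for j using hom by (simp add: homogeneous_zero)
  ultimately show ?case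
    by (intro exI[of _ "Suc k"] exI[of _ ?h] conjI allI impI)
next
  case (add p q)
  then obtain n h n' h' where
    h: "\<forall>k. homogeneous k (h k)" "\<forall>N\<ge>n. \<forall>x. p x = (\<Sum>k<N. h k x)" and
    h': "\<forall>k. homogeneous k (h' k)" "\<forall>N\<ge>n'. \<forall>x. q x = (\<Sum>k<N. h' k x)"
    by metis
  have "p x + q x = (\<Sum>k<N. h k x + h' k x)" if "N \<ge> max n n'" for N x
    using h(2)[rule_format, of N x] h'(2)[rule_format, of N x] that by (simp add: sum.distrib)
  moreover have "homogeneous k (\<lambda>x. h k x + h' k x)" for k
    using h(1) h'(1) by (simp add: homogeneous_add)
  ultimately show ?case
    by (intro exI[of _ "max n n'"] exI[of _ "\<lambda>k x. h k x + h' k x"] conjI allI impI)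
qed

text \<open>Grouping by total degree, where r counts as degree one; hence the index shift in
  \<open>g\<close>. The scaling law holds only for positive factors, since r is even.\<close>

definition radial_term :: "(nat \<Rightarrow> real^'n::finite \<Rightarrow> real) \<Rightarrow> (nat \<Rightarrow> real^'n \<Rightarrow> real) \<Rightarrow> nat \<Rightarrow> real^'n \<Rightarrow> real" where
  "radial_term h g k x = h k x + (case k of 0 \<Rightarrow> 0 | Suc j \<Rightarrow> norm x * g j x)"

lemma sum_radial_term:
  "(\<Sum>k<Suc n. radial_term h g k x) = (\<Sum>k<Suc n. h k x) + norm x * (\<Sum>k<n. g k x)"
proof -
  have "(\<Sum>k<Suc n. case k of 0 \<Rightarrow> 0 | Suc j \<Rightarrow> norm x * g j x) = (\<Sum>k<n. norm x * g k x)"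
    by (subst sum.lessThan_Suc_shift) simp
  then show ?thesis unfolding radial_term_def sum.distrib by (simp add: sum_distrib_left)
qed

lemma radial_term_scale:
  assumes "\<And>k. homogeneous k (h k)" "\<And>k. homogeneous k (g k)" "l > 0"
  shows "radial_term h g k (l *\<^sub>R x) = l ^ k * radial_term h g k x"
  using assms by (cases k) (auto simp: radial_term_def homogeneous_def algebra_simps)

lemma conormal_subset: "T \<subseteq> S \<Longrightarrow> conormal m s S f \<Longrightarrow> conormal m s T f"
  by (induction m arbitrary: s f) (auto intro: continuous_on_subset)

context
  fixes S :: "(real^'n::finite) set"
  assumes S: "open S" "0 \<in> S"
begin

lemma radial_term_conormal:
  assumes "\<And>k. homogeneous k (h k)" "\<And>k. homogeneous k (g k)"
  shows "conormal m (int k) S (radial_term h g k)"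
proof (cases k)
  case 0
  then have "radial_term h g k = h k" by (auto simp: radial_term_def)
  then show ?thesis using homogeneous_conormal[OF S assms(1)] by simp
next
  case (Suc j)
  have "conormal m (1 + int j) S (\<lambda>x. norm x * g j x)"
    by (intro conormal_mult[OF S] conormal_norm[OF S] homogeneous_conormal[OF S] assms(2))
  moreover have "radial_term h g k = (\<lambda>x. h k x + norm x * g j x)"
    using Suc by (auto simp: radial_term_def)
  moreover have "1 + int j = int k" using Suc by simp
  ultimately show ?thesis
    using conormal_add[OF S homogeneous_conormal[OF S assms(1)], of m k "\<lambda>x. norm x * g j x"]
    by (simp only:)
qed

text \<open>One pair of coefficient families serves all m up to M: terms of degree at least
  \<open>m\<close> themselves have order \<open>m\<close> and can be moved into the
  remainder.\<close>

lemma expandable_graded: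
  assumes "expandable M (int M) S u"
  shows "\<exists>h g. (\<forall>k. homogeneous k (h k)) \<and> (\<forall>k. homogeneous k (g k))
    \<and> (\<forall>m\<le>M. conormal m (int m) S (\<lambda>x. u x - (\<Sum>k<m. radial_term h g k x)))"
proof -
  obtain P Q where PQ: "polynomial_fn P" "polynomial_fn Q"
    "conormal M (int M) S (\<lambda>x. u x - (P x + norm x * Q x))"
    using assms by (auto simp: expandable_def radial_poly_def)
  obtain n h where h: "\<And>k. homogeneous k (h k)" "\<And>N x. N \<ge> n \<Longrightarrow> P x = (\<Sum>k<N. h k x)"
    using polynomial_fn_graded[OF PQ(1)] by metis
  obtain n' g where g: "\<And>k. homogeneous k (g k)" "\<And>N x. N \<ge> n' \<Longrightarrow> Q x = (\<Sum>k<N. g k x)"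
    using polynomial_fn_graded[OF PQ(2)] by metis
  have "conormal m (int m) S (\<lambda>x. u x - (\<Sum>k<m. radial_term h g k x))" if m: "m \<le> M" for m
  proof -
    \<comment> \<open>Beyond both gradings and beyond \<open>m\<close>; the successor is there
      because the sum over \<open>g\<close> is one term shorter.\<close>
    define N where "N = Suc (n + n' + m)"
    have PQN: "P x + norm x * Q x = (\<Sum>k<N. radial_term h g k x)" for x
      unfolding N_def sum_radial_term using h(2)[of "N" x] g(2)[of "n + n' + m" x] by (simp add: N_def)
    have "conormal m (int m) S (\<lambda>x. u x - (P x + norm x * Q x))"
      by (rule conormal_mono[OF _ conormal_mono_order[OF m PQ(3)]]) (use m in simp)
    moreover have "conormal m (int m) S (\<lambda>x. \<Sum>k\<in>{m..<N}. radial_term h g k x)"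
      by (rule conormal_sum[OF S], rule conormal_mono[OF _ radial_term_conormal[OF h(1) g(1)]]) simp
    ultimately have "conormal m (int m) S (\<lambda>x. (u x - (P x + norm x * Q x)) + (\<Sum>k\<in>{m..<N}. radial_term h g k x))"
      by (rule conormal_add[OF S])
    moreover have "(u x - (P x + norm x * Q x)) + (\<Sum>k\<in>{m..<N}. radial_term h g k x)
        = u x - (\<Sum>k<m. radial_term h g k x)" for x
    proof -
      have "(\<Sum>k<N. radial_term h g k x) = (\<Sum>k<m. radial_term h g k x) + (\<Sum>k\<in>{m..<N}. radial_term h g k x)"
        using sum.atLeastLessThan_concat[of 0 m N "\<lambda>k. radial_term h g k x"]
        by (simp add: N_def atLeast0LessThan)
      then show ?thesis by (simp add: PQN)
    qed
    ultimately show ?thesis by simp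
  qed
  then show ?thesis using h(1) g(1) by blast
qed

text \<open>Only the sums \<open>h k + r g (k-1)\<close> need to agree between expansions of different order; how
  such a sum is split into its two parts may be chosen freely for each \<open>k\<close>.\<close>

theorem expandable_imp_Einf_on:
  assumes "continuous_on S u" "\<And>m. expandable m (int m) S u"
  shows "Einf_on S u"
proof -
  have "\<forall>M. \<exists>h g. (\<forall>k. homogeneous k (h k)) \<and> (\<forall>k. homogeneous k (g k))
    \<and> (\<forall>m\<le>M. conormal m (int m) S (\<lambda>x. u x - (\<Sum>k<m. radial_term h g k x)))"
    using expandable_graded[OF assms(2)] by blast
  then obtain h g where h: "\<And>M k. homogeneous k (h M k)" and g: "\<And>M k. homogeneous k (g M k)"
    and e: "\<And>M m. m \<le> M \<Longrightarrow> conormal m (int m) S (\<lambda>x. u x - (\<Sum>k<m. radial_term (h M) (g M) k x))"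
    by metis
  \<comment> \<open>Two truncations of \<open>u\<close> at order M differ by O(r^M), so their terms
    of degree below M agree.\<close>
  have unique: "radial_term (h M) (g M) k x = radial_term (h M') (g M') k x"
    if "M \<le> M'" "k < M" "x \<noteq> 0" for M M' k x
  proof -
    let ?t = "\<lambda>k x. radial_term (h M) (g M) k x - radial_term (h M') (g M') k x"
    have "conormal M (int M) S (\<lambda>x. \<Sum>k<M. ?t k x)"
      using conormal_diff[OF S e[OF that(1)] e[OF order.refl]] by (simp add: sum_subtractf)
    then have "(\<lambda>x. \<Sum>k<M. ?t k x) \<in> O[at 0](\<lambda>x. norm x powi int M)" by (rule conormal_bigo)
    from graded_bigo_terms_zero[of ?t, OF _ this that(2,2,3)]
    show ?thesis by (simp add: radial_term_scale[OF h g] algebra_simps)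
  qed
  define p where "p k = h (Suc k) k" for k
  \<comment> \<open>The extra successor makes \<open>q (k - 1)\<close> come from the same expansion,
    number \<open>k + 1\<close>, as \<open>p k\<close>; only then is the combined term the one
    covered by \<open>unique\<close>.\<close>
  define q where "q k = g (Suc (Suc k)) k" for k
  have hp: "homogeneous k (p k)" and hq: "homogeneous k (q k)" for k
    by (simp_all add: p_def q_def h g)
  have pq: "radial_term p q k = radial_term (h (Suc k)) (g (Suc k)) k" for k
    by (cases k) (auto simp: radial_term_def p_def q_def)
  have u: "conormal m (int m) S (\<lambda>x. u x - (\<Sum>k<m. radial_term p q k x))" for m
  proof (rule conormal_cong[OF S _ e[of m m]])
    fix x assume "x \<in> S - {0}"
    then have "(\<Sum>k<m. radial_term (h m) (g m) k x) = (\<Sum>k<m. radial_term p q k x)"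
      unfolding pq by (intro sum.cong refl unique[symmetric]) auto
    then show "u x - (\<Sum>k<m. radial_term (h m) (g m) k x) = u x - (\<Sum>k<m. radial_term p q k x)" by simp
  qed simp
  obtain f1 where f1: "smooth_on UNIV f1" "\<And>m. conormal m (int m) UNIV (\<lambda>x. f1 x - (\<Sum>k<m. p k x))"
    using borel_expansion[OF hp] by blast
  obtain f2 where f2: "smooth_on UNIV f2" "\<And>m. conormal m (int m) UNIV (\<lambda>x. f2 x - (\<Sum>k<m. q k x))"
    using borel_expansion[OF hq] by blast
  define \<rho> where "\<rho> x = u x - f1 x - norm x * f2 x" for x
  \<comment> \<open>Order \<open>m + 1\<close> for \<open>m\<close> derivatives, as the strict
    inequality in \<open>conormal_imp_Ck_on\<close> requires. The series for f2 may stop one term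
    earlier because of the factor r.\<close>
  have \<rho>: "conormal m (int m + 1) S \<rho>" for m
  proof -
    have 1: "conormal m (int m + 1) S (\<lambda>x. u x - (\<Sum>k<Suc m. radial_term p q k x))"
      using conormal_mono_order[OF _ u[of "Suc m"], of m] by (simp add: add.commute)
    have 2: "conormal m (int m + 1) S (\<lambda>x. f1 x - (\<Sum>k<Suc m. p k x))"
      using conormal_mono_order[OF _ conormal_subset[OF subset_UNIV f1(2)[of "Suc m"]], of m]
      by (simp add: add.commute)
    have 3: "conormal m (int m + 1) S (\<lambda>x. norm x * (f2 x - (\<Sum>k<m. q k x)))"
      using conormal_mult[OF S conormal_norm[OF S] conormal_subset[OF subset_UNIV f2(2)[of m]]]
      by (simp add: add.commute)
    have "(\<lambda>x. (u x - (\<Sum>k<Suc m. radial_term p q k x)) - (f1 x - (\<Sum>k<Suc m. p k x))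
        - norm x * (f2 x - (\<Sum>k<m. q k x))) = \<rho>"
      unfolding sum_radial_term by (simp add: \<rho>_def fun_eq_iff algebra_simps)
    then show ?thesis using conormal_diff[OF S conormal_diff[OF S 1 2] 3] by simp
  qed
  \<comment> \<open>The symbol estimates ignore the origin; continuity supplies the value 0
    there.\<close>
  have "continuous_on S \<rho>"
    unfolding \<rho>_def
    by (intro continuous_intros assms(1) continuous_on_subset[OF smooth_on_continuous[OF f1(1)]]
        continuous_on_subset[OF smooth_on_continuous[OF f2(1)]] subset_UNIV)
  then have "(\<rho> \<longlongrightarrow> \<rho> 0) (at 0)" using S by (simp add: continuous_on_eq_continuous_at isCont_def)
  moreover have "(\<rho> \<longlongrightarrow> 0) (at 0)"
    by (rule bigo_norm_powi_tendsto_0[OF conormal_bigo[OF \<rho>[of 0]]]) simp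
  ultimately have "\<rho> 0 = 0" by (rule tendsto_unique[rotated]) simp
  then have "smooth_on S \<rho>"
    unfolding smooth_on_def using conormal_imp_Ck_on[OF S \<rho>] by simp
  then have "smooth_on S (\<lambda>x. f1 x + \<rho> x)"
    by (intro smooth_on_add S smooth_on_subset[OF subset_UNIV f1(1)])
  moreover have "smooth_on S f2" by (rule smooth_on_subset[OF subset_UNIV f2(1)])
  ultimately show ?thesis
    unfolding Einf_on_def by (intro exI[of _ "\<lambda>x. f1 x + \<rho> x"] exI[of _ f2]) (simp add: \<rho>_def)
qed

lemma expandable_bootstrap:
  assumes u: "Ck_on 2 S u" "\<And>x. x \<in> S \<Longrightarrow> u x \<ge> 0"
    and f: "smooth_on S f1" "smooth_on S f2"
    and eq: "\<And>x. x \<in> S \<Longrightarrow> laplacian u x = - ((f1 x + norm x * f2 x)^2 / (1 + norm x * u x)^7)"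
    and m: "expandable (Suc m) (int (Suc m)) S u"
  shows "expandable (Suc (Suc m)) (int (Suc (Suc m))) S u"
proof -
  \<comment> \<open>The right-hand side is expanded to an order one higher than the number of
    derivatives, thanks to the factor r in the denominator; the data f1 and f2 admit any
    order.\<close>
  let ?m = "Suc m" and ?s = "int (Suc m) + 1"
  define F where "F x = - 1 * ((f1 x + norm x * f2 x)^2 * (inverse (1 + norm x * u x))^7)" for x
  have "expandable ?m ?s S (\<lambda>x. norm x * f2 x)"
    by (intro expandable_mult[OF S] expandable_radial_poly[OF S] radial_poly_norm smooth_on_expandable[OF S] f) simp
  with smooth_on_expandable[OF S f(1)] have "expandable ?m ?s S (\<lambda>x. f1 x + norm x * f2 x)"
    by (rule expandable_add[OF S])
  moreover have "expandable ?m ?s S (\<lambda>x. inverse (1 + norm x * u x))"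
    by (rule expandable_inverse_one_plus[OF S _ m u(2)]) auto
  ultimately have "expandable ?m ?s S F"
    unfolding F_def by (intro expandable_cmult[OF S] expandable_mult[OF S] expandable_power[OF S]) auto
  then obtain g where g: "radial_poly g" "conormal ?m ?s S (\<lambda>x. F x - g x)"
    by (auto simp: expandable_def)
  obtain h where h: "radial_poly h" "Ck_on 2 UNIV h" "\<And>x. x \<noteq> 0 \<Longrightarrow> laplacian h x = g x"
    using radial_poly_laplace_solvable[OF g(1)] by blast
  define v where "v x = u x + - 1 * h x" for x
  have hS: "Ck_on 2 S h" "Ck_on 2 S (\<lambda>x. - 1 * h x)"
    by (rule Ck_on_subset[OF subset_UNIV h(2)])
       (rule Ck_on_cmult[OF S(1) Ck_on_subset[OF subset_UNIV h(2)]])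
  have v: "Ck_on 2 S v" unfolding v_def by (rule Ck_on_add[OF S(1) u(1) hS(2)])
  have "laplacian v x = F x - g x" if "x \<in> S - {0}" for x
  proof -
    have "laplacian v x = laplacian u x + laplacian (\<lambda>x. - 1 * h x) x"
      unfolding v_def[abs_def] using that by (intro laplacian_add[OF S(1) _ u(1) hS(2)]) simp
    also have "laplacian (\<lambda>x. - 1 * h x) x = - 1 * laplacian h x"
      using that by (intro laplacian_cmult[OF S(1) _ hS(1)]) simp
    finally show ?thesis using eq[of x] h(3)[of x] that by (simp add: F_def divide_inverse power_inverse)
  qed
  then have R: "conormal ?m ?s S (laplacian v)"
    by (intro conormal_cong[OF S _ g(2)]) simp
  \<comment> \<open>The equation for v was only obtained off the origin. Since v is C^2, its
    Laplacian is continuous and must take the limit value 0 at the origin.\<close>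
  have "Ck_on (Suc (Suc 0)) S v" using v by (simp only: numeral_2_eq_2)
  then have "continuous_on S (laplacian v)"
    unfolding laplacian_def[abs_def] by (intro continuous_on_sum) simp
  then have "(laplacian v \<longlongrightarrow> laplacian v 0) (at 0)"
    using S by (simp add: continuous_on_eq_continuous_at isCont_def)
  moreover have "(laplacian v \<longlongrightarrow> 0) (at 0)"
    by (rule bigo_norm_powi_tendsto_0[OF conormal_bigo[OF R]]) simp
  ultimately have "laplacian v 0 = 0" by (rule tendsto_unique[rotated]) simp
  then have "Ck_on (Suc m) S (laplacian v)"
    by (intro conormal_imp_Ck_on[OF S R]) simp_all
  then have "Ck_on (Suc (Suc m)) S v" by (rule laplacian_regularity[OF S(1) v])
  then have "expandable (Suc (Suc m)) (int (Suc (Suc m))) S (\<lambda>x. v x + h x)"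
    by (intro expandable_add[OF S] Ck_on_expandable[OF S] expandable_radial_poly[OF S] h(1))
  moreover have "(\<lambda>x. v x + h x) = u" by (simp add: v_def fun_eq_iff)
  ultimately show ?thesis by simp
qed

end

theorem theorem6:
  fixes a \<alpha> :: real and \<Psi> u :: "real^3 \<Rightarrow> real"
  assumes "0 < \<alpha>" "\<alpha> < 1"
    and "Einf_on (ball 0 a) \<Psi>"
    and "C2alpha_on \<alpha> (ball 0 a) u"
    and "\<forall>x\<in>ball 0 a. u x \<ge> 0"
    and "\<forall>x\<in>ball 0 a. laplacian u x = - ((\<Psi> x)^2 / (1 + norm x * u x)^7)"
  shows "Einf_on (ball 0 a) u"
proof (cases "a > 0")
  case False
  then have "x \<notin> ball 0 a" for x :: "real^3"
    using order.strict_trans1[OF norm_ge_zero[of x], of a] by auto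
  then show ?thesis
    unfolding Einf_on_def by (intro exI[of _ "\<lambda>_. 0"] conjI ballI smooth_on_const) blast
next
  case True
  then have S: "open (ball 0 a :: (real^3) set)" "0 \<in> (ball 0 a :: (real^3) set)" by auto
  have C2: "Ck_on 2 (ball 0 a) u" using assms(4) by (simp add: C2alpha_on_def)
  obtain f1 f2 where f: "smooth_on (ball 0 a) f1" "smooth_on (ball 0 a) f2"
    "\<And>x. x \<in> ball 0 a \<Longrightarrow> \<Psi> x = f1 x + norm x * f2 x"
    using assms(3) unfolding Einf_on_def by blast
  \<comment> \<open>The induction starts at order 2, with the Taylor polynomial of the C^2 function
    \<open>u\<close>; lower orders follow afterwards by weakening.\<close>
  have step: "expandable (Suc (Suc m)) (int (Suc (Suc m))) (ball 0 a) u" for m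
  proof (induction m)
    case 0
    then show ?case using Ck_on_expandable[OF S C2] by (simp add: numeral_2_eq_2)
  next
    case (Suc m)
    show ?case
      by (rule expandable_bootstrap[OF S C2 _ f(1,2) _ Suc]) (use assms(5,6) f(3) in auto)
  qed
  have "expandable m (int m) (ball 0 a) u" for m
  proof -
    obtain g where g: "radial_poly g" "conormal (Suc (Suc m)) (int (Suc (Suc m))) (ball 0 a) (\<lambda>x. u x - g x)"
      using step[of m] by (auto simp: expandable_def simp del: conormal.simps)
    have "conormal m (int m) (ball 0 a) (\<lambda>x. u x - g x)"
      by (rule conormal_mono[OF _ conormal_mono_order[OF _ g(2)]]) simp_all
    with g(1) show ?thesis by (rule expandableI)
  qed
  then show ?thesis by (rule expandable_imp_Einf_on[OF S Ck_on_imp_continuous[OF C2]])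
qed

end
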